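(* Let $k,n\ge 1$ be integers. The symplectic quotient $M_{0,k,n}$ is $\mathbb{Z}^+$-graded regularly symplectomorphic to a linear symplectic orbifold if and only if $k=1$ or $n=1$. Likewise, the symplectic quotient $M_{0,k,n}^{SO}$ is $\mathbb{Z}^+$-graded regularly symplectomorphic to a linear symplectic orbifold if and only if $k=1$ or $n=1$.
   Context: Let $V=V_{k,n}=(\mathbb{R}^n)^{2k}$ with points $y=(y_1,\dots,y_{2k})$, $y_i=(y_{i,1},\dots,y_{i,n})\in\mathbb{R}^n$; write $q_{\ell,\alpha}=y_{2\ell-1,\alpha}$ and $p_{\ell,\alpha}=y_{2\ell,\alpha}$ for $\ell=1,\dots,k$. $\mathbb{R}[V]$ is $\mathbb{Z}^+$-graded ($\mathbb{Z}^+$ = nonnegative integers) with all coordinates in degree 1 and carries the Poisson bracket with $\{q_{\ell_1,\alpha},p_{\ell_2,\beta}\}=\delta_{\ell_1,\ell_2}\delta_{\alpha,\beta}$, all other brackets of coordinates being zero. The groups $O_n$ and $SO_n$ (real orthogonal and special orthogonal groups) act diagonally on $V$. For $1\le\alpha<\beta\le n$ set $J_{\alpha,\beta}=\sum_{\ell=1}^k (q_{\ell,\alpha}p_{\ell,\beta}-q_{\ell,\beta}p_{\ell,\alpha})$ (components of the moment map), and let $Z\subset V$ be their common zero set. For $G=O_n$ or $SO_n$, the symplectic quotient is $Z/G$ with the quotient topology, denoted $M_{0,k,n}$ for $G=O_n$ and $M_{0,k,n}^{SO}$ for $G=SO_n$. Its algebra of regular functions is $\mathbb{R}[V]^{G}/\mathcal{I}_Z^{G}$,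 where $\mathcal{I}_Z^{G}$ is the ideal of $G$-invariant polynomials vanishing on $Z$; it is a graded algebra of functions on $Z/G$ and inherits a Poisson bracket from $\mathbb{R}[V]$. A linear symplectic orbifold is a quotient $\mathbb{C}^N/\Gamma$ with $\Gamma$ a finite subgroup of the unitary group $U_N$; its algebra of regular functions is the algebra $\mathbb{R}[\mathbb{C}^N]^\Gamma$ of $\Gamma$-invariant real polynomials on the underlying real vector space $\mathbb{R}^{2N}$, graded by degree and with the Poisson bracket of the standard symplectic structure on $\mathbb{C}^N$ ($\{q_i,p_j\}=\delta_{i,j}$, where the complex coordinates are $q_i+\sqrt{-1}\,p_i$). Two such spaces $M,M'$ are $\mathbb{Z}^+$-graded regularly symplectomorphic if there is an isomorphism $\mathbb{R}[M']\to\mathbb{R}[M]$ of $\mathbb{Z}^+$-graded Poisson algebras whose induced homeomorphism of Zariski closures (the spaces being embedded as semialgebraic sets by homogeneous generators of their algebras of regular functions) restricts to a homeomorphism $M\to M'$; equivalently, there is a homeomorphism $\chi\colon M\to M'$ such that $f\mapsto f\circ\chi$ is an isomorphism $\mathbb{R}[M']\to\mathbb{R}[M]$ of graded Poisson algebras. *)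

theory Defs
  imports
    "HOL-Analysis.Function_Topology"
    "HOL-Analysis.Derivative"
    "HOL-Algebra.Group_Action"
    "Jordan_Normal_Form.Determinant"
    "Jordan_Normal_Form.Schur_Decomposition"
begin

section \<open>The phase space\<close>

text \<open>
  Indices start at 0, as in the matrix library: the block \<open>y\<^sub>i\<close> of the usual notation is
  \<open>\<lambda>\<alpha>. y (i - 1, \<alpha> - 1)\<close>, so that \<open>q\<^sub>\<ell>\<close> and \<open>p\<^sub>\<ell>\<close> are the blocks \<open>2\<ell>\<close> and \<open>2\<ell> + 1\<close>
  for \<open>\<ell> < k\<close>.  Points of \<open>V\<close> are total functions that vanish outside the index set; the topology is
  the one induced by the product topology on functions.
\<close>

type_synonym point = "nat \<times> nat \<Rightarrow> real"

definition coords :: "nat \<Rightarrow> nat \<Rightarrow> (nat \<times> nat) set" where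
  "coords k n = {..<2 * k} \<times> {..<n}"

definition phase_space :: "nat \<Rightarrow> nat \<Rightarrow> point set" where
  "phase_space k n = {y. \<forall>c. c \<notin> coords k n \<longrightarrow> y c = 0}"

text \<open>
  As the reals are infinite, polynomials on \<open>V\<close> are identified with polynomial functions; only the
  values on \<open>V\<close> matter.  The exponent vectors are the functions \<open>e\<close>.
\<close>

definition polynomial_on :: "nat \<Rightarrow> nat \<Rightarrow> (point \<Rightarrow> real) \<Rightarrow> bool" where
  "polynomial_on k n f \<longleftrightarrow>
     (\<exists>E a. finite E \<and>
        (\<forall>y\<in>phase_space k n. f y = (\<Sum>e\<in>E. a e * (\<Prod>c\<in>coords k n. y c ^ e c))))"

definition homogeneous_on :: "nat \<Rightarrow> nat \<Rightarrow> nat \<Rightarrow> (point \<Rightarrow> real) \<Rightarrow> bool" where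
  "homogeneous_on k n d f \<longleftrightarrow>
     (\<exists>E a. finite E \<and> (\<forall>e\<in>E. (\<Sum>c\<in>coords k n. e c) = d) \<and>
        (\<forall>y\<in>phase_space k n. f y = (\<Sum>e\<in>E. a e * (\<Prod>c\<in>coords k n. y c ^ e c))))"

definition partial :: "nat \<times> nat \<Rightarrow> (point \<Rightarrow> real) \<Rightarrow> point \<Rightarrow> real" where
  "partial c f y = deriv (\<lambda>t. f (y(c := t))) (y c)"

definition poisson :: "nat \<Rightarrow> nat \<Rightarrow> (point \<Rightarrow> real) \<Rightarrow> (point \<Rightarrow> real) \<Rightarrow> point \<Rightarrow> real" where
  "poisson k n f g y =
     (\<Sum>l<k. \<Sum>\<alpha><n. partial (2 * l, \<alpha>) f y * partial (2 * l + 1, \<alpha>) g y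
                   - partial (2 * l + 1, \<alpha>) f y * partial (2 * l, \<alpha>) g y)"

definition moment_zero_set :: "nat \<Rightarrow> nat \<Rightarrow> point set" where
  "moment_zero_set k n =
     {y \<in> phase_space k n. \<forall>\<alpha> \<beta>. \<alpha> < \<beta> \<and> \<beta> < n \<longrightarrow>
        (\<Sum>l<k. y (2 * l, \<alpha>) * y (2 * l + 1, \<beta>) - y (2 * l, \<beta>) * y (2 * l + 1, \<alpha>)) = 0}"

section \<open>The groups and their actions\<close>

text \<open>\<^const>\<open>orthogonal_mat\<close> only demands that \<open>A\<^sup>TA\<close> be an invertible diagonal matrix,
  hence it is not used here.\<close>

definition orthogonal_group :: "nat \<Rightarrow> real mat monoid" where
  "orthogonal_group n =
     \<lparr>carrier = {A \<in> carrier_mat n n. transpose_mat A * A = 1\<^sub>m n}, mult = (*), one = 1\<^sub>m n\<rparr>"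

definition special_orthogonal_group :: "nat \<Rightarrow> real mat monoid" where
  "special_orthogonal_group n =
     orthogonal_group n\<lparr>carrier := {A \<in> carrier (orthogonal_group n). det A = 1}\<rparr>"

definition unitary_group :: "nat \<Rightarrow> complex mat monoid" where
  "unitary_group N =
     \<lparr>carrier = {A \<in> carrier_mat N N. mat_adjoint A * A = 1\<^sub>m N}, mult = (*), one = 1\<^sub>m N\<rparr>"

definition diagonal_action :: "nat \<Rightarrow> nat \<Rightarrow> real mat \<Rightarrow> point \<Rightarrow> point" where
  "diagonal_action k n A = (\<lambda>y\<in>phase_space k n. \<lambda>(i, \<alpha>).
     if (i, \<alpha>) \<in> coords k n then \<Sum>\<beta><n. A $$ (\<alpha>, \<beta>) * y (i, \<beta>) else 0)"

text \<open>
  The real symplectic vector space underlying \<open>\<complex>\<^sup>N\<close> is \<^term>\<open>phase_space 1 N\<close>, with complex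
  coordinates \<open>z\<^sub>j = y (0, j) + \<i> y (1, j)\<close>.
\<close>

definition complex_coord :: "point \<Rightarrow> nat \<Rightarrow> complex" where
  "complex_coord y j = Complex (y (0, j)) (y (1, j))"

definition unitary_action :: "nat \<Rightarrow> complex mat \<Rightarrow> point \<Rightarrow> point" where
  "unitary_action N A = (\<lambda>y\<in>phase_space 1 N. \<lambda>(i, j).
     if (i, j) \<in> coords 1 N
     then let w = (\<Sum>m<N. A $$ (j, m) * complex_coord y m) in if i = 0 then Re w else Im w
     else 0)"

section \<open>Spaces with graded Poisson algebras of functions\<close>

text \<open>
  Functions on a space \<open>M\<close> are represented by functions that are \<^const>\<open>extensional\<close> on its
  points \<^term>\<open>topspace (space_topology M)\<close>.  The Poisson bracket is given by its graph:
  \<^term>\<open>bracket_graph M F G H\<close> means \<open>{F, G} = H\<close>.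
\<close>

record 'p poisson_space =
  space_topology :: "'p topology"
  regular_functions :: "('p \<Rightarrow> real) set"
  graded_part :: "nat \<Rightarrow> ('p \<Rightarrow> real) set"
  bracket_graph :: "('p \<Rightarrow> real) \<Rightarrow> ('p \<Rightarrow> real) \<Rightarrow> ('p \<Rightarrow> real) \<Rightarrow> bool"

abbreviation points :: "'p poisson_space \<Rightarrow> 'p set" where
  "points M \<equiv> topspace (space_topology M)"

definition orbit_topology ::
  "('g, 'm) monoid_scheme \<Rightarrow> ('g \<Rightarrow> point \<Rightarrow> point) \<Rightarrow> point set \<Rightarrow> point set topology" where
  "orbit_topology G \<phi> Z = topology (\<lambda>U. U \<subseteq> orbits G Z \<phi> \<and>
     openin (top_of_set Z) {z \<in> Z. orbit G \<phi> z \<in> U})"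

definition invariant_on :: "('g, 'm) monoid_scheme \<Rightarrow> ('g \<Rightarrow> point \<Rightarrow> point) \<Rightarrow> point set \<Rightarrow>
    (point \<Rightarrow> real) \<Rightarrow> bool" where
  "invariant_on G \<phi> V f \<longleftrightarrow> (\<forall>g\<in>carrier G. \<forall>y\<in>V. f (\<phi> g y) = f y)"

text \<open>
  The function on orbits induced by an invariant function; the chosen representative is irrelevant.
  Two invariant polynomials induce the same function on the orbits in \<open>Z\<close> iff they differ by an
  element of \<open>\<I>\<^sub>Z\<^sup>G\<close>.
\<close>

definition descend :: "('g, 'm) monoid_scheme \<Rightarrow> ('g \<Rightarrow> point \<Rightarrow> point) \<Rightarrow> point set \<Rightarrow>
    (point \<Rightarrow> real) \<Rightarrow> point set \<Rightarrow> real" where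
  "descend G \<phi> Z f = (\<lambda>x\<in>orbits G Z \<phi>. f (SOME z. z \<in> x))"

text \<open>
  The quotient \<open>Z/G\<close> of a \<open>G\<close>-stable subset \<open>Z\<close> of \<^term>\<open>phase_space k n\<close>, with the algebra
  \<open>\<real>[V]\<^sup>G/\<I>\<^sub>Z\<^sup>G\<close>.  The bracket is inherited from \<open>\<real>[V]\<^sup>G\<close>: two classes have as bracket the class of
  the bracket of representatives; this is single-valued as \<open>\<I>\<^sub>Z\<^sup>G\<close> is a Poisson ideal.
\<close>

definition quotient_space :: "nat \<Rightarrow> nat \<Rightarrow> point set \<Rightarrow> ('g, 'm) monoid_scheme \<Rightarrow>
    ('g \<Rightarrow> point \<Rightarrow> point) \<Rightarrow> point set poisson_space" where
  "quotient_space k n Z G \<phi> =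
     \<lparr>space_topology = orbit_topology G \<phi> Z,
      regular_functions =
        descend G \<phi> Z ` {f. polynomial_on k n f \<and> invariant_on G \<phi> (phase_space k n) f},
      graded_part = (\<lambda>d.
        descend G \<phi> Z ` {f. homogeneous_on k n d f \<and> invariant_on G \<phi> (phase_space k n) f}),
      bracket_graph = (\<lambda>F G' H. \<exists>f g.
        polynomial_on k n f \<and> invariant_on G \<phi> (phase_space k n) f \<and> descend G \<phi> Z f = F \<and>
        polynomial_on k n g \<and> invariant_on G \<phi> (phase_space k n) g \<and> descend G \<phi> Z g = G' \<and>
        descend G \<phi> Z (poisson k n f g) = H)\<rparr>"

definition symplectic_quotient_O :: "nat \<Rightarrow> nat \<Rightarrow> point set poisson_space" where
  "symplectic_quotient_O k n =
     quotient_space k n (moment_zero_set k n) (orthogonal_group n) (diagonal_action k n)"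

definition symplectic_quotient_SO :: "nat \<Rightarrow> nat \<Rightarrow> point set poisson_space" where
  "symplectic_quotient_SO k n =
     quotient_space k n (moment_zero_set k n) (special_orthogonal_group n) (diagonal_action k n)"

definition linear_symplectic_orbifold :: "nat \<Rightarrow> complex mat set \<Rightarrow> point set poisson_space" where
  "linear_symplectic_orbifold N \<Gamma> =
     quotient_space 1 N (phase_space 1 N) (unitary_group N\<lparr>carrier := \<Gamma>\<rparr>) (unitary_action N)"

definition graded_poisson_iso ::
  "'p poisson_space \<Rightarrow> 'q poisson_space \<Rightarrow> (('p \<Rightarrow> real) \<Rightarrow> 'q \<Rightarrow> real) \<Rightarrow> bool" where
  "graded_poisson_iso M N \<Phi> \<longleftrightarrow>
     bij_betw \<Phi> (regular_functions M) (regular_functions N) \<and>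
     \<Phi> (\<lambda>x\<in>points M. 1) = (\<lambda>x\<in>points N. 1) \<and>
     (\<forall>c. \<forall>F\<in>regular_functions M.
        \<Phi> (\<lambda>x\<in>points M. c * F x) = (\<lambda>x\<in>points N. c * \<Phi> F x)) \<and>
     (\<forall>F\<in>regular_functions M. \<forall>G\<in>regular_functions M.
        \<Phi> (\<lambda>x\<in>points M. F x + G x) = (\<lambda>x\<in>points N. \<Phi> F x + \<Phi> G x) \<and>
        \<Phi> (\<lambda>x\<in>points M. F x * G x) = (\<lambda>x\<in>points N. \<Phi> F x * \<Phi> G x)) \<and>
     (\<forall>d. \<Phi> ` graded_part M d = graded_part N d) \<and>
     (\<forall>F\<in>regular_functions M. \<forall>G\<in>regular_functions M. \<forall>H\<in>regular_functions M.
        bracket_graph M F G H \<longleftrightarrow> bracket_graph N (\<Phi> F) (\<Phi> G) (\<Phi> H))"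

definition graded_regularly_symplectomorphic ::
  "'p poisson_space \<Rightarrow> 'q poisson_space \<Rightarrow> bool" where
  "graded_regularly_symplectomorphic M M' \<longleftrightarrow>
     (\<exists>h. homeomorphic_map (space_topology M) (space_topology M') h \<and>
          graded_poisson_iso M' M (\<lambda>F. \<lambda>x\<in>points M. F (h x)))"

section \<open>Basic properties\<close>

lemma quotient_map_orbit_topology:
  "quotient_map (top_of_set Z) (orbit_topology G \<phi> Z) (orbit G \<phi>)"
proof -
  let ?P = "\<lambda>U. U \<subseteq> orbits G Z \<phi> \<and> openin (top_of_set Z) {z \<in> Z. orbit G \<phi> z \<in> U}"
  have "istopology ?P"
    unfolding istopology_def
  proof (intro conjI allI impI)
    fix S T assume "?P S" "?P T"
    moreover have "{z \<in> Z. orbit G \<phi> z \<in> S \<inter> T}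
        = {z \<in> Z. orbit G \<phi> z \<in> S} \<inter> {z \<in> Z. orbit G \<phi> z \<in> T}" by auto
    ultimately show "S \<inter> T \<subseteq> orbits G Z \<phi>"
      "openin (top_of_set Z) {z \<in> Z. orbit G \<phi> z \<in> S \<inter> T}" by auto
  next
    fix K assume K: "Ball K ?P"
    then show "\<Union> K \<subseteq> orbits G Z \<phi>" by auto
    have "{z \<in> Z. orbit G \<phi> z \<in> \<Union> K} = (\<Union>S\<in>K. {z \<in> Z. orbit G \<phi> z \<in> S})" by auto
    then show "openin (top_of_set Z) {z \<in> Z. orbit G \<phi> z \<in> \<Union> K}"
      using K by auto
  qed
  then have op: "openin (orbit_topology G \<phi> Z) U \<longleftrightarrow> ?P U" for U
    by (simp add: orbit_topology_def)
  have "{z \<in> Z. orbit G \<phi> z \<in> orbits G Z \<phi>} = Z"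
    by (auto simp: orbits_def)
  then have "openin (orbit_topology G \<phi> Z) (orbits G Z \<phi>)"
    by (simp add: op)
  then have "topspace (orbit_topology G \<phi> Z) = orbits G Z \<phi>"
    by (metis op openin_subset openin_topspace subset_antisym)
  then show ?thesis
    by (auto simp: quotient_map_def op orbits_def)
qed

lemma poisson_coords:
  assumes "l < k" "m < k" "\<alpha> < n" "\<beta> < n"
  shows "poisson k n (\<lambda>y. y (2 * l, \<alpha>)) (\<lambda>y. y (2 * m + 1, \<beta>)) y
           = (if l = m \<and> \<alpha> = \<beta> then 1 else 0)"
    and "poisson k n (\<lambda>y. y (2 * l, \<alpha>)) (\<lambda>y. y (2 * m, \<beta>)) y = 0"
    and "poisson k n (\<lambda>y. y (2 * l + 1, \<alpha>)) (\<lambda>y. y (2 * m + 1, \<beta>)) y = 0"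
proof -
  have par: "partial c (\<lambda>y. y b) y = (if b = c then 1 else 0)" for b c :: "nat \<times> nat"
    by (auto simp: partial_def)
  have odd: "Suc (2 * a) \<noteq> 2 * b" "2 * b \<noteq> Suc (2 * a)" for a b :: nat
    by presburger+
  show "poisson k n (\<lambda>y. y (2 * l, \<alpha>)) (\<lambda>y. y (2 * m, \<beta>)) y = 0"
    and "poisson k n (\<lambda>y. y (2 * l + 1, \<alpha>)) (\<lambda>y. y (2 * m + 1, \<beta>)) y = 0"
    by (auto simp: poisson_def par odd intro!: sum.neutral)
  have "poisson k n (\<lambda>y. y (2 * l, \<alpha>)) (\<lambda>y. y (2 * m + 1, \<beta>)) y
      = (\<Sum>l'<k. \<Sum>\<alpha>'<n. if \<alpha>' = \<alpha> then (if l' = l \<and> l = m \<and> \<alpha> = \<beta> then 1 else 0) else 0)"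
    unfolding poisson_def par by (intro sum.cong refl) (auto simp: odd)
  also have "\<dots> = (\<Sum>l'<k. if l' = l then (if l = m \<and> \<alpha> = \<beta> then 1 else 0) else 0)"
    using assms by (intro sum.cong) auto
  also have "\<dots> = (if l = m \<and> \<alpha> = \<beta> then 1 else 0)"
    using assms by simp
  finally show "poisson k n (\<lambda>y. y (2 * l, \<alpha>)) (\<lambda>y. y (2 * m + 1, \<beta>)) y
      = (if l = m \<and> \<alpha> = \<beta> then 1 else 0)" .
qed

lemma mult_mat_regroup:
  fixes A B C D :: "'a :: semiring_0 mat"
  assumes "A \<in> carrier_mat n n" "B \<in> carrier_mat n n" "C \<in> carrier_mat n n" "D \<in> carrier_mat n n"
  shows "(A * B) * (C * D) = A * (B * C) * D"
proof -
  have "(A * B) * (C * D) = A * (B * (C * D))"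
    using assms by (intro assoc_mult_mat[of _ n n _ n _ n]) auto
  also have "B * (C * D) = (B * C) * D"
    using assms by (intro assoc_mult_mat[of _ n n _ n _ n, symmetric]) auto
  also have "A * ((B * C) * D) = A * (B * C) * D"
    using assms by (intro assoc_mult_mat[of _ n n _ n _ n, symmetric]) auto
  finally show ?thesis .
qed

lemma group_orthogonal_group: "group (orthogonal_group n)"
proof (rule groupI; simp add: orthogonal_group_def left_mult_one_mat[of _ n n])
  fix A B :: "real mat"
  assume A: "A \<in> carrier_mat n n \<and> transpose_mat A * A = 1\<^sub>m n"
    and B: "B \<in> carrier_mat n n \<and> transpose_mat B * B = 1\<^sub>m n"
  have "transpose_mat (A * B) * (A * B) = transpose_mat B * (transpose_mat A * A) * B"
    using A B by (simp add: transpose_mult[of A n n B n] mult_mat_regroup[of _ n])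
  then show "A * B \<in> carrier_mat n n \<and> transpose_mat (A * B) * (A * B) = 1\<^sub>m n"
    using A B by auto
next
  fix A B C :: "real mat"
  assume "A \<in> carrier_mat n n \<and> transpose_mat A * A = 1\<^sub>m n"
    "B \<in> carrier_mat n n \<and> transpose_mat B * B = 1\<^sub>m n"
    "C \<in> carrier_mat n n \<and> transpose_mat C * C = 1\<^sub>m n"
  then show "A * B * C = A * (B * C)" by (simp add: assoc_mult_mat[of _ n n _ n _ n])
next
  fix A :: "real mat"
  assume A: "A \<in> carrier_mat n n \<and> transpose_mat A * A = 1\<^sub>m n"
  then have "A * transpose_mat A = 1\<^sub>m n"
    by (metis mat_mult_left_right_inverse transpose_carrier_mat)
  with A show "\<exists>B. B \<in> carrier_mat n n \<and> transpose_mat B * B = 1\<^sub>m n \<and> B * A = 1\<^sub>m n"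
    by (intro exI[of _ "transpose_mat A"]) auto
qed

lemma mat_adjoint_mult:
  fixes A B :: "complex mat"
  assumes "A \<in> carrier_mat n n" "B \<in> carrier_mat n n"
  shows "mat_adjoint (A * B) = mat_adjoint B * mat_adjoint A"
  using assms
  by (intro eq_matI)
     (auto simp: mat_adjoint_def mat_of_rows_def scalar_prod_def mult.commute intro!: sum.cong)

lemma group_unitary_group: "group (unitary_group N)"
proof -
  have adj: "mat_adjoint A \<in> carrier_mat N N" "mat_adjoint (mat_adjoint A) = A"
    if "A \<in> carrier_mat N N" for A :: "complex mat"
    using that by (auto simp: mat_adjoint_def mat_of_rows_def intro!: eq_matI)
  have adj1: "mat_adjoint (1\<^sub>m N) = (1\<^sub>m N :: complex mat)"
    by (intro eq_matI) (auto simp: mat_adjoint_def mat_of_rows_def)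
  show ?thesis
  proof (rule groupI; simp add: unitary_group_def adj1 left_mult_one_mat[of _ N N])
    fix A B :: "complex mat"
    assume A: "A \<in> carrier_mat N N \<and> mat_adjoint A * A = 1\<^sub>m N"
      and B: "B \<in> carrier_mat N N \<and> mat_adjoint B * B = 1\<^sub>m N"
    have "mat_adjoint (A * B) * (A * B) = mat_adjoint B * (mat_adjoint A * A) * B"
      using A B adj by (simp add: mat_adjoint_mult[of A N B] mult_mat_regroup[of _ N])
    also have "\<dots> = 1\<^sub>m N"
      using A B adj(1)[of B] by (simp add: right_mult_one_mat[of _ N N])
    finally show "A * B \<in> carrier_mat N N \<and> mat_adjoint (A * B) * (A * B) = 1\<^sub>m N"
      using A B by (simp add: mult_carrier_mat[of A N N B N])
  next
    fix A B C :: "complex mat"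
    assume "A \<in> carrier_mat N N \<and> mat_adjoint A * A = 1\<^sub>m N"
      "B \<in> carrier_mat N N \<and> mat_adjoint B * B = 1\<^sub>m N"
      "C \<in> carrier_mat N N \<and> mat_adjoint C * C = 1\<^sub>m N"
    then show "A * B * C = A * (B * C)" by (simp add: assoc_mult_mat[of _ N N _ N _ N])
  next
    fix A :: "complex mat"
    assume A: "A \<in> carrier_mat N N \<and> mat_adjoint A * A = 1\<^sub>m N"
    then have "A * mat_adjoint A = 1\<^sub>m N"
      by (metis mat_mult_left_right_inverse adj(1))
    with A adj show "\<exists>B. B \<in> carrier_mat N N \<and> mat_adjoint B * B = 1\<^sub>m N \<and> B * A = 1\<^sub>m N"
      by (intro exI[of _ "mat_adjoint A"]) auto
  qed
qed

lemma subgroup_special_orthogonal: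
  "subgroup (carrier (special_orthogonal_group n)) (orthogonal_group n)"
proof -
  interpret group "orthogonal_group n" by (rule group_orthogonal_group)
  let ?S = "carrier (special_orthogonal_group n)"
  have S: "?S = {A \<in> carrier (orthogonal_group n). det A = 1}"
    by (simp add: special_orthogonal_group_def)
  have det_mult: "det (A \<otimes>\<^bsub>orthogonal_group n\<^esub> B) = det A * det B"
    if "A \<in> carrier (orthogonal_group n)" "B \<in> carrier (orthogonal_group n)" for A B
    using that det_mult[of A n B] by (simp add: orthogonal_group_def)
  have det_one: "det \<one>\<^bsub>orthogonal_group n\<^esub> = 1"
    by (simp add: orthogonal_group_def)
  show ?thesis
  proof (rule subgroupI)
    show "?S \<subseteq> carrier (orthogonal_group n)" by (auto simp: S)
    show "?S \<noteq> {}" using det_one one_closed unfolding S by blast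
  next
    fix A assume "A \<in> ?S"
    then show "inv\<^bsub>orthogonal_group n\<^esub> A \<in> ?S"
      using det_mult[of "inv\<^bsub>orthogonal_group n\<^esub> A" A] det_one by (auto simp: S)
  next
    fix A B assume "A \<in> ?S" "B \<in> ?S"
    then show "A \<otimes>\<^bsub>orthogonal_group n\<^esub> B \<in> ?S"
      using det_mult by (auto simp: S)
  qed
qed

lemma group_actionI:
  assumes "group G"
    and ext: "\<And>g. g \<in> carrier G \<Longrightarrow> \<phi> g \<in> extensional E"
    and clo: "\<And>g x. g \<in> carrier G \<Longrightarrow> x \<in> E \<Longrightarrow> \<phi> g x \<in> E"
    and one: "\<And>x. x \<in> E \<Longrightarrow> \<phi> \<one>\<^bsub>G\<^esub> x = x"
    and mul: "\<And>g h x. g \<in> carrier G \<Longrightarrow> h \<in> carrier G \<Longrightarrow> x \<in> E \<Longrightarrow>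
                \<phi> (g \<otimes>\<^bsub>G\<^esub> h) x = \<phi> g (\<phi> h x)"
  shows "group_action G E \<phi>"
proof -
  interpret group G by fact
  have "bij_betw (\<phi> g) E E" if g: "g \<in> carrier G" for g
  proof (rule bij_betw_byWitness[where f' = "\<phi> (inv\<^bsub>G\<^esub> g)"])
    show "\<forall>a\<in>E. \<phi> (inv\<^bsub>G\<^esub> g) (\<phi> g a) = a" "\<forall>a\<in>E. \<phi> g (\<phi> (inv\<^bsub>G\<^esub> g) a) = a"
      using g one by (auto simp flip: mul)
    show "\<phi> g ` E \<subseteq> E" "\<phi> (inv\<^bsub>G\<^esub> g) ` E \<subseteq> E" using g clo by auto
  qed
  then have bij: "\<phi> g \<in> Bij E" if "g \<in> carrier G" for g
    using that ext by (simp add: Bij_def)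
  have "\<phi> (g \<otimes>\<^bsub>G\<^esub> h) = compose E (\<phi> g) (\<phi> h)" if "g \<in> carrier G" "h \<in> carrier G" for g h
    by (rule extensionalityI[of _ E]) (use that ext mul in \<open>auto simp: compose_def\<close>)
  then have "\<phi> \<in> hom G (BijGroup E)"
    using bij by (auto simp: hom_def BijGroup_def)
  then show ?thesis
    by (simp add: group_action_def group_hom_def group_hom_axioms_def group_BijGroup is_group)
qed

lemma group_action_orthogonal:
  "group_action (orthogonal_group n) (phase_space k n) (diagonal_action k n)"
proof (rule group_actionI[OF group_orthogonal_group])
  show "diagonal_action k n A \<in> extensional (phase_space k n)" for A
    by (simp add: diagonal_action_def)
  show cl: "diagonal_action k n A y \<in> phase_space k n" if "y \<in> phase_space k n" for A y
    using that by (auto simp: diagonal_action_def phase_space_def)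
  fix y assume y: "y \<in> phase_space k n"
  have "(\<Sum>\<beta><n. 1\<^sub>m n $$ (\<alpha>, \<beta>) * y (i, \<beta>)) = y (i, \<alpha>)" if "\<alpha> < n" for i \<alpha>
  proof -
    have "(\<Sum>\<beta><n. 1\<^sub>m n $$ (\<alpha>, \<beta>) * y (i, \<beta>)) = (\<Sum>\<beta><n. if \<beta> = \<alpha> then y (i, \<beta>) else 0)"
      using that by (intro sum.cong) auto
    then show ?thesis using that by simp
  qed
  then show "diagonal_action k n \<one>\<^bsub>orthogonal_group n\<^esub> y = y"
    using y by (auto simp: diagonal_action_def orthogonal_group_def phase_space_def coords_def fun_eq_iff)
  fix A B assume AB: "A \<in> carrier (orthogonal_group n)" "B \<in> carrier (orthogonal_group n)"
  have "(\<Sum>\<beta><n. (A * B) $$ (\<alpha>, \<beta>) * y (i, \<beta>))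
      = (\<Sum>\<gamma><n. A $$ (\<alpha>, \<gamma>) * (\<Sum>\<beta><n. B $$ (\<gamma>, \<beta>) * y (i, \<beta>)))" if "\<alpha> < n" for i \<alpha>
  proof -
    have "(\<Sum>\<beta><n. (A * B) $$ (\<alpha>, \<beta>) * y (i, \<beta>))
        = (\<Sum>\<beta><n. \<Sum>\<gamma><n. A $$ (\<alpha>, \<gamma>) * B $$ (\<gamma>, \<beta>) * y (i, \<beta>))"
      using AB that
      by (intro sum.cong) (auto simp: orthogonal_group_def scalar_prod_def sum_distrib_right
          atLeast0LessThan)
    also have "\<dots> = (\<Sum>\<gamma><n. \<Sum>\<beta><n. A $$ (\<alpha>, \<gamma>) * B $$ (\<gamma>, \<beta>) * y (i, \<beta>))"
      by (rule sum.swap)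
    finally show ?thesis by (simp add: sum_distrib_left mult.assoc)
  qed
  then have "diagonal_action k n (A * B) y = diagonal_action k n A (diagonal_action k n B y)"
    using y cl[OF y, of B]
    by (auto simp: diagonal_action_def[of k n A] diagonal_action_def[of k n "A * B"] fun_eq_iff)
       (auto simp: diagonal_action_def coords_def intro!: sum.cong)
  then show "diagonal_action k n (A \<otimes>\<^bsub>orthogonal_group n\<^esub> B) y
      = diagonal_action k n A (diagonal_action k n B y)"
    by (simp add: orthogonal_group_def)
qed

lemma group_action_unitary:
  "group_action (unitary_group N) (phase_space 1 N) (unitary_action N)"
proof (rule group_actionI[OF group_unitary_group])
  show "unitary_action N A \<in> extensional (phase_space 1 N)" for A
    by (simp add: unitary_action_def)
  show cl: "unitary_action N A y \<in> phase_space 1 N" if "y \<in> phase_space 1 N" for A y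
    using that by (auto simp: unitary_action_def phase_space_def)
  have cc: "complex_coord (unitary_action N A y) j = (\<Sum>m<N. A $$ (j, m) * complex_coord y m)"
    if "y \<in> phase_space 1 N" "j < N" for A y j
  proof -
    have "unitary_action N A y (0, j) = Re (\<Sum>m<N. A $$ (j, m) * complex_coord y m)"
      "unitary_action N A y (1, j) = Im (\<Sum>m<N. A $$ (j, m) * complex_coord y m)"
      using that by (simp_all add: unitary_action_def coords_def Let_def)
    then show ?thesis
      unfolding complex_coord_def[of "unitary_action N A y"] by (simp only: complex_surj)
  qed
  have eqI: "y = y'" if "y \<in> phase_space 1 N" "y' \<in> phase_space 1 N"
    "\<And>j. j < N \<Longrightarrow> complex_coord y j = complex_coord y' j" for y y'
  proof
    fix c :: "nat \<times> nat"
    obtain i j where c: "c = (i, j)" by force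
    show "y c = y' c"
    proof (cases "c \<in> coords 1 N")
      case True
      then have "i = 0 \<or> i = 1" "j < N" by (auto simp: c coords_def)
      then show ?thesis using that(3)[of j] by (auto simp: c complex_coord_def)
    next
      case False
      then have "y c = 0" "y' c = 0" using that(1,2) unfolding phase_space_def by blast+
      then show ?thesis by simp
    qed
  qed
  fix y assume y: "y \<in> phase_space 1 N"
  have "complex_coord (unitary_action N (1\<^sub>m N) y) j = complex_coord y j" if "j < N" for j
  proof -
    have "(\<Sum>m<N. 1\<^sub>m N $$ (j, m) * complex_coord y m)
        = (\<Sum>m<N. if m = j then complex_coord y m else 0)"
      using that by (intro sum.cong) auto
    then show ?thesis using that cc[OF y that] by simp
  qed
  then show "unitary_action N \<one>\<^bsub>unitary_group N\<^esub> y = y"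
    using eqI cl y by (simp add: unitary_group_def)
  fix A B assume AB: "A \<in> carrier (unitary_group N)" "B \<in> carrier (unitary_group N)"
  have "complex_coord (unitary_action N (A * B) y) j
      = complex_coord (unitary_action N A (unitary_action N B y)) j" if j: "j < N" for j
  proof -
    have "(\<Sum>m<N. (A * B) $$ (j, m) * complex_coord y m)
        = (\<Sum>m<N. \<Sum>l<N. A $$ (j, l) * B $$ (l, m) * complex_coord y m)"
      using AB j
      by (intro sum.cong) (auto simp: unitary_group_def scalar_prod_def sum_distrib_right
          atLeast0LessThan)
    also have "\<dots> = (\<Sum>l<N. \<Sum>m<N. A $$ (j, l) * B $$ (l, m) * complex_coord y m)"
      by (rule sum.swap)
    finally show ?thesis
      using y cl[OF y, of B] j by (simp add: cc sum_distrib_left mult.assoc)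
  qed
  then show "unitary_action N (A \<otimes>\<^bsub>unitary_group N\<^esub> B) y
      = unitary_action N A (unitary_action N B y)"
    using eqI cl y by (simp add: unitary_group_def)
qed

end

theory Submission
  imports Defs
begin

text \<open>
  For \<open>n = 1\<close> the quotient is \<open>\<complex>\<^sup>k\<close> modulo a group of signs.  For \<open>k = 1\<close> the zero set consists of
  the pairs \<open>(q, p) = (s u, t u)\<close> with \<open>u\<close> a unit vector, and \<open>(s, t)\<close> is determined up to sign.

  Let \<open>k, n \<ge> 2\<close> and suppose that the quotient is \<open>\<complex>\<^sup>N/\<Gamma>\<close>.  The invariants \<open>y\<^sub>j \<cdot> y\<^sub>j\<close> correspond to
  positive semidefinite quadratic forms \<open>s\<^sub>j\<close> on \<open>\<real>\<^sup>2\<^sup>N\<close> whose sum \<open>g\<close> is positive definite, and the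
  bracket with the form corresponding to \<open>q\<^sub>1 \<cdot> p\<^sub>1\<close> is a linear vector field under which the form \<open>a\<close>
  of \<open>q\<^sub>1 \<cdot> q\<^sub>1\<close> has weight 1, that of \<open>p\<^sub>1 \<cdot> p\<^sub>1\<close> has weight -1, and all others have weight 0.
  Comparing traces with respect to \<open>g\<close> forces \<open>a\<close> to be an orthogonal projection.  Hence a point \<open>z\<close>
  with \<open>q\<^sub>1 \<cdot> q\<^sub>1 = q\<^sub>2 \<cdot> q\<^sub>2 = 1\<close> and all other \<open>s\<^sub>j\<close> zero is a sum \<open>z' + z''\<close>, where only
  \<open>q\<^sub>1 \<cdot> q\<^sub>1 = 1\<close> is nonzero at \<open>z'\<close> and only \<open>q\<^sub>2 \<cdot> q\<^sub>2 = 1\<close> at \<open>z''\<close>.  As such \<open>z'\<close> and \<open>z''\<close> lie in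
  two single \<open>\<Gamma>\<close>-orbits, there are finitely many such \<open>z\<close>; but in the symplectic quotient the value
  of \<open>q\<^sub>1 \<cdot> q\<^sub>2\<close> is still arbitrary in \<open>[-1, 1]\<close>.
\<close>

section \<open>Positive semidefinite forms\<close>

text \<open>Nothing makes the forms \<open>s_j\<close> diagonal in a common basis. What is available
  is that their values are sums of squares at real points of the quotient, which makes them
  semidefinite, and their weights under one linear field. With \<open>g\<close> as inner product
  every \<open>s_j\<close> becomes an operator between 0 and 1. Let \<open>A\<close> and
  \<open>P\<close> be the operators of \<open>q_1 . q_1\<close> and \<open>p_1 . p_1\<close>. The
  field has \<open>g\<close>-symmetric part \<open>A - P\<close>, and \<open>a\<close> has weight 1;
  hence tr A = tr A^2 - tr(PA), which is at most tr A^2, whereas 0 <= A <= 1 gives A^2 <= A. So A^2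
  = A, without knowing whether \<open>A\<close> and \<open>P\<close> commute. In the affirmative
  cases the orbifold is compared with a linear section. The obstacles lie in \<open>k = 1\<close>:
  the unit vector \<open>u\<close> has no continuous choice at the origin, which matters for the
  quotient topology, and the bracket upstairs contains derivatives transverse to the section, whose
  contributions have to cancel.\<close>

definition bform :: "'i set \<Rightarrow> ('i \<Rightarrow> 'i \<Rightarrow> real) \<Rightarrow> ('i \<Rightarrow> real) \<Rightarrow> ('i \<Rightarrow> real) \<Rightarrow> real" where
  "bform I \<beta> x y = (\<Sum>c\<in>I. \<Sum>d\<in>I. \<beta> c d * (x c * y d))"

lemma bform_sum_left:
  "bform I \<beta> (\<lambda>c. \<Sum>j\<in>J. t j * e j c) y = (\<Sum>j\<in>J. t j * bform I \<beta> (e j) y)"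
proof -
  have "bform I \<beta> (\<lambda>c. \<Sum>j\<in>J. t j * e j c) y
      = (\<Sum>c\<in>I. \<Sum>d\<in>I. \<Sum>j\<in>J. t j * (\<beta> c d * (e j c * y d)))"
    unfolding bform_def
    by (intro sum.cong refl) (simp add: sum_distrib_left sum_distrib_right mult_ac)
  also have "\<dots> = (\<Sum>c\<in>I. \<Sum>j\<in>J. \<Sum>d\<in>I. t j * (\<beta> c d * (e j c * y d)))"
    by (intro sum.cong refl sum.swap)
  also have "\<dots> = (\<Sum>j\<in>J. \<Sum>c\<in>I. \<Sum>d\<in>I. t j * (\<beta> c d * (e j c * y d)))"
    by (rule sum.swap)
  finally show ?thesis by (simp add: bform_def sum_distrib_left)
qed

lemma bform_commute:
  assumes "\<forall>c d. \<beta> c d = \<beta> d c"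
  shows "bform I \<beta> x y = bform I \<beta> y x"
  unfolding bform_def by (subst sum.swap) (simp add: assms mult_ac)

lemma bform_sum_right:
  "bform I \<beta> y (\<lambda>c. \<Sum>j\<in>J. t j * e j c) = (\<Sum>j\<in>J. t j * bform I \<beta> y (e j))"
proof -
  have flip: "bform I \<beta> x z = bform I (\<lambda>c d. \<beta> d c) z x" for x z
    unfolding bform_def by (subst sum.swap) (simp add: mult_ac)
  show ?thesis unfolding flip[of y] by (simp add: bform_sum_left)
qed

text \<open>Combinations are always kept in the shape \<open>r * x c + s * y c\<close>, with
  coefficients 1, -1 and 0 written out, so that these two rules and
  \<open>bform_lincomb_diag\<close> rewrite them directly.\<close>

lemma bform_lincomb_left:
  "bform I \<beta> (\<lambda>c. r * x c + s * y c) z = r * bform I \<beta> x z + s * bform I \<beta> y z"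
  by (simp add: bform_def algebra_simps sum.distrib sum_distrib_left)

lemma bform_lincomb_right:
  "bform I \<beta> z (\<lambda>c. r * x c + s * y c) = r * bform I \<beta> z x + s * bform I \<beta> z y"
  by (simp add: bform_def algebra_simps sum.distrib sum_distrib_left)

lemma bform_cong:
  assumes "\<And>c. c \<in> I \<Longrightarrow> x c = x' c" "\<And>c. c \<in> I \<Longrightarrow> y c = y' c"
  shows "bform I \<beta> x y = bform I \<beta> x' y'"
  using assms by (simp add: bform_def)

lemma bform_lincomb_diag:
  assumes "\<forall>c d. \<beta> c d = \<beta> d c"
  shows "bform I \<beta> (\<lambda>c. r * x c + s * y c) (\<lambda>c. r * x c + s * y c)
    = r^2 * bform I \<beta> x x + 2 * r * s * bform I \<beta> x y + s^2 * bform I \<beta> y y"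
  unfolding bform_lincomb_left bform_lincomb_right bform_commute[OF assms, of I y x]
  by (simp add: algebra_simps power2_eq_square)

text \<open>The form may be degenerate, so one of the diagonal values has to be positive before the
  usual argument applies. If both vanish, the value at \<open>r x + s y\<close> is
  \<open>2 r s\<close> times the mixed term, and changing the sign of \<open>r s\<close> forces that
  term to be 0.\<close>

lemma psd_cauchy_schwarz:
  assumes sym: "\<forall>c d. \<beta> c d = \<beta> d c" and psd: "\<forall>x. 0 \<le> bform I \<beta> x x"
  shows "(bform I \<beta> x y)^2 \<le> bform I \<beta> x x * bform I \<beta> y y"
proof -
  let ?B = "bform I \<beta>"
  have key: "(?B x y)^2 \<le> ?B x x * ?B y y" if "?B y y > 0" for x y
  proof -
    \<comment> \<open>The value of the form at \<open>B(y,y) x - B(x,y) y\<close>.\<close>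
    have "0 \<le> (?B y y)^2 * ?B x x + 2 * ?B y y * (- ?B x y) * ?B x y + (- ?B x y)^2 * ?B y y"
      by (subst bform_lincomb_diag[OF sym, symmetric]) (use psd in blast)
    also have "\<dots> = ?B y y * (?B x x * ?B y y - (?B x y)^2)"
      by (simp add: algebra_simps power2_eq_square)
    finally show ?thesis using that by (simp add: zero_le_mult_iff)
  qed
  consider "?B y y > 0" | "?B x x > 0" | "?B x x = 0" "?B y y = 0"
    using psd by (metis less_eq_real_def)
  then show ?thesis
  proof cases
    case 1 then show ?thesis by (rule key)
  next
    case 2 then show ?thesis
      using key[OF 2, of y] by (simp add: bform_commute[OF sym, of I y x] mult.commute)
  next
    case 3
    have "0 \<le> 2 * r * s * ?B x y" for r s
      using bform_lincomb_diag[OF sym, of I r x s y] 3 psd[rule_format, of "\<lambda>c. r * x c + s * y c"] by simp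
    from this[of 1 1] this[of 1 "-1"] have "?B x y = 0" by simp
    then show ?thesis using 3 by simp
  qed
qed

lemma psd_zero:
  assumes "\<forall>c d. \<beta> c d = \<beta> d c" "\<forall>x. 0 \<le> bform I \<beta> x x" "bform I \<beta> x x = 0"
  shows "bform I \<beta> x y = 0"
  using psd_cauchy_schwarz[OF assms(1,2), of x y] assms(3) by simp

text \<open>Gram-Schmidt over the coordinates. Indexing the family by \<open>J\<close> itself, and
  expanding only vectors supported in \<open>J\<close>, lets the induction add one coordinate
  \<open>m\<close> at a time.\<close>

lemma orthonormal_family_exists:
  assumes fin: "finite I" and sym: "\<forall>c d. \<gamma> c d = \<gamma> d c"
    and pos: "\<forall>x. (\<exists>c\<in>I. x c \<noteq> 0) \<longrightarrow> bform I \<gamma> x x > 0"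
    and JI: "J \<subseteq> I"
  shows "\<exists>e. (\<forall>i\<in>J. \<forall>c. c \<notin> J \<longrightarrow> e i c = 0) \<and>
     (\<forall>i\<in>J. \<forall>j\<in>J. bform I \<gamma> (e i) (e j) = (if i = j then 1 else 0)) \<and>
     (\<forall>x. (\<forall>c. c \<notin> J \<longrightarrow> x c = 0) \<longrightarrow> x = (\<lambda>c. \<Sum>i\<in>J. bform I \<gamma> x (e i) * e i c))"
  using finite_subset[OF JI fin] JI
proof (induction J rule: finite_induct)
  case empty
  then show ?case by auto
next
  case (insert m J)
  let ?G = "bform I \<gamma>"
  obtain e where supp: "\<And>i c. i \<in> J \<Longrightarrow> c \<notin> J \<Longrightarrow> e i c = 0"
    and on: "\<And>i j. i \<in> J \<Longrightarrow> j \<in> J \<Longrightarrow> ?G (e i) (e j) = (if i = j then 1 else 0)"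
    and ex: "\<And>x. (\<And>c. c \<notin> J \<Longrightarrow> x c = 0) \<Longrightarrow> x = (\<lambda>c. \<Sum>i\<in>J. ?G x (e i) * e i c)"
    using insert.IH insert.prems by blast
  define d where "d = (\<lambda>c. if c = m then 1 else (0::real))"
  define s where "s = (\<lambda>c. \<Sum>i\<in>J. ?G d (e i) * e i c)"
  \<comment> \<open>The unit vector at \<open>m\<close> minus its projection \<open>s\<close> to the
    span of the earlier family. As \<open>s\<close> is supported in \<open>J\<close>, the entry at
    \<open>m\<close> stays 1, so \<open>v\<close> can be normalised.\<close>
  define v where "v = (\<lambda>c. 1 * d c + (-1) * s c)"
  have s0: "s c = 0" if "c \<notin> J" for c using that supp by (simp add: s_def)
  have vm: "v m = 1" using s0 insert.hyps by (simp add: v_def d_def)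
  have vpos: "?G v v > 0" using pos vm insert.prems by (metis insert_subset zero_neq_one)
  have sj: "?G s (e j) = ?G d (e j)" if "j \<in> J" for j
  proof -
    have "?G s (e j) = (\<Sum>i\<in>J. ?G d (e i) * (if i = j then 1 else 0))"
      unfolding s_def bform_sum_left using on that by (intro sum.cong) auto
    also have "\<dots> = (\<Sum>i\<in>J. if i = j then ?G d (e i) else 0)" by (intro sum.cong) auto
    finally show ?thesis using that insert.hyps by simp
  qed
  have vj: "?G v (e j) = 0" if "j \<in> J" for j
    unfolding v_def bform_lincomb_left using sj[OF that] by simp
  define r where "r = sqrt (?G v v)"
  have r: "r > 0" "r * r = ?G v v" using vpos by (auto simp: r_def)
  define e' where "e' = e(m := (\<lambda>c. (1/r) * v c + 0 * v c))"
  have e'J: "e' i = e i" if "i \<in> J" for i using that insert.hyps by (auto simp: e'_def)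
  have em: "e' m = (\<lambda>c. (1/r) * v c + 0 * v c)" by (simp add: e'_def)
  have on_mj: "?G (e' m) (e j) = 0" if "j \<in> J" for j
    unfolding em bform_lincomb_left using vj[OF that] by simp
  then have on_jm: "?G (e j) (e' m) = 0" if "j \<in> J" for j
    using that bform_commute[OF sym] by metis
  have on_mm: "?G (e' m) (e' m) = 1"
    unfolding em bform_lincomb_left bform_lincomb_right using r vpos by (simp add: field_simps)
  have vem: "v = (\<lambda>c. r * e' m c)" unfolding em using r by auto
  show ?case
  proof (intro exI[of _ e'] conjI ballI allI impI)
    show "e' i c = 0" if "i \<in> insert m J" "c \<notin> insert m J" for i c
      using that supp e'J s0 by (auto simp: em v_def d_def)
  next
    show "?G (e' i) (e' j) = (if i = j then 1 else 0)"
      if "i \<in> insert m J" "j \<in> insert m J" for i j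
      using that on on_mj on_jm on_mm e'J insert.hyps by auto
  next
    fix x :: "'a \<Rightarrow> real"
    assume x': "\<forall>c. c \<notin> insert m J \<longrightarrow> x c = 0"
    then have x: "\<And>c. c \<notin> insert m J \<Longrightarrow> x c = 0" by blast
    show "x = (\<lambda>c. \<Sum>i\<in>insert m J. ?G x (e' i) * e' i c)"
    proof
      fix c
      \<comment> \<open>Substituting \<open>d = v + s\<close> in \<open>x = z + x m * d\<close>
        splits \<open>x\<close> into a part \<open>w\<close> supported in \<open>J\<close> and a
        multiple of \<open>v\<close>.\<close>
      define z where "z = (\<lambda>c. if c = m then 0 else x c)"
      define w where "w = (\<lambda>c. 1 * z c + x m * s c)"
      have w0: "w c = 0" if "c \<notin> J" for c using that x s0 by (auto simp: w_def z_def)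
      have xw: "x = (\<lambda>c. 1 * w c + x m * v c)"
        by (auto simp: fun_eq_iff w_def z_def v_def d_def algebra_simps)
      have wm: "?G w (e' m) = 0"
      proof -
        have "?G w (e' m) = (\<Sum>i\<in>J. ?G w (e i) * ?G (e i) (e' m))"
          by (subst ex[of w]) (simp_all add: w0 bform_sum_left)
        also have "\<dots> = 0" using on_jm by (intro sum.neutral) auto
        finally show ?thesis .
      qed
      have vm': "?G v (e' m) = r"
      proof -
        have "?G (\<lambda>c. r * e' m c + 0 * v c) (e' m) = r" unfolding bform_lincomb_left using on_mm by simp
        then show ?thesis using vem by simp
      qed
      have xG: "?G x y = ?G w y + x m * ?G v y" for y
      proof -
        have "?G x y = ?G (\<lambda>c. 1 * w c + x m * v c) y" using xw by (rule arg_cong)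
        then show ?thesis unfolding bform_lincomb_left by simp
      qed
      have xm: "?G x (e' m) = x m * r" unfolding xG wm vm' by simp
      have xj: "?G x (e' j) * e' j c = ?G w (e j) * e j c" if "j \<in> J" for j
        unfolding xG e'J[OF that] vj[OF that] by simp
      have wc: "w c = (\<Sum>i\<in>J. ?G w (e i) * e i c)" using w0 by (intro fun_cong[OF ex]) auto
      have "(\<Sum>i\<in>insert m J. ?G x (e' i) * e' i c)
          = ?G x (e' m) * e' m c + (\<Sum>i\<in>J. ?G x (e' i) * e' i c)"
        using insert.hyps by (rule sum.insert)
      also have "(\<Sum>i\<in>J. ?G x (e' i) * e' i c) = w c"
        unfolding wc by (rule sum.cong[OF refl xj])
      also have "?G x (e' m) * e' m c = x m * v c"
        unfolding xm fun_cong[OF vem, of c] by (rule mult.assoc)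
      also have "x m * v c + w c = x c" by (subst fun_cong[OF xw, of c]) simp
      finally show "x c = (\<Sum>i\<in>insert m J. ?G x (e' i) * e' i c)" by (rule HOL.sym)
    qed
  qed
qed

section \<open>Traces of products of semidefinite forms, and a criterion for projections\<close>

text \<open>If \<open>e\<close> is orthonormal for an inner product, this is the trace of the
  product of the operators of \<open>\<pi>\<close> and \<open>\<alpha>\<close>. For definite
  \<open>\<alpha>\<close>, an \<open>\<alpha>\<close>-orthonormal family turns it into a sum of
  diagonal values of \<open>\<pi>\<close>. A semidefinite \<open>\<alpha>\<close> is made definite
  by adding \<open>\<epsilon>\<close> times the standard form \<open>\<delta>\<close>, with
  \<open>\<epsilon>\<close> arbitrarily small.\<close>

lemma psd_trace_nonneg:
  fixes \<alpha> \<pi> :: "'i \<Rightarrow> 'i \<Rightarrow> real"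
  assumes fin: "finite I" and syma: "\<forall>c d. \<alpha> c d = \<alpha> d c" and psda: "\<forall>x. 0 \<le> bform I \<alpha> x x"
    and psdp: "\<forall>x. 0 \<le> bform I \<pi> x x"
  shows "0 \<le> (\<Sum>i\<in>J. \<Sum>j\<in>J. bform I \<pi> (e i) (e j) * bform I \<alpha> (e i) (e j))"
proof -
  define \<delta> where "\<delta> = (\<lambda>c d::'i. if c = d then 1 else (0::real))"
  let ?T = "\<lambda>\<beta>. \<Sum>i\<in>J. \<Sum>j\<in>J. bform I \<pi> (e i) (e j) * bform I \<beta> (e i) (e j)"
  have \<delta>: "bform I \<delta> x x = (\<Sum>c\<in>I. (x c)^2)" for x
    unfolding bform_def \<delta>_def using fin
    by (intro sum.cong refl) (simp add: if_distrib[of "\<lambda>u. u * _"] power2_eq_square cong: if_cong)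
  have main: "0 \<le> ?T \<alpha> + \<epsilon> * ?T \<delta>" if \<epsilon>: "\<epsilon> > 0" for \<epsilon>
  proof -
    define \<beta> where "\<beta> = (\<lambda>c d. \<alpha> c d + \<epsilon> * \<delta> c d)"
    have \<beta>: "bform I \<beta> x y = bform I \<alpha> x y + \<epsilon> * bform I \<delta> x y" for x y
      by (simp add: bform_def \<beta>_def algebra_simps sum.distrib sum_distrib_left)
    have sym: "\<forall>c d. \<beta> c d = \<beta> d c" by (simp add: \<beta>_def \<delta>_def syma[rule_format, symmetric])
    have pos: "\<forall>x. (\<exists>c\<in>I. x c \<noteq> 0) \<longrightarrow> bform I \<beta> x x > 0"
    proof (intro allI impI)
      fix x :: "'i \<Rightarrow> real" assume *: "\<exists>c\<in>I. x c \<noteq> 0"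
      have "bform I \<delta> x x > 0"
        unfolding \<delta> using * fin by (auto intro!: sum_pos2)
      then show "bform I \<beta> x x > 0" using psda[rule_format, of x] \<epsilon> by (simp add: \<beta> add_nonneg_pos)
    qed
    obtain f where f: "\<And>x. (\<And>c. c \<notin> I \<Longrightarrow> x c = 0) \<Longrightarrow> x = (\<lambda>c. \<Sum>i\<in>I. bform I \<beta> x (f i) * f i c)"
      using orthonormal_family_exists[OF fin sym pos subset_refl] by metis
    have exp: "bform I \<beta> x y = (\<Sum>m\<in>I. bform I \<beta> x (f m) * bform I \<beta> y (f m))" for x y
    proof -
      define x' where "x' = (\<lambda>c. if c \<in> I then x c else 0)"
      have xx': "bform I \<beta> x z = bform I \<beta> x' z" for z by (rule bform_cong) (auto simp: x'_def)
      have "bform I \<beta> x y = bform I \<beta> (\<lambda>c. \<Sum>i\<in>I. bform I \<beta> x' (f i) * f i c) y"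
        using f[of x'] xx' by (auto simp: x'_def)
      also have "\<dots> = (\<Sum>m\<in>I. bform I \<beta> x' (f m) * bform I \<beta> y (f m))"
        unfolding bform_sum_left by (simp add: bform_commute[OF sym, of I y])
      finally show ?thesis by (simp add: xx')
    qed
    \<comment> \<open>Parseval for \<open>f\<close> splits \<open>\<beta>\<close> at
      \<open>(e i, e j)\<close> into a sum of products over \<open>m\<close>, so each
      \<open>m\<close> contributes the value of \<open>\<pi>\<close> on the diagonal at one
      vector.\<close>
    have "?T \<beta> = (\<Sum>m\<in>I. bform I \<pi> (\<lambda>c. \<Sum>j\<in>J. bform I \<beta> (e j) (f m) * e j c)
                                   (\<lambda>c. \<Sum>j\<in>J. bform I \<beta> (e j) (f m) * e j c))"
    proof -
      have "?T \<beta> = (\<Sum>i\<in>J. \<Sum>j\<in>J. \<Sum>m\<in>I.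
          bform I \<beta> (e i) (f m) * (bform I \<beta> (e j) (f m) * bform I \<pi> (e i) (e j)))"
        by (intro sum.cong refl, subst exp) (simp add: sum_distrib_left mult_ac)
      also have "\<dots> = (\<Sum>i\<in>J. \<Sum>m\<in>I. \<Sum>j\<in>J.
          bform I \<beta> (e i) (f m) * (bform I \<beta> (e j) (f m) * bform I \<pi> (e i) (e j)))"
        by (intro sum.cong refl sum.swap)
      also have "\<dots> = (\<Sum>m\<in>I. \<Sum>i\<in>J. \<Sum>j\<in>J.
          bform I \<beta> (e i) (f m) * (bform I \<beta> (e j) (f m) * bform I \<pi> (e i) (e j)))"
        by (rule sum.swap)
      finally show ?thesis by (simp add: bform_sum_left bform_sum_right sum_distrib_left)
    qed
    then have "0 \<le> ?T \<beta>" by (simp add: sum_nonneg psdp)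
    then show ?thesis by (simp add: \<beta> algebra_simps sum.distrib sum_distrib_left)
  qed
  show ?thesis
  proof (rule ccontr)
    assume neg: "\<not> 0 \<le> ?T \<alpha>"
    \<comment> \<open>Small enough that the perturbation consumes at most half of the negative
      value; the added 1 keeps the denominator positive.\<close>
    define \<epsilon> where "\<epsilon> = - ?T \<alpha> / (2 * (\<bar>?T \<delta>\<bar> + 1))"
    have "\<epsilon> > 0" using neg by (simp add: \<epsilon>_def divide_neg_pos)
    have "\<epsilon> * ?T \<delta> \<le> \<epsilon> * (\<bar>?T \<delta>\<bar> + 1)" using \<open>\<epsilon> > 0\<close> by simp
    also have "\<dots> = - ?T \<alpha> / 2" by (simp add: \<epsilon>_def field_simps)
    finally show False using main[OF \<open>\<epsilon> > 0\<close>] neg by linarith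
  qed
qed

text \<open>For the inner product \<open>\<gamma>\<close> let \<open>A\<close> and \<open>P\<close>
  be the operators of \<open>\<alpha>\<close> and \<open>\<pi>\<close>. The hypotheses say that
  \<open>A H\<close> has symmetric part \<open>A\<close> and that \<open>H\<close> has symmetric
  part \<open>A - P\<close>. The conclusion is A^2 = A in terms of forms, with \<open>A x\<close> as
  the witness \<open>x'\<close>.\<close>

lemma psd_form_is_projection:
  fixes \<alpha> \<pi> \<gamma> :: "'i \<Rightarrow> 'i \<Rightarrow> real" and H :: "('i \<Rightarrow> real) \<Rightarrow> 'i \<Rightarrow> real"
  assumes fin: "finite I"
    and syma: "\<forall>c d. \<alpha> c d = \<alpha> d c" and symg: "\<forall>c d. \<gamma> c d = \<gamma> d c"
    and symp: "\<forall>c d. \<pi> c d = \<pi> d c"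
    and psda: "\<forall>x. 0 \<le> bform I \<alpha> x x" and psdp: "\<forall>x. 0 \<le> bform I \<pi> x x"
    and pos: "\<forall>x. (\<exists>c\<in>I. x c \<noteq> 0) \<longrightarrow> bform I \<gamma> x x > 0"
    and le: "\<And>x. bform I \<alpha> x x \<le> bform I \<gamma> x x"
    and addH: "\<And>x y. H (\<lambda>c. 1 * x c + 1 * y c) = (\<lambda>c. 1 * H x c + 1 * H y c)"
    and Ha: "\<And>x. bform I \<alpha> (H x) x = bform I \<alpha> x x"
    and Hg: "\<And>x. bform I \<gamma> (H x) x = bform I \<alpha> x x - bform I \<pi> x x"
  shows "\<exists>x'. (\<forall>c. c \<notin> I \<longrightarrow> x' c = 0) \<and> bform I \<alpha> x' x' = bform I \<alpha> x x \<and>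
           bform I \<gamma> x' x' = bform I \<alpha> x x \<and>
           bform I \<alpha> (\<lambda>c. 1 * x c + (-1) * x' c) (\<lambda>c. 1 * x c + (-1) * x' c) = 0"
proof -
  let ?a = "bform I \<alpha>" and ?g = "bform I \<gamma>" and ?p = "bform I \<pi>"
  obtain e where e: "(\<forall>i\<in>I. \<forall>c. c \<notin> I \<longrightarrow> e i c = 0) \<and>
     (\<forall>i\<in>I. \<forall>j\<in>I. ?g (e i) (e j) = (if i = j then 1 else 0)) \<and>
     (\<forall>x. (\<forall>c. c \<notin> I \<longrightarrow> x c = 0) \<longrightarrow> x = (\<lambda>c. \<Sum>i\<in>I. ?g x (e i) * e i c))"
    using orthonormal_family_exists[OF fin symg pos subset_refl] ..
  have supp: "e i c = 0" if "i \<in> I" "c \<notin> I" for i c using e that by blast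
  have on: "?g (e i) (e j) = (if i = j then 1 else 0)" if "i \<in> I" "j \<in> I" for i j
    using e that by blast
  have ex': "x = (\<lambda>c. \<Sum>i\<in>I. ?g x (e i) * e i c)" if "\<And>c. c \<notin> I \<Longrightarrow> x c = 0" for x
    using that by (intro e[THEN conjunct2, THEN conjunct2, rule_format])
  have ex: "x c = (\<Sum>i\<in>I. ?g x (e i) * e i c)" if "c \<in> I" for x c
  proof -
    define x' where "x' = (\<lambda>c. if c \<in> I then x c else 0)"
    have "?g x z = ?g x' z" for z by (rule bform_cong) (auto simp: x'_def)
    then show ?thesis using fun_cong[OF ex'[of x'], of c] that by (simp add: x'_def)
  qed
  \<comment> \<open>Polarisation of \<open>Hg\<close>, for which additivity of \<open>H\<close> is
    needed.\<close>
  have pol: "?g (H x) y + ?g (H y) x = 2 * ?a x y - 2 * ?p x y" for x y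
  proof -
    let ?s = "\<lambda>c. 1 * x c + 1 * y c"
    have "?g (H ?s) ?s = ?a ?s ?s - ?p ?s ?s" by (rule Hg)
    then show ?thesis
      unfolding addH bform_lincomb_diag[OF syma] bform_lincomb_diag[OF symp]
      unfolding bform_lincomb_left bform_lincomb_right using Hg[of x] Hg[of y] by simp
  qed
  have trH: "(\<Sum>i\<in>I. ?a (e i) (e i)) = (\<Sum>i\<in>I. \<Sum>j\<in>I. ?g (H (e i)) (e j) * ?a (e i) (e j))"
  proof (intro sum.cong refl)
    fix i assume "i \<in> I"
    have "?a (e i) (e i) = ?a (H (e i)) (e i)" by (rule Ha[symmetric])
    also have "\<dots> = ?a (\<lambda>c. \<Sum>j\<in>I. ?g (H (e i)) (e j) * e j c) (e i)"
      by (rule bform_cong) (use ex in auto)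
    also have "\<dots> = (\<Sum>j\<in>I. ?g (H (e i)) (e j) * ?a (e i) (e j))"
      unfolding bform_sum_left by (simp add: bform_commute[OF syma])
    finally show "?a (e i) (e i) = (\<Sum>j\<in>I. ?g (H (e i)) (e j) * ?a (e i) (e j))" .
  qed
  also have trH': "\<dots> = (\<Sum>i\<in>I. \<Sum>j\<in>I. ?g (H (e j)) (e i) * ?a (e i) (e j))"
    by (subst sum.swap) (simp add: bform_commute[OF syma])
  finally have trH2: "(\<Sum>i\<in>I. ?a (e i) (e i)) = \<dots>" .
  \<comment> \<open>Against the symmetric \<open>\<alpha>\<close> only the symmetric part of
    \<open>H\<close> counts; averaging the two expressions for the trace makes \<open>pol\<close>
    applicable. The result reads 2 tr A = 2 tr A^2 - 2 tr(PA).\<close>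
  have "2 * (\<Sum>i\<in>I. ?a (e i) (e i))
      = (\<Sum>i\<in>I. \<Sum>j\<in>I. (?g (H (e i)) (e j) + ?g (H (e j)) (e i)) * ?a (e i) (e j))"
    unfolding distrib_right sum.distrib using trH trH2 by simp
  also have "\<dots> = (\<Sum>i\<in>I. \<Sum>j\<in>I. 2 * (?a (e i) (e j))^2 - 2 * (?p (e i) (e j) * ?a (e i) (e j)))"
    unfolding pol by (simp add: algebra_simps power2_eq_square)
  also have "\<dots> = 2 * (\<Sum>i\<in>I. \<Sum>j\<in>I. (?a (e i) (e j))^2)
      - 2 * (\<Sum>i\<in>I. \<Sum>j\<in>I. ?p (e i) (e j) * ?a (e i) (e j))"
    by (simp add: sum_subtractf sum_distrib_left)
  finally have tr: "(\<Sum>i\<in>I. ?a (e i) (e i)) \<le> (\<Sum>i\<in>I. \<Sum>j\<in>I. (?a (e i) (e j))^2)"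
    using psd_trace_nonneg[OF fin syma psda psdp, of e I] by linarith
  \<comment> \<open>\<open>F x\<close> is \<open>A x\<close>, expanded in the orthonormal
    family.\<close>
  define F where "F = (\<lambda>x c. \<Sum>j\<in>I. ?a x (e j) * e j c)"
  have aF: "?a x (F x) = (\<Sum>j\<in>I. (?a x (e j))^2)" for x
    unfolding F_def bform_sum_right by (simp add: power2_eq_square)
  have gF: "?g (F x) (F x) = (\<Sum>j\<in>I. (?a x (e j))^2)" for x
  proof -
    have "?g (F x) (F x) = (\<Sum>j\<in>I. ?a x (e j) * (\<Sum>i\<in>I. ?a x (e i) * (if j = i then 1 else 0)))"
      unfolding F_def bform_sum_left bform_sum_right using on by (intro sum.cong refl) auto
    also have "\<dots> = (\<Sum>j\<in>I. (?a x (e j))^2)"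
      using fin by (intro sum.cong refl) (simp add: if_distrib power2_eq_square cong: if_cong)
    finally show ?thesis .
  qed
  \<comment> \<open>This is A^2 <= A: Cauchy-Schwarz for \<open>\<alpha>\<close> between
    \<open>x\<close> and \<open>F x\<close>, then \<open>\<alpha>\<close> bounded by
    \<open>\<gamma>\<close> at \<open>F x\<close>, where \<open>\<gamma>\<close> takes the value of
    the sum itself.\<close>
  have defect_nonneg: "(\<Sum>j\<in>I. (?a x (e j))^2) \<le> ?a x x" for x
  proof -
    let ?S = "\<Sum>j\<in>I. (?a x (e j))^2"
    have "?S^2 \<le> ?a x x * ?a (F x) (F x)"
      using psd_cauchy_schwarz[OF syma psda, of x "F x"] by (simp add: aF)
    also have "\<dots> \<le> ?a x x * ?S"
      using le[of "F x"] psda by (intro mult_left_mono) (auto simp: gF)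
    finally have "?S * ?S \<le> ?a x x * ?S" by (simp add: power2_eq_square)
    moreover have "0 \<le> ?S" by (simp add: sum_nonneg)
    ultimately show ?thesis using psda by (cases "?S = 0") (auto simp: mult_le_cancel_right)
  qed
  \<comment> \<open>Coefficients of the functional that pairs with \<open>e j\<close> under
    \<open>\<alpha>\<close>. They make \<open>\<rho>\<close> the coefficient matrix of A - A^2, a
    semidefinite form whose trace is at most 0 by \<open>tr\<close>, so that it vanishes.\<close>
  define K where "K = (\<lambda>j c. \<Sum>k\<in>I. \<alpha> c k * e j k)"
  define \<rho> where "\<rho> = (\<lambda>c d. \<alpha> c d - (\<Sum>j\<in>I. K j c * K j d))"
  have \<rho>: "bform I \<rho> x y = ?a x y - (\<Sum>j\<in>I. ?a x (e j) * ?a y (e j))" for x y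
  proof -
    have ae: "?a x (e j) = (\<Sum>c\<in>I. K j c * x c)" for x j
      by (simp add: bform_def K_def sum_distrib_left sum_distrib_right mult_ac)
    have "(\<Sum>j\<in>I. ?a x (e j) * ?a y (e j)) = (\<Sum>j\<in>I. \<Sum>c\<in>I. \<Sum>d\<in>I.
        K j c * K j d * (x c * y d))"
      unfolding ae sum_product by (intro sum.cong refl) (simp add: mult_ac)
    also have "\<dots> = (\<Sum>c\<in>I. \<Sum>j\<in>I. \<Sum>d\<in>I.
        K j c * K j d * (x c * y d))"
      by (rule sum.swap)
    also have "\<dots> = (\<Sum>c\<in>I. \<Sum>d\<in>I. \<Sum>j\<in>I.
        K j c * K j d * (x c * y d))"
      by (intro sum.cong refl sum.swap)
    finally have 1: "(\<Sum>j\<in>I. ?a x (e j) * ?a y (e j)) = (\<Sum>c\<in>I. \<Sum>d\<in>I. \<Sum>j\<in>I.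
        K j c * K j d * (x c * y d))" .
    show ?thesis
      unfolding 1 by (simp add: bform_def \<rho>_def left_diff_distrib sum_subtractf sum_distrib_right)
  qed
  have sym\<rho>: "\<forall>c d. \<rho> c d = \<rho> d c"
    using syma by (simp add: \<rho>_def mult.commute)
  have psd\<rho>: "\<forall>x. 0 \<le> bform I \<rho> x x"
    using defect_nonneg by (simp add: \<rho> power2_eq_square)
  have "bform I \<rho> (e i) (e i) = 0" if "i \<in> I" for i
  proof -
    have "(\<Sum>i\<in>I. bform I \<rho> (e i) (e i)) \<le> 0"
      using tr by (simp add: \<rho> sum_subtractf power2_eq_square)
    then have "(\<Sum>i\<in>I. bform I \<rho> (e i) (e i)) = 0"
      using psd\<rho> by (meson antisym sum_nonneg)
    then show ?thesis using psd\<rho> fin that by (simp add: sum_nonneg_eq_0_iff)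
  qed
  then have \<rho>e: "bform I \<rho> (e i) y = 0" if "i \<in> I" for i y
    using psd_zero[OF sym\<rho> psd\<rho>] that by blast
  have defect: "?a x x = (\<Sum>j\<in>I. (?a x (e j))^2)" for x
  proof -
    have "bform I \<rho> x x = bform I \<rho> (\<lambda>c. \<Sum>i\<in>I. ?g x (e i) * e i c) x"
      by (rule bform_cong) (use ex in auto)
    also have "\<dots> = 0" unfolding bform_sum_left using \<rho>e by simp
    finally show ?thesis by (simp add: \<rho> power2_eq_square)
  qed
  \<comment> \<open>Now that the sum equals \<open>?a x x\<close>, the two inequalities behind
    \<open>defect_nonneg\<close> bound \<open>?a (F x) (F x)\<close> from both sides; cancelling
    requires \<open>?a x x\<close> to be nonzero.\<close>
  have aFF: "?a (F x) (F x) = ?a x x"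
  proof (cases "?a x x = 0")
    case True
    then show ?thesis using le[of "F x"] psda[rule_format, of "F x"] by (simp add: gF defect[of x])
  next
    case False
    then have ax: "?a x x > 0" using psda by (metis less_eq_real_def)
    have "?a x x * ?a x x \<le> ?a x x * ?a (F x) (F x)"
      using psd_cauchy_schwarz[OF syma psda, of x "F x"]
      unfolding aF defect[of x, symmetric] by (simp add: power2_eq_square)
    then have "?a x x \<le> ?a (F x) (F x)" using ax by simp
    moreover have "?a (F x) (F x) \<le> ?a x x" using le[of "F x"] by (simp add: gF defect[of x])
    ultimately show ?thesis by simp
  qed
  show ?thesis
  proof (intro exI[of _ "F x"] conjI)
    show "\<forall>c. c \<notin> I \<longrightarrow> F x c = 0" using supp by (simp add: F_def)
    show "?a (F x) (F x) = ?a x x" by (rule aFF)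
    show "?g (F x) (F x) = ?a x x" by (simp add: gF defect[of x])
    show "?a (\<lambda>c. 1 * x c + (-1) * F x c) (\<lambda>c. 1 * x c + (-1) * F x c) = 0"
      unfolding bform_lincomb_diag[OF syma] using aFF aF[of x] defect[of x] by simp
  qed
qed

section \<open>Graded polynomials and brackets of invariants\<close>

text \<open>\<open>D\<close> is the set of allowed degrees: \<open>UNIV\<close> gives polynomials
  and \<open>{d}\<close> homogeneous ones, so the whole algebra and its graded parts obey the same
  lemmas.\<close>

definition wpoly :: "nat set \<Rightarrow> nat \<Rightarrow> nat \<Rightarrow> (point \<Rightarrow> real) \<Rightarrow> bool" where
  "wpoly D k n f \<longleftrightarrow>
     (\<exists>E a. finite E \<and> (\<forall>e\<in>E. (\<Sum>c\<in>coords k n. e c) \<in> D) \<and>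
        (\<forall>y\<in>phase_space k n. f y = (\<Sum>e\<in>E. a e * (\<Prod>c\<in>coords k n. y c ^ e c))))"

lemma polynomial_on_eq_wpoly: "polynomial_on k n f \<longleftrightarrow> wpoly UNIV k n f"
  by (simp add: polynomial_on_def wpoly_def)

lemma homogeneous_on_eq_wpoly: "homogeneous_on k n d f \<longleftrightarrow> wpoly {d} k n f"
  by (simp add: homogeneous_on_def wpoly_def)

lemma finite_coords [simp]: "finite (coords k n)"
  by (simp add: coords_def)

text \<open>Terms may be indexed by anything and exponents may repeat; coefficients of equal
  exponents are collected, since in the definition the exponents form a set.\<close>

lemma wpolyI:
  assumes "finite I" "\<And>i. i \<in> I \<Longrightarrow> (\<Sum>c\<in>coords k n. e i c) \<in> D"
    and "\<And>y. y \<in> phase_space k n \<Longrightarrow> f y = (\<Sum>i\<in>I. a i * (\<Prod>c\<in>coords k n. y c ^ e i c))"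
  shows "wpoly D k n f"
  unfolding wpoly_def
proof (intro exI conjI ballI)
  show "finite (e ` I)" using assms(1) by simp
  show "(\<Sum>c\<in>coords k n. e' c) \<in> D" if "e' \<in> e ` I" for e' using that assms(2) by auto
  fix y assume y: "y \<in> phase_space k n"
  have "f y = (\<Sum>e'\<in>e ` I. \<Sum>i\<in>{i\<in>I. e i = e'}. a i * (\<Prod>c\<in>coords k n. y c ^ e i c))"
    unfolding assms(3)[OF y] using assms(1) by (rule sum.image_gen)
  also have "\<dots> = (\<Sum>e'\<in>e ` I. (\<Sum>i\<in>{i\<in>I. e i = e'}. a i) * (\<Prod>c\<in>coords k n. y c ^ e' c))"
    by (intro sum.cong refl) (simp add: sum_distrib_right)
  finally show "f y = (\<Sum>e'\<in>e ` I. (\<Sum>i\<in>{i\<in>I. e i = e'}. a i) * (\<Prod>c\<in>coords k n. y c ^ e' c))" .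
qed

lemma wpoly_cong:
  assumes "wpoly D k n f" "\<And>y. y \<in> phase_space k n \<Longrightarrow> g y = f y"
  shows "wpoly D k n g"
  using assms unfolding wpoly_def by simp

lemma wpoly_mono: "wpoly D k n f \<Longrightarrow> D \<subseteq> D' \<Longrightarrow> wpoly D' k n f"
  unfolding wpoly_def by blast

lemma wpoly_zero: "wpoly D k n (\<lambda>y. 0)"
  by (rule wpolyI[where I = "{}"]) auto

lemma wpoly_add:
  assumes "wpoly D k n f" "wpoly D k n g"
  shows "wpoly D k n (\<lambda>y. f y + g y)"
proof -
  obtain E a where E: "finite E" "\<And>e. e \<in> E \<Longrightarrow> (\<Sum>c\<in>coords k n. e c) \<in> D"
    "\<And>y. y \<in> phase_space k n \<Longrightarrow> f y = (\<Sum>e\<in>E. a e * (\<Prod>c\<in>coords k n. y c ^ e c))"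
    using assms(1) unfolding wpoly_def by blast
  obtain E' a' where E': "finite E'" "\<And>e. e \<in> E' \<Longrightarrow> (\<Sum>c\<in>coords k n. e c) \<in> D"
    "\<And>y. y \<in> phase_space k n \<Longrightarrow> g y = (\<Sum>e\<in>E'. a' e * (\<Prod>c\<in>coords k n. y c ^ e c))"
    using assms(2) unfolding wpoly_def by blast
  show ?thesis
    by (rule wpolyI[where I = "E <+> E'" and e = "case_sum id id" and a = "case_sum a a'"])
       (use E E' in \<open>auto simp: sum.Plus\<close>)
qed

lemma wpoly_sum:
  assumes "finite I" "\<And>i. i \<in> I \<Longrightarrow> wpoly D k n (f i)"
  shows "wpoly D k n (\<lambda>y. \<Sum>i\<in>I. f i y)"
  using assms by (induction I rule: finite_induct) (auto intro: wpoly_zero wpoly_add)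

lemma wpoly_cmult:
  assumes "wpoly D k n f" shows "wpoly D k n (\<lambda>y. r * f y)"
proof -
  obtain E a where E: "finite E" "\<And>e. e \<in> E \<Longrightarrow> (\<Sum>c\<in>coords k n. e c) \<in> D"
    "\<And>y. y \<in> phase_space k n \<Longrightarrow> f y = (\<Sum>e\<in>E. a e * (\<Prod>c\<in>coords k n. y c ^ e c))"
    using assms(1) unfolding wpoly_def by blast
  show ?thesis
    by (rule wpolyI[where I = E and e = id and a = "\<lambda>e. r * a e"])
       (use E in \<open>auto simp: sum_distrib_left mult.assoc\<close>)
qed

lemma homogeneous_const: "wpoly {0} k n (\<lambda>y. r)"
  by (rule wpolyI[where I = "{()}" and e = "\<lambda>_ _. 0" and a = "\<lambda>_. r"]) auto

lemma homogeneous_coord: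
  assumes "c \<in> coords k n" shows "wpoly {1} k n (\<lambda>y. y c)"
proof (rule wpolyI[where I = "{()}" and e = "\<lambda>_ d. if d = c then 1 else 0" and a = "\<lambda>_. 1"])
  fix y :: point
  have "(\<Prod>d\<in>coords k n. y d ^ (if d = c then 1 else 0)) = (\<Prod>d\<in>coords k n. if d = c then y d else 1)"
    by (intro prod.cong) auto
  then show "y c = (\<Sum>i\<in>{()}. 1 * (\<Prod>d\<in>coords k n. y d ^ (if d = c then 1 else 0)))"
    using assms by simp
qed (use assms in auto)

lemma homogeneous_mult:
  assumes "wpoly {d} k n f" "wpoly {d'} k n g"
  shows "wpoly {d + d'} k n (\<lambda>y. f y * g y)"
proof -
  obtain E a where E: "finite E" "\<And>e. e \<in> E \<Longrightarrow> (\<Sum>c\<in>coords k n. e c) = d"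
    "\<And>y. y \<in> phase_space k n \<Longrightarrow> f y = (\<Sum>e\<in>E. a e * (\<Prod>c\<in>coords k n. y c ^ e c))"
    using assms(1) unfolding wpoly_def by auto
  obtain E' a' where E': "finite E'" "\<And>e. e \<in> E' \<Longrightarrow> (\<Sum>c\<in>coords k n. e c) = d'"
    "\<And>y. y \<in> phase_space k n \<Longrightarrow> g y = (\<Sum>e\<in>E'. a' e * (\<Prod>c\<in>coords k n. y c ^ e c))"
    using assms(2) unfolding wpoly_def by auto
  show ?thesis
  proof (rule wpolyI[where I = "E \<times> E'" and e = "\<lambda>(e, e') c. e c + e' c"
        and a = "\<lambda>(e, e'). a e * a' e'"])
    fix y assume y: "y \<in> phase_space k n"
    show "f y * g y = (\<Sum>i\<in>E \<times> E'. (case i of (e, e') \<Rightarrow> a e * a' e') *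
        (\<Prod>c\<in>coords k n. y c ^ (case i of (e, e') \<Rightarrow> \<lambda>c. e c + e' c) c))"
      unfolding E(3)[OF y] E'(3)[OF y] sum_product sum.cartesian_product
      by (intro sum.cong refl) (auto simp: power_add prod.distrib mult_ac)
  qed (use E E' in \<open>auto simp: sum.distrib\<close>)
qed

lemma homogeneous_prod:
  assumes "finite C" "\<And>c. c \<in> C \<Longrightarrow> wpoly {d c} k n (f c)"
  shows "wpoly {\<Sum>c\<in>C. d c} k n (\<lambda>y. \<Prod>c\<in>C. f c y)"
  using assms
  by (induction C rule: finite_induct) (auto intro: homogeneous_const homogeneous_mult)

lemma homogeneous_power:
  assumes "wpoly {d} k n f"
  shows "wpoly {m * d} k n (\<lambda>y. f y ^ m)"
  using homogeneous_prod[of "{..<m}" "\<lambda>_. d" k n "\<lambda>_. f"] assms by simp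

lemma wpoly_compose:
  assumes f: "wpoly D k n f"
    and hom: "\<And>c. c \<in> coords k n \<Longrightarrow> wpoly {1} k' n' (\<lambda>z. \<iota> z c)"
    and \<iota>: "\<And>z. z \<in> phase_space k' n' \<Longrightarrow> \<iota> z \<in> phase_space k n"
  shows "wpoly D k' n' (\<lambda>z. f (\<iota> z))"
proof -
  obtain E a where E: "finite E" "\<And>e. e \<in> E \<Longrightarrow> (\<Sum>c\<in>coords k n. e c) \<in> D"
    "\<And>y. y \<in> phase_space k n \<Longrightarrow> f y = (\<Sum>e\<in>E. a e * (\<Prod>c\<in>coords k n. y c ^ e c))"
    using f unfolding wpoly_def by blast
  have "wpoly D k' n' (\<lambda>z. \<Sum>e\<in>E. a e * (\<Prod>c\<in>coords k n. \<iota> z c ^ e c))"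
  proof (intro wpoly_sum E(1) wpoly_cmult)
    fix e assume "e \<in> E"
    have "wpoly {\<Sum>c\<in>coords k n. e c * 1} k' n' (\<lambda>z. \<Prod>c\<in>coords k n. \<iota> z c ^ e c)"
      by (intro homogeneous_prod homogeneous_power hom) auto
    then show "wpoly D k' n' (\<lambda>z. \<Prod>c\<in>coords k n. \<iota> z c ^ e c)"
      using E(2)[OF \<open>e \<in> E\<close>] by (auto elim: wpoly_mono)
  qed
  then show ?thesis
    by (rule wpoly_cong) (use E(3) \<iota> in auto)
qed

section \<open>Chain rule for polynomial functions\<close>

text \<open>The chain rule itself serves as the notion of differentiability: it passes to sums and
  products, and asks of a curve only that its coordinates be differentiable.\<close>

definition has_gradient :: "nat \<Rightarrow> nat \<Rightarrow> (point \<Rightarrow> real) \<Rightarrow> (nat \<times> nat \<Rightarrow> point \<Rightarrow> real) \<Rightarrow> bool" where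
  "has_gradient k n f f' \<longleftrightarrow> (\<forall>\<gamma> \<gamma>' t\<^sub>0.
     (\<forall>c\<in>coords k n. ((\<lambda>t. \<gamma> t c) has_real_derivative \<gamma>' c) (at t\<^sub>0)) \<longrightarrow>
     ((\<lambda>t. f (\<gamma> t)) has_real_derivative (\<Sum>b\<in>coords k n. \<gamma>' b * f' b (\<gamma> t\<^sub>0))) (at t\<^sub>0))"

lemma has_gradient_const: "has_gradient k n (\<lambda>y. r) (\<lambda>b y. 0)"
  by (simp add: has_gradient_def)

lemma has_gradient_coord:
  "c \<in> coords k n \<Longrightarrow> has_gradient k n (\<lambda>y. y c) (\<lambda>b y. if b = c then 1 else 0)"
  by (simp add: has_gradient_def if_distrib cong: if_cong)

lemma has_gradient_add:
  assumes "has_gradient k n f f'" "has_gradient k n g g'"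
  shows "has_gradient k n (\<lambda>y. f y + g y) (\<lambda>b y. f' b y + g' b y)"
  using assms unfolding has_gradient_def
  by (auto simp: distrib_left sum.distrib intro!: DERIV_add)

lemma has_gradient_mult:
  assumes "has_gradient k n f f'" "has_gradient k n g g'"
  shows "has_gradient k n (\<lambda>y. f y * g y) (\<lambda>b y. f' b y * g y + g' b y * f y)"
  unfolding has_gradient_def
proof (intro allI impI)
  fix \<gamma> :: "real \<Rightarrow> point" and \<gamma>' t\<^sub>0
  assume d: "\<forall>c\<in>coords k n. ((\<lambda>t. \<gamma> t c) has_real_derivative \<gamma>' c) (at t\<^sub>0)"
  have "((\<lambda>t. f (\<gamma> t) * g (\<gamma> t)) has_real_derivative
     (\<Sum>b\<in>coords k n. \<gamma>' b * f' b (\<gamma> t\<^sub>0)) * g (\<gamma> t\<^sub>0) + (\<Sum>b\<in>coords k n. \<gamma>' b * g' b (\<gamma> t\<^sub>0)) * f (\<gamma> t\<^sub>0)) (at t\<^sub>0)"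
    using assms d unfolding has_gradient_def by (intro DERIV_mult) auto
  then show "((\<lambda>t. f (\<gamma> t) * g (\<gamma> t)) has_real_derivative
     (\<Sum>b\<in>coords k n. \<gamma>' b * (f' b (\<gamma> t\<^sub>0) * g (\<gamma> t\<^sub>0) + g' b (\<gamma> t\<^sub>0) * f (\<gamma> t\<^sub>0)))) (at t\<^sub>0)"
    by (simp add: sum_distrib_right sum_distrib_left distrib_left sum.distrib mult_ac)
qed

lemma has_gradient_power:
  assumes "has_gradient k n f f'"
  shows "\<exists>f'. has_gradient k n (\<lambda>y. f y ^ m) f'"
proof (induction m)
  case 0 then show ?case using has_gradient_const[of k n 1] by auto
next
  case (Suc m) then show ?case using has_gradient_mult[OF assms] by auto
qed

lemma has_gradient_prod:
  assumes "finite C" "\<And>c. c \<in> C \<Longrightarrow> \<exists>f'. has_gradient k n (f c) f'"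
  shows "\<exists>f'. has_gradient k n (\<lambda>y. \<Prod>c\<in>C. f c y) f'"
  using assms
proof (induction C rule: finite_induct)
  case empty then show ?case using has_gradient_const[of k n 1] by auto
next
  case (insert c C)
  then obtain f' g' where "has_gradient k n (f c) f'" "has_gradient k n (\<lambda>y. \<Prod>c\<in>C. f c y) g'"
    by (meson insertCI)
  then show ?case using has_gradient_mult[of k n "f c"] insert.hyps by (intro exI) simp
qed

lemma has_gradient_sum:
  assumes "finite C" "\<And>c. c \<in> C \<Longrightarrow> \<exists>f'. has_gradient k n (f c) f'"
  shows "\<exists>f'. has_gradient k n (\<lambda>y. \<Sum>c\<in>C. f c y) f'"
  using assms
proof (induction C rule: finite_induct)
  case empty then show ?case using has_gradient_const[of k n 0] by auto
next
  case (insert c C)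
  then obtain f' g' where "has_gradient k n (f c) f'" "has_gradient k n (\<lambda>y. \<Sum>c\<in>C. f c y) g'"
    by (meson insertCI)
  then show ?case using has_gradient_add[of k n "f c"] insert.hyps by (intro exI) simp
qed

lemma phase_space_update: "y \<in> phase_space k n \<Longrightarrow> c \<in> coords k n \<Longrightarrow> y(c := t) \<in> phase_space k n"
  by (auto simp: phase_space_def)

text \<open>\<open>f\<close> is known on the phase space only, whereas \<open>has_gradient\<close>
  admits curves anywhere; hence the passage to a polynomial expression \<open>g\<close> that makes
  sense at every point.\<close>

lemma polynomial_has_gradient:
  assumes "polynomial_on k n f"
  obtains g f' where "\<And>y. y \<in> phase_space k n \<Longrightarrow> f y = g y" "has_gradient k n g f'"
proof -
  obtain E a where E: "finite E"
    "\<And>y. y \<in> phase_space k n \<Longrightarrow> f y = (\<Sum>e\<in>E. a e * (\<Prod>c\<in>coords k n. y c ^ e c))"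
    using assms unfolding polynomial_on_def by blast
  have "\<exists>f'. has_gradient k n (\<lambda>y. \<Sum>e\<in>E. a e * (\<Prod>c\<in>coords k n. y c ^ e c)) f'"
  proof (rule has_gradient_sum[OF E(1)])
    fix e
    have "\<exists>f'. has_gradient k n (\<lambda>y. \<Prod>c\<in>coords k n. y c ^ e c) f'"
      by (rule has_gradient_prod) (simp_all add: has_gradient_power[OF has_gradient_coord])
    then show "\<exists>f'. has_gradient k n (\<lambda>y. a e * (\<Prod>c\<in>coords k n. y c ^ e c)) f'"
      using has_gradient_mult[OF has_gradient_const] by blast
  qed
  then obtain f' where "has_gradient k n (\<lambda>y. \<Sum>e\<in>E. a e * (\<Prod>c\<in>coords k n. y c ^ e c)) f'" ..
  with E(2) show ?thesis by (rule that)
qed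

lemma DERIV_polynomial_along_curve:
  assumes f: "polynomial_on k n f"
    and \<gamma>: "\<And>t. \<gamma> t \<in> phase_space k n"
    and d: "\<And>c. c \<in> coords k n \<Longrightarrow> ((\<lambda>t. \<gamma> t c) has_real_derivative \<gamma>' c) (at t\<^sub>0)"
  shows "((\<lambda>t. f (\<gamma> t)) has_real_derivative (\<Sum>b\<in>coords k n. \<gamma>' b * partial b f (\<gamma> t\<^sub>0))) (at t\<^sub>0)"
proof -
  obtain g f' where g: "\<And>y. y \<in> phase_space k n \<Longrightarrow> f y = g y" "has_gradient k n g f'"
    using polynomial_has_gradient[OF f] by blast
  have par: "partial b f y = f' b y" if y: "y \<in> phase_space k n" and b: "b \<in> coords k n" for b y
  proof -
    have "((\<lambda>t. g (y(b := t))) has_real_derivative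
        (\<Sum>c\<in>coords k n. (if c = b then 1 else 0) * f' c (y(b := y b)))) (at (y b))"
      using g(2)[unfolded has_gradient_def, rule_format, of "\<lambda>t. y(b := t)" "\<lambda>c. if c = b then 1 else 0" "y b"]
      by (auto simp del: fun_upd_triv)
    then have "((\<lambda>t. f (y(b := t))) has_real_derivative f' b y) (at (y b))"
      using b by (simp add: g(1) phase_space_update[OF y b] if_distrib[of "\<lambda>u. u * _"] cong: if_cong)
    then show ?thesis unfolding partial_def by (rule DERIV_imp_deriv)
  qed
  show ?thesis
    using g(2) d par \<gamma> unfolding has_gradient_def by (simp add: g(1)[OF \<gamma>])
qed

text \<open>Differentiating the identity \<open>f (T y) = f y\<close> shows that gradients transform
  by the transpose of the matrix \<open>\<tau>\<close> of \<open>T\<close>. Linearity is asked for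
  one coordinate at a time, which is what a partial derivative sees.\<close>

lemma partial_of_invariant:
  assumes f: "polynomial_on k n f" and inv: "\<And>y. y \<in> phase_space k n \<Longrightarrow> f (T y) = f y"
    and T: "\<And>y. y \<in> phase_space k n \<Longrightarrow> T y \<in> phase_space k n"
    and lin: "\<And>y c b t. y \<in> phase_space k n \<Longrightarrow> c \<in> coords k n \<Longrightarrow> b \<in> coords k n \<Longrightarrow>
        T (y(c := t)) b = T y b + (t - y c) * \<tau> b c"
    and y: "y \<in> phase_space k n" and c: "c \<in> coords k n"
  shows "partial c f y = (\<Sum>b\<in>coords k n. \<tau> b c * partial b f (T y))"
proof -
  have "((\<lambda>t. f (T (y(c := t)))) has_real_derivative
      (\<Sum>b\<in>coords k n. \<tau> b c * partial b f (T (y(c := y c))))) (at (y c))"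
  proof (rule DERIV_polynomial_along_curve[OF f])
    show "T (y(c := t)) \<in> phase_space k n" for t by (intro T phase_space_update y c)
    fix b assume "b \<in> coords k n"
    then show "((\<lambda>t. T (y(c := t)) b) has_real_derivative \<tau> b c) (at (y c))"
      unfolding lin[OF y c \<open>b \<in> coords k n\<close>] by (auto intro!: derivative_eq_intros)
  qed
  then have "((\<lambda>t. f (y(c := t))) has_real_derivative
      (\<Sum>b\<in>coords k n. \<tau> b c * partial b f (T y))) (at (y c))"
    by (simp add: inv phase_space_update[OF y c])
  then show ?thesis unfolding partial_def[of c] by (rule DERIV_imp_deriv)
qed

section \<open>Invariance of the bracket under orthogonal and unitary maps\<close>

text \<open>The group is defined by orthonormal columns, but gradients transform by the transpose,
  so the bracket calls for orthonormal rows.\<close>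

lemma orthogonal_row_products:
  assumes "A \<in> carrier (orthogonal_group n)" "i < n" "j < n"
  shows "(\<Sum>m<n. A $$ (i, m) * A $$ (j, m)) = (if i = j then 1 else 0)"
proof -
  have A: "A \<in> carrier_mat n n" "transpose_mat A * A = 1\<^sub>m n"
    using assms(1) by (auto simp: orthogonal_group_def)
  then have "A * transpose_mat A = 1\<^sub>m n"
    by (metis mat_mult_left_right_inverse transpose_carrier_mat)
  then have "(A * transpose_mat A) $$ (i, j) = (1\<^sub>m n :: real mat) $$ (i, j)" by simp
  then show ?thesis
    using A(1) assms(2,3) by (simp add: scalar_prod_def atLeast0LessThan)
qed

lemma orthogonal_column_products:
  assumes "A \<in> carrier (orthogonal_group n)" "i < n" "j < n"
  shows "(\<Sum>m<n. A $$ (m, i) * A $$ (m, j)) = (if i = j then 1 else 0)"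
proof -
  have A: "A \<in> carrier_mat n n" "transpose_mat A * A = 1\<^sub>m n"
    using assms(1) by (auto simp: orthogonal_group_def)
  then have "(transpose_mat A * A) $$ (i, j) = (1\<^sub>m n :: real mat) $$ (i, j)" by simp
  then show ?thesis
    using A(1) assms(2,3) by (simp add: scalar_prod_def atLeast0LessThan)
qed

lemma unitary_row_products:
  assumes "A \<in> carrier (unitary_group n)" "i < n" "j < n"
  shows "(\<Sum>m<n. A $$ (i, m) * cnj (A $$ (j, m))) = (if i = j then 1 else 0)"
proof -
  have A: "A \<in> carrier_mat n n" "mat_adjoint A * A = 1\<^sub>m n"
    using assms(1) by (auto simp: unitary_group_def)
  have "mat_adjoint A \<in> carrier_mat n n" using A(1) by (auto simp: mat_adjoint_def mat_of_rows_def)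
  then have "A * mat_adjoint A = 1\<^sub>m n"
    using A by (metis mat_mult_left_right_inverse)
  then have "(A * mat_adjoint A) $$ (i, j) = (1\<^sub>m n :: complex mat) $$ (i, j)" by simp
  then show ?thesis
    using A(1) assms(2,3)
    by (simp add: scalar_prod_def atLeast0LessThan mat_adjoint_def mat_of_rows_def)
qed

lemma diagonal_action_closed:
  "y \<in> phase_space k n \<Longrightarrow> diagonal_action k n A y \<in> phase_space k n"
  by (auto simp: diagonal_action_def phase_space_def)

lemma unitary_action_closed:
  "y \<in> phase_space 1 N \<Longrightarrow> unitary_action N A y \<in> phase_space 1 N"
  by (auto simp: unitary_action_def phase_space_def)

lemma diagonal_action_apply:
  "y \<in> phase_space k n \<Longrightarrow> (i, \<alpha>) \<in> coords k n \<Longrightarrow>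
    diagonal_action k n A y (i, \<alpha>) = (\<Sum>\<beta><n. A $$ (\<alpha>, \<beta>) * y (i, \<beta>))"
  by (simp add: diagonal_action_def)

lemma sum_coords: "(\<Sum>b\<in>coords k n. h b) = (\<Sum>i<2*k. \<Sum>\<alpha><n. h (i, \<alpha>))"
  by (simp add: coords_def sum.cartesian_product)

text \<open>The matrix acts alike on every block, and for each particle the bracket pairs the
  q-gradient of one function with the p-gradient of the other by the scalar product of R^n, which an
  orthogonal matrix preserves.\<close>

lemma poisson_invariant_orthogonal:
  assumes A: "A \<in> carrier (orthogonal_group n)"
    and f: "polynomial_on k n f" "\<And>y. y \<in> phase_space k n \<Longrightarrow> f (diagonal_action k n A y) = f y"
    and g: "polynomial_on k n g" "\<And>y. y \<in> phase_space k n \<Longrightarrow> g (diagonal_action k n A y) = g y"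
    and y: "y \<in> phase_space k n"
  shows "poisson k n f g (diagonal_action k n A y) = poisson k n f g y"
proof -
  let ?T = "diagonal_action k n A"
  have par: "partial (i, \<beta>) h y = (\<Sum>\<alpha><n. A $$ (\<alpha>, \<beta>) * partial (i, \<alpha>) h (?T y))"
    if h: "polynomial_on k n h" "\<And>y. y \<in> phase_space k n \<Longrightarrow> h (?T y) = h y"
      and i: "i < 2 * k" "\<beta> < n" for h i \<beta>
  proof -
    have "partial (i, \<beta>) h y = (\<Sum>b\<in>coords k n.
        (if fst b = i then A $$ (snd b, \<beta>) else 0) * partial b h (?T y))"
    proof -
      let ?\<tau> = "\<lambda>b c. if fst b = fst c then A $$ (snd b, snd c) else (0::real)"
      have "partial (i, \<beta>) h y = (\<Sum>b\<in>coords k n. ?\<tau> b (i, \<beta>) * partial b h (?T y))"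
      proof (rule partial_of_invariant[OF h diagonal_action_closed _ y])
        show "(i, \<beta>) \<in> coords k n" using i by (simp add: coords_def)
        fix y :: point and c b t
        assume y: "y \<in> phase_space k n" and c: "c \<in> coords k n" and b: "b \<in> coords k n"
        obtain i' \<alpha> where b': "b = (i', \<alpha>)" by force
        obtain j' \<delta> where c': "c = (j', \<delta>)" by force
        have "(\<Sum>\<beta><n. A $$ (\<alpha>, \<beta>) * (y(c := t)) (i', \<beta>))
            = (\<Sum>\<beta><n. A $$ (\<alpha>, \<beta>) * y (i', \<beta>) +
                (if \<beta> = snd c then (t - y c) * ?\<tau> b c else 0))"
          by (intro sum.cong refl) (auto simp: b' c' algebra_simps)
        also have "\<dots> = (\<Sum>\<beta><n. A $$ (\<alpha>, \<beta>) * y (i', \<beta>)) + (t - y c) * ?\<tau> b c"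
          using c by (auto simp: sum.distrib coords_def)
        finally show "?T (y(c := t)) b = ?T y b + (t - y c) * ?\<tau> b c"
          using y c b by (simp add: b' diagonal_action_apply phase_space_update)
      qed
      then show ?thesis by (simp cong: if_cong)
    qed
    also have "\<dots> = (\<Sum>j<2*k. if j = i then (\<Sum>\<alpha><n. A $$ (\<alpha>, \<beta>) * partial (j, \<alpha>) h (?T y)) else 0)"
      unfolding sum_coords by (intro sum.cong refl) auto
    finally show ?thesis using i by simp
  qed
  have orth: "(\<Sum>\<alpha><n. (\<Sum>\<beta><n. A $$ (\<beta>, \<alpha>) * u \<beta>) * (\<Sum>\<gamma><n. A $$ (\<gamma>, \<alpha>) * v \<gamma>)) = (\<Sum>\<alpha><n. u \<alpha> * v \<alpha>)"
    for u v :: "nat \<Rightarrow> real"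
  proof -
    have "(\<Sum>\<alpha><n. (\<Sum>\<beta><n. A $$ (\<beta>, \<alpha>) * u \<beta>) * (\<Sum>\<gamma><n. A $$ (\<gamma>, \<alpha>) * v \<gamma>))
        = (\<Sum>\<alpha><n. \<Sum>\<beta><n. \<Sum>\<gamma><n. A $$ (\<beta>, \<alpha>) * A $$ (\<gamma>, \<alpha>) * (u \<beta> * v \<gamma>))"
      by (simp add: sum_product mult_ac)
    also have "\<dots> = (\<Sum>\<beta><n. \<Sum>\<alpha><n. \<Sum>\<gamma><n. A $$ (\<beta>, \<alpha>) * A $$ (\<gamma>, \<alpha>) * (u \<beta> * v \<gamma>))"
      by (rule sum.swap)
    also have "\<dots> = (\<Sum>\<beta><n. \<Sum>\<gamma><n. \<Sum>\<alpha><n. A $$ (\<beta>, \<alpha>) * A $$ (\<gamma>, \<alpha>) * (u \<beta> * v \<gamma>))"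
      by (intro sum.cong refl sum.swap)
    also have "\<dots> = (\<Sum>\<beta><n. \<Sum>\<gamma><n. (if \<beta> = \<gamma> then 1 else 0) * (u \<beta> * v \<gamma>))"
      by (intro sum.cong refl) (simp add: sum_distrib_right[symmetric] orthogonal_row_products[OF A])
    also have "\<dots> = (\<Sum>\<beta><n. u \<beta> * v \<beta>)"
      by (intro sum.cong refl) (simp add: if_distrib[of "\<lambda>u. u * _"] cong: if_cong)
    finally show ?thesis .
  qed
  show ?thesis
    unfolding poisson_def
  proof (rule sum.cong[OF refl])
    fix l assume l: "l \<in> {..<k}"
    show "(\<Sum>\<alpha><n. partial (2 * l, \<alpha>) f (?T y) * partial (2 * l + 1, \<alpha>) g (?T y)
        - partial (2 * l + 1, \<alpha>) f (?T y) * partial (2 * l, \<alpha>) g (?T y))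
      = (\<Sum>\<alpha><n. partial (2 * l, \<alpha>) f y * partial (2 * l + 1, \<alpha>) g y
        - partial (2 * l + 1, \<alpha>) f y * partial (2 * l, \<alpha>) g y)"
      using l by (simp add: par[OF f] par[OF g] orth sum_subtractf)
  qed
qed

text \<open>As the imaginary part of a Hermitian product of complex gradients, the bracket is
  visibly unitarily invariant once gradients are known to transform by the adjoint.\<close>

lemma poisson_complex:
  "poisson 1 N f g y = Im (\<Sum>m<N. cnj (Complex (partial (0, m) f y) (partial (1, m) f y)) *
       Complex (partial (0, m) g y) (partial (1, m) g y))"
  by (simp add: poisson_def Im_sum algebra_simps)

lemma poisson_invariant_unitary:
  assumes A: "A \<in> carrier (unitary_group N)"
    and f: "polynomial_on 1 N f" "\<And>y. y \<in> phase_space 1 N \<Longrightarrow> f (unitary_action N A y) = f y"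
    and g: "polynomial_on 1 N g" "\<And>y. y \<in> phase_space 1 N \<Longrightarrow> g (unitary_action N A y) = g y"
    and y: "y \<in> phase_space 1 N"
  shows "poisson 1 N f g (unitary_action N A y) = poisson 1 N f g y"
proof -
  let ?T = "unitary_action N A"
  let ?U = "\<lambda>h y m. Complex (partial (0, m) h y) (partial (1, m) h y)"
  \<comment> \<open>The real 2 by 2 blocks of multiplication by the entries of
    \<open>A\<close>.\<close>
  define \<tau> where "\<tau> = (\<lambda>b c. let a = A $$ (snd b, snd c) in
     if fst b = (0::nat) then (if fst c = (0::nat) then Re a else - Im a)
     else (if fst c = 0 then Im a else Re a))"
  have app: "?T y (i, j) = (\<Sum>m<N. \<tau> (i, j) (0, m) * y (0, m) + \<tau> (i, j) (1, m) * y (1, m))"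
    if "y \<in> phase_space 1 N" "(i, j) \<in> coords 1 N" for y i j
    using that
    by (auto simp: unitary_action_def \<tau>_def Let_def complex_coord_def sum.distrib sum_subtractf
        sum_negf)
  \<comment> \<open>Transposing these real blocks amounts to taking the complex adjoint, hence the
    conjugated entries.\<close>
  have par: "?U h y m = (\<Sum>j<N. cnj (A $$ (j, m)) * ?U h (?T y) j)"
    if h: "polynomial_on 1 N h" "\<And>y. y \<in> phase_space 1 N \<Longrightarrow> h (?T y) = h y"
      and m: "m < N" for h m
  proof -
    have "partial c h y = (\<Sum>b\<in>coords 1 N. \<tau> b c * partial b h (?T y))" if c: "c \<in> coords 1 N" for c
    proof (rule partial_of_invariant[OF h])
      fix y :: point and c b t
      assume y: "y \<in> phase_space 1 N" and c: "c \<in> coords 1 N" and b: "b \<in> coords 1 N"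
      obtain i j where bij: "b = (i, j)" by force
      obtain r s where crs: "c = (r, s)" by force
      have r: "r = 0 \<or> r = 1" "s < N" using c by (auto simp: crs coords_def)
      have "(\<Sum>m<N. \<tau> (i, j) (0, m) * (y(c := t)) (0, m) + \<tau> (i, j) (1, m) * (y(c := t)) (1, m))
        = (\<Sum>m<N. (\<tau> (i, j) (0, m) * y (0, m) + \<tau> (i, j) (1, m) * y (1, m)) +
            (if m = s then \<tau> b c * (t - y c) else 0))"
        using r(1) by (intro sum.cong refl) (auto simp: crs bij algebra_simps)
      also have "\<dots> = (\<Sum>m<N. \<tau> (i, j) (0, m) * y (0, m) + \<tau> (i, j) (1, m) * y (1, m)) + \<tau> b c * (t - y c)"
        using r(2) by (simp add: sum.distrib)
      finally show "?T (y(c := t)) b = ?T y b + (t - y c) * \<tau> b c"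
        using y b c by (simp add: bij app phase_space_update mult.commute)
    qed (use y c unitary_action_closed in auto)
    note 1 = this
    have "partial (r, m) h y = (\<Sum>j<N. \<tau> (0, j) (r, m) * partial (0, j) h (?T y) +
        \<tau> (1, j) (r, m) * partial (1, j) h (?T y))" if "r = 0 \<or> r = 1" for r
    proof -
      have mem: "(r, m) \<in> coords 1 N" using that m by (auto simp: coords_def)
      show ?thesis unfolding 1[OF mem] sum_coords by (simp add: sum.distrib numeral_2_eq_2)
    qed
    from this[of 0] this[of 1] show ?thesis
      by (intro complex_eqI) (simp_all add: Re_sum Im_sum \<tau>_def algebra_simps)
  qed
  have unit: "(\<Sum>m<N. cnj (\<Sum>j<N. cnj (A $$ (j, m)) * u j) * (\<Sum>l<N. cnj (A $$ (l, m)) * v l))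
      = (\<Sum>j<N. cnj (u j) * v j)" for u v :: "nat \<Rightarrow> complex"
  proof -
    have "(\<Sum>m<N. cnj (\<Sum>j<N. cnj (A $$ (j, m)) * u j) * (\<Sum>l<N. cnj (A $$ (l, m)) * v l))
        = (\<Sum>m<N. \<Sum>j<N. \<Sum>l<N. A $$ (j, m) * cnj (A $$ (l, m)) * (cnj (u j) * v l))"
      unfolding cnj_sum sum_product by (intro sum.cong refl) (simp add: mult_ac)
    also have "\<dots> = (\<Sum>j<N. \<Sum>m<N. \<Sum>l<N. A $$ (j, m) * cnj (A $$ (l, m)) * (cnj (u j) * v l))"
      by (rule sum.swap)
    also have "\<dots> = (\<Sum>j<N. \<Sum>l<N. \<Sum>m<N. A $$ (j, m) * cnj (A $$ (l, m)) * (cnj (u j) * v l))"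
      by (intro sum.cong refl sum.swap)
    also have "\<dots> = (\<Sum>j<N. \<Sum>l<N. (if j = l then 1 else 0) * (cnj (u j) * v l))"
      by (intro sum.cong refl) (simp add: sum_distrib_right[symmetric] unitary_row_products[OF A])
    also have "\<dots> = (\<Sum>j<N. cnj (u j) * v j)"
      by (intro sum.cong refl) (simp add: if_distrib[of "\<lambda>u. u * _"] cong: if_cong)
    finally show ?thesis .
  qed
  have "(\<Sum>m<N. cnj (?U f y m) * ?U g y m)
      = (\<Sum>m<N. cnj (\<Sum>j<N. cnj (A $$ (j, m)) * ?U f (?T y) j) * (\<Sum>l<N. cnj (A $$ (l, m)) * ?U g (?T y) l))"
    by (intro sum.cong refl) (simp only: lessThan_iff par[OF f] par[OF g])
  then show ?thesis unfolding poisson_complex unit by simp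
qed

section \<open>Orbits\<close>

lemma group_action_subgroup:
  assumes "group_action G E \<phi>" "group G" "subgroup H G"
  shows "group_action (G\<lparr>carrier := H\<rparr>) E \<phi>"
proof -
  interpret group_action G E \<phi> by fact
  have H: "H \<subseteq> carrier G" using assms(3) by (rule subgroup.subset)
  show ?thesis
  proof (rule group_actionI)
    show "group (G\<lparr>carrier := H\<rparr>)" using assms(2,3) by (simp add: subgroup.subgroup_is_group)
    show "\<phi> g \<in> extensional E" if "g \<in> carrier (G\<lparr>carrier := H\<rparr>)" for g
      using bij_prop0[of g] that H by (auto simp: Bij_def)
    show "\<phi> g x \<in> E" if "g \<in> carrier (G\<lparr>carrier := H\<rparr>)" "x \<in> E" for g x
      using element_image that H by auto
    show "\<phi> \<one>\<^bsub>G\<lparr>carrier := H\<rparr>\<^esub> x = x" if "x \<in> E" for x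
      using that by (simp flip: id_eq_one)
    show "\<phi> (g \<otimes>\<^bsub>G\<lparr>carrier := H\<rparr>\<^esub> h) x = \<phi> g (\<phi> h x)"
      if "g \<in> carrier (G\<lparr>carrier := H\<rparr>)" "h \<in> carrier (G\<lparr>carrier := H\<rparr>)" "x \<in> E" for g h x
      using composition_rule[of x g h] that H by auto
  qed
qed

lemma group_action_special_orthogonal:
  "group_action (special_orthogonal_group n) (phase_space k n) (diagonal_action k n)"
proof -
  have "special_orthogonal_group n
      = orthogonal_group n\<lparr>carrier := carrier (special_orthogonal_group n)\<rparr>"
    by (simp add: special_orthogonal_group_def)
  then show ?thesis
    using group_action_subgroup[OF group_action_orthogonal group_orthogonal_group
        subgroup_special_orthogonal] by metis
qed

lemma (in group_action) orbit_closed: "x \<in> E \<Longrightarrow> y \<in> orbit G \<phi> x \<Longrightarrow> y \<in> E"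
  using element_image by (auto simp: orbit_def)

lemma (in group_action) orbit_eqI:
  assumes "x \<in> E" "y \<in> orbit G \<phi> x"
  shows "orbit G \<phi> y = orbit G \<phi> x"
proof -
  have y: "y \<in> E" using assms orbit_closed by blast
  have "orbit G \<phi> y \<in> orbits G E \<phi>" "orbit G \<phi> x \<in> orbits G E \<phi>"
    using y assms(1) by (auto simp: orbits_def)
  then show ?thesis
    using disjoint_union[of "orbit G \<phi> y" "orbit G \<phi> x"] orbit_refl[OF y] assms(2) by blast
qed

lemma invariant_on_orbit:
  "invariant_on G \<phi> E f \<Longrightarrow> x \<in> E \<Longrightarrow> y \<in> orbit G \<phi> x \<Longrightarrow> f y = f x"
  by (auto simp: invariant_on_def orbit_def)

lemma descend_apply:
  assumes "group_action G E \<phi>" "invariant_on G \<phi> E f" "Z \<subseteq> E" "x \<in> Z"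
  shows "descend G \<phi> Z f (orbit G \<phi> x) = f x"
proof -
  have "x \<in> orbit G \<phi> x" using group_action.orbit_refl[OF assms(1)] assms(3,4) by auto
  then have "(SOME z. z \<in> orbit G \<phi> x) \<in> orbit G \<phi> x"
    by (auto simp: some_in_eq)
  then have "f (SOME z. z \<in> orbit G \<phi> x) = f x"
    using assms(3,4) by (intro invariant_on_orbit[OF assms(2)]) auto
  moreover have "orbit G \<phi> x \<in> orbits G Z \<phi>" using assms(4) by (auto simp: orbits_def)
  ultimately show ?thesis by (simp add: descend_def)
qed

lemma points_quotient_space: "points (quotient_space k n Z G \<phi>) = orbits G Z \<phi>"
  using quotient_imp_surjective_map[OF quotient_map_orbit_topology[of Z G \<phi>]]
  by (auto simp: quotient_space_def orbits_def)

section \<open>Orthogonal matrices with a prescribed first column\<close>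

lemma orthogonal_groupI:
  assumes "A \<in> carrier_mat n n"
    and "\<And>i j. i < n \<Longrightarrow> j < n \<Longrightarrow> (\<Sum>m<n. A $$ (m, i) * A $$ (m, j)) = (if i = j then 1 else 0)"
  shows "A \<in> carrier (orthogonal_group n)"
proof -
  have "transpose_mat A * A = 1\<^sub>m n"
    using assms by (intro eq_matI) (auto simp: scalar_prod_def atLeast0LessThan)
  then show ?thesis using assms(1) by (simp add: orthogonal_group_def)
qed

lemma det_orthogonal:
  assumes "A \<in> carrier (orthogonal_group n)"
  shows "det A = 1 \<or> det A = -1"
proof -
  have A: "A \<in> carrier_mat n n" "transpose_mat A * A = 1\<^sub>m n"
    using assms by (auto simp: orthogonal_group_def)
  have "det A * det A = det (transpose_mat A * A)"
    using A(1) by (simp add: det_mult[of _ n] det_transpose[of _ n])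
  then have "det A * det A = 1" by (simp add: A(2))
  then show ?thesis by (simp add: square_eq_1_iff)
qed

text \<open>The Householder reflection exchanging the first basis vector and \<open>v\<close>. It
  degenerates when the two coincide, and there the identity serves.\<close>

lemma orthogonal_first_column:
  assumes v: "(\<Sum>\<alpha><n. (v \<alpha>)^2) = (1::real)" and n: "0 < n"
  shows "\<exists>A\<in>carrier (orthogonal_group n). \<forall>\<alpha><n. A $$ (\<alpha>, 0) = v \<alpha>"
proof (cases "v 0 = 1")
  case True
  have "(\<Sum>\<alpha>\<in>{..<n} - {0}. (v \<alpha>)^2) = 0"
    using v True n by (simp add: sum.remove[of "{..<n}" 0])
  then have v0: "v \<alpha> = 0" if "\<alpha> < n" "\<alpha> \<noteq> 0" for \<alpha>
    using that by (simp add: sum_nonneg_eq_0_iff)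
  have "1\<^sub>m n \<in> carrier (orthogonal_group n)" by (simp add: orthogonal_group_def)
  then show ?thesis using True v0 n by (intro bexI[of _ "1\<^sub>m n"]) auto
next
  case False
  define s where "s = 1 - v 0"
  have s: "s \<noteq> 0" using False by (simp add: s_def)
  \<comment> \<open>This \<open>w\<close> is the first basis vector minus \<open>v\<close>. Its
    squared norm is \<open>2 * s\<close>, so the reflection 1 - 2 w w^T / |w|^2 becomes 1 - w w^T /
    s.\<close>
  define w where "w = (\<lambda>\<alpha>. (if \<alpha> = 0 then 1 else 0) - v \<alpha>)"
  have ws: "w 0 = s" by (simp add: w_def s_def)
  have ww: "(\<Sum>\<alpha><n. w \<alpha> * w \<alpha>) = 2 * s"
  proof -
    have "(\<Sum>\<alpha><n. w \<alpha> * w \<alpha>) = (\<Sum>\<alpha><n. (if \<alpha> = 0 then 1 - 2 * v 0 else 0) + (v \<alpha>)^2)"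
      by (intro sum.cong refl) (auto simp: w_def algebra_simps power2_eq_square)
    then show ?thesis using v n by (simp add: sum.distrib s_def)
  qed
  define A where "A = mat n n (\<lambda>(i, j). (if i = j then 1 else 0) - w i * w j / s)"
  show ?thesis
  proof (intro bexI[of _ A])
    show "\<forall>\<alpha><n. A $$ (\<alpha>, 0) = v \<alpha>"
      using n s ws by (auto simp: A_def w_def)
    show "A \<in> carrier (orthogonal_group n)"
    proof (rule orthogonal_groupI)
      show "A \<in> carrier_mat n n" by (simp add: A_def)
      fix i j assume ij: "i < n" "j < n"
      have "(\<Sum>m<n. A $$ (m, i) * A $$ (m, j))
          = (\<Sum>m<n. (if m = i then (if i = j then 1 else 0) else 0) - (if m = i then w m * w j / s else 0)
             - (if m = j then w m * w i / s else 0) + w i * w j / s^2 * (w m * w m))"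
        using ij by (intro sum.cong refl) (auto simp: A_def algebra_simps power2_eq_square)
      also have "\<dots> = (if i = j then 1 else 0) - w i * w j / s - w j * w i / s + w i * w j / s^2 * (2 * s)"
        unfolding sum.distrib sum_subtractf sum_distrib_left[symmetric] ww using ij by simp
      also have "w i * w j / s^2 * (2 * s) = w i * w j / s + w j * w i / s"
        using s by (simp add: power2_eq_square)
      finally have "(\<Sum>m<n. A $$ (m, i) * A $$ (m, j)) = (if i = j then 1 else 0)
          - w i * w j / s - w j * w i / s + (w i * w j / s + w j * w i / s)" .
      then show "(\<Sum>m<n. A $$ (m, i) * A $$ (m, j)) = (if i = j then 1 else 0)" by linarith
    qed
  qed
qed

text \<open>Reversing the second column repairs a determinant -1 without touching the first one,
  which takes \<open>n\<close> at least 2.\<close>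

lemma special_orthogonal_first_column:
  assumes v: "(\<Sum>\<alpha><n. (v \<alpha>)^2) = (1::real)" and n: "2 \<le> n"
  shows "\<exists>A\<in>carrier (special_orthogonal_group n). \<forall>\<alpha><n. A $$ (\<alpha>, 0) = v \<alpha>"
proof -
  obtain A where A: "A \<in> carrier (orthogonal_group n)" "\<And>\<alpha>. \<alpha> < n \<Longrightarrow> A $$ (\<alpha>, 0) = v \<alpha>"
    using orthogonal_first_column[OF v] n by auto
  consider "det A = 1" | "det A = -1" using det_orthogonal[OF A(1)] by blast
  then show ?thesis
  proof cases
    case 1
    then show ?thesis using A by (intro bexI[of _ A]) (auto simp: special_orthogonal_group_def)
  next
    case 2
    define D where "D = mat n n (\<lambda>(i, j). if i = j then (if i = 1 then -1 else 1) else (0::real))"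
    have Dc: "D \<in> carrier_mat n n" by (simp add: D_def)
    have DO: "D \<in> carrier (orthogonal_group n)"
    proof (rule orthogonal_groupI[OF Dc])
      fix i j assume ij: "i < n" "j < n"
      have "(\<Sum>m<n. D $$ (m, i) * D $$ (m, j)) = (\<Sum>m<n. if m = i then (if i = j then 1 else 0) else 0)"
        using ij by (intro sum.cong refl) (auto simp: D_def)
      then show "(\<Sum>m<n. D $$ (m, i) * D $$ (m, j)) = (if i = j then 1 else 0)" using ij by simp
    qed
    have "det D = prod_list (diag_mat D)"
      by (rule det_upper_triangular[OF _ Dc]) (auto simp: D_def)
    also have "\<dots> = (\<Prod>i<n. if i = 1 then -1 else 1)"
      by (simp add: prod_list_diag_prod D_def atLeast0LessThan)
    also have "\<dots> = -1" using n by simp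
    finally have detD: "det D = -1" .
    have Ac: "A \<in> carrier_mat n n" using A(1) by (simp add: orthogonal_group_def)
    have "A * D \<in> carrier (orthogonal_group n)"
      using monoid.m_closed[OF group.is_monoid[OF group_orthogonal_group] A(1) DO]
      by (simp add: orthogonal_group_def)
    moreover have "det (A * D) = 1" using 2 detD by (simp add: det_mult[OF Ac Dc])
    moreover have "(A * D) $$ (\<alpha>, 0) = v \<alpha>" if "\<alpha> < n" for \<alpha>
    proof -
      have "(A * D) $$ (\<alpha>, 0) = (\<Sum>m<n. A $$ (\<alpha>, m) * D $$ (m, 0))"
        using that n Ac Dc by (simp add: scalar_prod_def atLeast0LessThan)
      also have "\<dots> = (\<Sum>m<n. if m = 0 then A $$ (\<alpha>, 0) else 0)"
        using n by (intro sum.cong refl) (auto simp: D_def)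
      finally show ?thesis using n A(2)[OF that] by simp
    qed
    ultimately show ?thesis
      by (intro bexI[of _ "A * D"]) (auto simp: special_orthogonal_group_def)
  qed
qed

section \<open>Scalar products of blocks, and orbits of points on an axis\<close>

definition block_product :: "nat \<Rightarrow> nat \<Rightarrow> nat \<Rightarrow> point \<Rightarrow> real" where
  "block_product n i j y = (\<Sum>\<alpha><n. y (i, \<alpha>) * y (j, \<alpha>))"

lemma block_product_homogeneous:
  assumes "i < 2 * k" "j < 2 * k"
  shows "wpoly {2} k n (block_product n i j)"
proof -
  have "wpoly {1 + 1} k n (\<lambda>y. y (i, \<alpha>) * y (j, \<alpha>))" if "\<alpha> < n" for \<alpha>
    using assms that by (intro homogeneous_mult homogeneous_coord) (auto simp: coords_def)
  then have "wpoly {1 + 1} k n (\<lambda>y. \<Sum>\<alpha><n. y (i, \<alpha>) * y (j, \<alpha>))"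
    by (intro wpoly_sum) auto
  then show ?thesis by (simp add: block_product_def[abs_def] numeral_2_eq_2)
qed

lemma block_product_invariant:
  assumes G: "carrier G \<subseteq> carrier (orthogonal_group n)" and ij: "i < 2 * k" "j < 2 * k"
  shows "invariant_on G (diagonal_action k n) (phase_space k n) (block_product n i j)"
  unfolding invariant_on_def
proof (intro ballI)
  fix A y assume A: "A \<in> carrier G" and y: "y \<in> phase_space k n"
  have "block_product n i j (diagonal_action k n A y)
      = (\<Sum>\<alpha><n. (\<Sum>\<beta><n. A $$ (\<alpha>, \<beta>) * y (i, \<beta>)) * (\<Sum>\<gamma><n. A $$ (\<alpha>, \<gamma>) * y (j, \<gamma>)))"
    using y ij by (auto simp: block_product_def diagonal_action_apply coords_def intro!: sum.cong)
  also have "\<dots> = (\<Sum>\<alpha><n. \<Sum>\<beta><n. \<Sum>\<gamma><n. A $$ (\<alpha>, \<beta>) * A $$ (\<alpha>, \<gamma>) * (y (i, \<beta>) * y (j, \<gamma>)))"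
    unfolding sum_product by (intro sum.cong refl) (simp add: mult_ac)
  also have "\<dots> = (\<Sum>\<beta><n. \<Sum>\<alpha><n. \<Sum>\<gamma><n. A $$ (\<alpha>, \<beta>) * A $$ (\<alpha>, \<gamma>) * (y (i, \<beta>) * y (j, \<gamma>)))"
    by (rule sum.swap)
  also have "\<dots> = (\<Sum>\<beta><n. \<Sum>\<gamma><n. \<Sum>\<alpha><n. A $$ (\<alpha>, \<beta>) * A $$ (\<alpha>, \<gamma>) * (y (i, \<beta>) * y (j, \<gamma>)))"
    by (intro sum.cong refl sum.swap)
  also have "\<dots> = (\<Sum>\<beta><n. \<Sum>\<gamma><n. (if \<beta> = \<gamma> then 1 else 0) * (y (i, \<beta>) * y (j, \<gamma>)))"
    using A G by (intro sum.cong refl) (auto simp: sum_distrib_right[symmetric] orthogonal_column_products subset_iff)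
  also have "\<dots> = block_product n i j y"
    unfolding block_product_def
    by (intro sum.cong refl) (simp add: if_distrib[of "\<lambda>u. u * _"] cong: if_cong)
  finally show "block_product n i j (diagonal_action k n A y) = block_product n i j y" .
qed

text \<open>A matrix with first column \<open>v\<close> sends the first axis to the line of
  \<open>v\<close>, for all blocks simultaneously. Asking \<open>G\<close> to contain the special
  orthogonal group covers both quotients at once.\<close>

lemma mem_orbit_axis:
  assumes n: "2 \<le> n" and G: "carrier (special_orthogonal_group n) \<subseteq> carrier G"
    and v: "(\<Sum>\<alpha><n. (v \<alpha>)^2) = 1" and z: "z \<in> phase_space k n" "\<And>i \<alpha>. \<alpha> \<noteq> 0 \<Longrightarrow> z (i, \<alpha>) = 0"
    and y: "y \<in> phase_space k n" "\<And>i \<alpha>. i < 2 * k \<Longrightarrow> \<alpha> < n \<Longrightarrow> y (i, \<alpha>) = z (i, 0) * v \<alpha>"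
  shows "y \<in> orbit G (diagonal_action k n) z"
proof -
  obtain A where A: "A \<in> carrier G" "\<And>\<alpha>. \<alpha> < n \<Longrightarrow> A $$ (\<alpha>, 0) = v \<alpha>"
    using special_orthogonal_first_column[OF v n] G by blast
  have "diagonal_action k n A z = y"
  proof
    fix c :: "nat \<times> nat"
    obtain i \<alpha> where c: "c = (i, \<alpha>)" by force
    show "diagonal_action k n A z c = y c"
    proof (cases "c \<in> coords k n")
      case True
      have "(\<Sum>\<beta><n. A $$ (\<alpha>, \<beta>) * z (i, \<beta>)) = (\<Sum>\<beta><n. if \<beta> = 0 then A $$ (\<alpha>, 0) * z (i, 0) else 0)"
        using z(2) by (intro sum.cong refl) auto
      then show ?thesis
        using True n A(2) y(2) by (auto simp: c diagonal_action_apply z(1) coords_def)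
    next
      case False
      then show ?thesis
        using y(1) diagonal_action_closed[OF z(1), of A] by (simp add: phase_space_def c)
    qed
  qed
  then show ?thesis using A(1) by (auto simp: orbit_def)
qed

section \<open>Quadratic functions and their brackets\<close>

lemma monomial_split:
  fixes e :: "'a \<Rightarrow> nat"
  assumes "finite C" "(\<Sum>c\<in>C. e c) = Suc m"
  shows "\<exists>c\<in>C. \<exists>e'. (\<Sum>c\<in>C. e' c) = m \<and>
           (\<forall>y :: 'a \<Rightarrow> real. (\<Prod>c\<in>C. y c ^ e c) = y c * (\<Prod>c\<in>C. y c ^ e' c))"
proof -
  obtain c where c: "c \<in> C" "e c \<noteq> 0" using assms by (metis Zero_not_Suc sum.neutral)
  define e' where "e' = e(c := e c - 1)"
  have "(\<Sum>c\<in>C. e c) = e c + (\<Sum>d\<in>C - {c}. e d)" using assms(1) c(1) by (rule sum.remove)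
  moreover have "(\<Sum>c\<in>C. e' c) = e' c + (\<Sum>d\<in>C - {c}. e' d)"
    using assms(1) c(1) by (rule sum.remove)
  moreover have "(\<Sum>d\<in>C - {c}. e' d) = (\<Sum>d\<in>C - {c}. e d)"
    by (intro sum.cong) (auto simp: e'_def)
  ultimately have s: "(\<Sum>c\<in>C. e' c) = m" using assms(2) c(2) by (simp add: e'_def)
  have p: "(\<Prod>c\<in>C. y c ^ e c) = y c * (\<Prod>c\<in>C. y c ^ e' c)" for y :: "'a \<Rightarrow> real"
  proof -
    have "(\<Prod>d\<in>C. y d ^ e d) = y c ^ e c * (\<Prod>d\<in>C - {c}. y d ^ e d)"
      using assms(1) c(1) by (rule prod.remove)
    moreover have "(\<Prod>d\<in>C. y d ^ e' d) = y c ^ e' c * (\<Prod>d\<in>C - {c}. y d ^ e' d)"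
      using assms(1) c(1) by (rule prod.remove)
    moreover have "(\<Prod>d\<in>C - {c}. y d ^ e' d) = (\<Prod>d\<in>C - {c}. y d ^ e d)"
      by (intro prod.cong) (auto simp: e'_def)
    moreover have "y c ^ e c = y c * y c ^ e' c"
      using c(2) by (cases "e c") (auto simp: e'_def)
    ultimately show ?thesis by simp
  qed
  show ?thesis using c(1) s p by blast
qed

lemma degree_two_monomial:
  fixes e :: "'a \<Rightarrow> nat"
  assumes "finite C" "(\<Sum>c\<in>C. e c) = 2"
  shows "\<exists>c\<in>C. \<exists>d\<in>C. \<forall>y :: 'a \<Rightarrow> real. (\<Prod>c\<in>C. y c ^ e c) = y c * y d"
proof -
  obtain c e' where c: "c \<in> C" "(\<Sum>c\<in>C. e' c) = Suc 0"
    "\<forall>y :: 'a \<Rightarrow> real. (\<Prod>c\<in>C. y c ^ e c) = y c * (\<Prod>c\<in>C. y c ^ e' c)"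
    using monomial_split[OF assms(1), of e 1] assms(2) by (auto simp: numeral_2_eq_2)
  obtain d e'' where d: "d \<in> C" "(\<Sum>c\<in>C. e'' c) = 0"
    "\<forall>y :: 'a \<Rightarrow> real. (\<Prod>c\<in>C. y c ^ e' c) = y d * (\<Prod>c\<in>C. y c ^ e'' c)"
    using monomial_split[OF assms(1) c(2)] by blast
  have "(\<Prod>c\<in>C. y c ^ e'' c) = 1" for y :: "'a \<Rightarrow> real"
    using d(2) assms(1) by (intro prod.neutral) auto
  then show ?thesis using c(1,3) d(1,3) by auto
qed

lemma bform_sum_coeffs:
  "bform I (\<lambda>c d. \<Sum>e\<in>E. \<beta> e c d) x y = (\<Sum>e\<in>E. bform I (\<beta> e) x y)"
proof -
  have "bform I (\<lambda>c d. \<Sum>e\<in>E. \<beta> e c d) x y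
      = (\<Sum>c\<in>I. \<Sum>e\<in>E. \<Sum>d\<in>I. \<beta> e c d * (x c * y d))"
    unfolding bform_def sum_distrib_right by (intro sum.cong refl sum.swap)
  also have "\<dots> = (\<Sum>e\<in>E. bform I (\<beta> e) x y)"
    unfolding bform_def by (rule sum.swap)
  finally show ?thesis .
qed

lemma bform_unit:
  assumes "finite I" "p \<in> I" "q \<in> I"
  shows "bform I (\<lambda>c d. if c = p \<and> d = q then 1 else 0) x y = x p * y q"
proof -
  have "bform I (\<lambda>c d. if c = p \<and> d = q then 1 else 0) x y
      = (\<Sum>c\<in>I. if c = p then (\<Sum>d\<in>I. if d = q then x p * y q else 0) else 0)"
    unfolding bform_def by (intro sum.cong refl) (auto intro!: sum.cong)
  then show ?thesis using assms by simp
qed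

text \<open>A monomial of degree two is a product of two coordinates; splitting its coefficient
  evenly between the matrix entry and the transposed entry gives symmetry.\<close>

lemma quadratic_form_exists:
  assumes "wpoly {2} k n f"
  shows "\<exists>\<beta>. (\<forall>c d. \<beta> c d = \<beta> d c) \<and>
    (\<forall>y\<in>phase_space k n. f y = bform (coords k n) \<beta> y y)"
proof -
  let ?I = "coords k n"
  obtain E a where E: "finite E" "\<And>e. e \<in> E \<Longrightarrow> (\<Sum>c\<in>?I. e c) = 2"
    "\<And>y. y \<in> phase_space k n \<Longrightarrow> f y = (\<Sum>e\<in>E. a e * (\<Prod>c\<in>?I. y c ^ e c))"
    using assms unfolding wpoly_def by auto
  have "\<forall>e\<in>E. \<exists>p. fst p \<in> ?I \<and> snd p \<in> ?I \<and> (\<forall>y. (\<Prod>c\<in>?I. y c ^ e c :: real) = y (fst p) * y (snd p))"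
  proof
    fix e assume "e \<in> E"
    then obtain c d where "c \<in> ?I" "d \<in> ?I" "\<forall>y. (\<Prod>c\<in>?I. y c ^ e c :: real) = y c * y d"
      using degree_two_monomial[OF finite_coords E(2)] by blast
    then show "\<exists>p. fst p \<in> ?I \<and> snd p \<in> ?I \<and>
        (\<forall>y. (\<Prod>c\<in>?I. y c ^ e c :: real) = y (fst p) * y (snd p))"
      by (intro exI[of _ "(c, d)"]) simp
  qed
  from bchoice[OF this] obtain p where p: "\<forall>e\<in>E. fst (p e) \<in> ?I \<and> snd (p e) \<in> ?I \<and>
      (\<forall>y. (\<Prod>c\<in>?I. y c ^ e c :: real) = y (fst (p e)) * y (snd (p e)))" ..
  define u where "u = (\<lambda>e c d. if c = fst (p e) \<and> d = snd (p e) then 1 else (0::real))"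
  define \<beta> where "\<beta> = (\<lambda>c d. \<Sum>e\<in>E. a e / 2 * (u e c d + u e d c))"
  have "f y = bform ?I \<beta> y y" if y: "y \<in> phase_space k n" for y
  proof -
    have flip: "bform ?I (\<lambda>c d. u e d c) y y = bform ?I (u e) y y" for e
      unfolding bform_def by (subst sum.swap) (simp add: mult_ac)
    have "bform ?I (\<lambda>c d. a e / 2 * (u e c d + u e d c)) y y
        = a e / 2 * (bform ?I (u e) y y + bform ?I (\<lambda>c d. u e d c) y y)" for e
      by (simp add: bform_def sum_distrib_left sum.distrib algebra_simps)
    then have "bform ?I (\<lambda>c d. a e / 2 * (u e c d + u e d c)) y y = a e * bform ?I (u e) y y" for e
      unfolding flip by simp
    then have "bform ?I \<beta> y y = (\<Sum>e\<in>E. a e * bform ?I (u e) y y)"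
      unfolding \<beta>_def bform_sum_coeffs by simp
    also have "\<dots> = (\<Sum>e\<in>E. a e * (\<Prod>c\<in>?I. y c ^ e c))"
      using p by (intro sum.cong refl) (simp add: u_def bform_unit)
    finally show ?thesis using E(3)[OF y] by simp
  qed
  moreover have "\<beta> c d = \<beta> d c" for c d by (simp add: \<beta>_def add.commute)
  ultimately show ?thesis by blast
qed

lemma partial_quadratic:
  assumes sym: "\<forall>c d. \<beta> c d = \<beta> d c"
    and f: "\<And>y. y \<in> phase_space k n \<Longrightarrow> f y = bform (coords k n) \<beta> y y"
    and z: "z \<in> phase_space k n" and b: "b \<in> coords k n"
  shows "partial b f z = 2 * bform (coords k n) \<beta> z (\<lambda>c. if c = b then 1 else 0)"
proof -
  let ?B = "bform (coords k n) \<beta>" and ?e = "\<lambda>c. if c = b then 1 else (0::real)"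
  have "f (z(b := t)) = ?B z z + 2 * (t - z b) * ?B z ?e + (t - z b)^2 * ?B ?e ?e" for t
  proof -
    have "z(b := t) = (\<lambda>c. 1 * z c + (t - z b) * ?e c)" by auto
    then have "f (z(b := t)) = ?B (\<lambda>c. 1 * z c + (t - z b) * ?e c) (\<lambda>c. 1 * z c + (t - z b) * ?e c)"
      using f[OF phase_space_update[OF z b]] by metis
    then show ?thesis unfolding bform_lincomb_diag[OF sym] by simp
  qed
  then have "((\<lambda>t. f (z(b := t))) has_real_derivative 2 * ?B z ?e) (at (z b))"
    by (auto intro!: derivative_eq_intros)
  then show ?thesis unfolding partial_def by (rule DERIV_imp_deriv)
qed

lemma partial_block_product:
  assumes "\<alpha> < n"
  shows "partial (a, \<alpha>) (block_product n i j) y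
    = (if i = a then y (j, \<alpha>) else 0) + (if j = a then y (i, \<alpha>) else 0)"
proof -
  let ?y = "\<lambda>t. y((a, \<alpha>) := t)"
  have c: "((\<lambda>t. ?y t b) has_real_derivative (if b = (a, \<alpha>) then 1 else 0)) (at t)" for b t
    by auto
  have "((\<lambda>t. \<Sum>\<beta><n. ?y t (i, \<beta>) * ?y t (j, \<beta>)) has_real_derivative
     (\<Sum>\<beta><n. (if (i, \<beta>) = (a, \<alpha>) then 1 else 0) * ?y (y (a, \<alpha>)) (j, \<beta>) +
        (if (j, \<beta>) = (a, \<alpha>) then 1 else 0) * ?y (y (a, \<alpha>)) (i, \<beta>))) (at (y (a, \<alpha>)))"
    by (intro DERIV_sum DERIV_mult c)
  also have "(\<Sum>\<beta><n. (if (i, \<beta>) = (a, \<alpha>) then 1 else 0) * ?y (y (a, \<alpha>)) (j, \<beta>) +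
        (if (j, \<beta>) = (a, \<alpha>) then 1 else 0) * ?y (y (a, \<alpha>)) (i, \<beta>))
      = (\<Sum>\<beta><n. if \<beta> = \<alpha> then (if i = a then y (j, \<alpha>) else 0) + (if j = a then y (i, \<alpha>) else 0) else 0)"
    by (intro sum.cong refl) auto
  also have "\<dots> = (if i = a then y (j, \<alpha>) else 0) + (if j = a then y (i, \<alpha>) else 0)"
    using assms by simp
  finally show ?thesis
    unfolding partial_def block_product_def by (rule DERIV_imp_deriv)
qed

text \<open>The flow of q_1 . p_1 rescales block 0 and block 1 by inverse factors and fixes the
  other blocks, so the squared norms of blocks are eigenvectors. The signs come from the convention
  {q, p} = 1.\<close>

lemma poisson_block_product:
  assumes "1 \<le> k"
  shows "poisson k n (block_product n 0 1) (block_product n j j)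
    = (\<lambda>y. (if j = 0 then - 2 else if j = 1 then 2 else 0) * block_product n j j y)"
proof
  fix y
  have "poisson k n (block_product n 0 1) (block_product n j j) y
      = (\<Sum>l<k. if l = 0 then (\<Sum>\<alpha><n. (if j = 0 then - 2 else if j = 1 then 2 else 0) * (y (j, \<alpha>) * y (j, \<alpha>))) else 0)"
    unfolding poisson_def
  proof (rule sum.cong[OF refl])
    fix l
    show "(\<Sum>\<alpha><n. partial (2 * l, \<alpha>) (block_product n 0 1) y * partial (2 * l + 1, \<alpha>) (block_product n j j) y
        - partial (2 * l + 1, \<alpha>) (block_product n 0 1) y * partial (2 * l, \<alpha>) (block_product n j j) y)
      = (if l = 0 then (\<Sum>\<alpha><n. (if j = 0 then - 2 else if j = 1 then 2 else 0) * (y (j, \<alpha>) * y (j, \<alpha>))) else 0)"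
      by (cases "l = 0") (auto simp: partial_block_product intro!: sum.neutral sum.cong)
  qed
  also have "\<dots> = (if j = 0 then - 2 else if j = 1 then 2 else 0) * block_product n j j y"
    using assms by (simp add: block_product_def sum_distrib_left)
  finally show "poisson k n (block_product n 0 1) (block_product n j j) y
      = (if j = 0 then - 2 else if j = 1 then 2 else 0) * block_product n j j y" .
qed

lemma poisson_cong:
  assumes "\<And>y. y \<in> phase_space k n \<Longrightarrow> f y = f' y" "\<And>y. y \<in> phase_space k n \<Longrightarrow> g y = g' y"
    and y: "y \<in> phase_space k n"
  shows "poisson k n f g y = poisson k n f' g' y"
proof -
  have "partial c h y = partial c h' y"
    if "c \<in> coords k n" "\<And>y. y \<in> phase_space k n \<Longrightarrow> h y = h' y" for c h h'
    using that phase_space_update[OF y] by (simp add: partial_def)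
  note p = this[OF _ assms(1)] this[OF _ assms(2)]
  show ?thesis unfolding poisson_def
    by (intro sum.cong refl) (auto simp: p coords_def)
qed

text \<open>The graph of the bracket only provides some representatives \<open>f'\<close> and
  \<open>g'\<close>. On an orbifold every point counts, not just those of a zero set, so they agree
  with \<open>f\<close> and \<open>g\<close> throughout the phase space, and the identity holds
  pointwise instead of modulo an ideal.\<close>

lemma bracket_value_unitary:
  fixes N :: nat and \<Gamma> :: "complex mat set"
  defines "G \<equiv> unitary_group N\<lparr>carrier := \<Gamma>\<rparr>" and "V \<equiv> phase_space 1 N"
  assumes sub: "subgroup \<Gamma> (unitary_group N)"
    and f: "polynomial_on 1 N f" "invariant_on G (unitary_action N) V f"
    and g: "polynomial_on 1 N g" "invariant_on G (unitary_action N) V g"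
    and h: "invariant_on G (unitary_action N) V h"
    and br: "bracket_graph (linear_symplectic_orbifold N \<Gamma>) (descend G (unitary_action N) V f)
       (descend G (unitary_action N) V g) (descend G (unitary_action N) V h)"
    and z: "z \<in> V"
  shows "poisson 1 N f g z = h z"
proof -
  let ?d = "descend G (unitary_action N) V"
  have ga: "group_action G V (unitary_action N)"
    unfolding G_def V_def
    by (rule group_action_subgroup[OF group_action_unitary group_unitary_group sub])
  have desc: "?d u (orbit G (unitary_action N) z) = u z"
    if "invariant_on G (unitary_action N) V u" "z \<in> V" for u z
    by (rule descend_apply[OF ga that(1) subset_refl that(2)])
  obtain f' g' where f': "polynomial_on 1 N f'" "invariant_on G (unitary_action N) V f'" "?d f' = ?d f"
    and g': "polynomial_on 1 N g'" "invariant_on G (unitary_action N) V g'" "?d g' = ?d g"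
    and fg: "?d (poisson 1 N f' g') = ?d h"
    using br unfolding linear_symplectic_orbifold_def quotient_space_def G_def V_def by auto
  have eq: "f' z = f z" "g' z = g z" if "z \<in> V" for z
    using desc[OF f'(2) that] desc[OF f(2) that] f'(3) desc[OF g'(2) that] desc[OF g(2) that] g'(3)
    by auto
  have "invariant_on G (unitary_action N) V (poisson 1 N f' g')"
    unfolding invariant_on_def
  proof (intro ballI)
    fix A y assume A: "A \<in> carrier G" and y: "y \<in> V"
    have AU: "A \<in> carrier (unitary_group N)"
      using A subgroup.subset[OF sub] by (auto simp: G_def)
    show "poisson 1 N f' g' (unitary_action N A y) = poisson 1 N f' g' y"
      using f'(2) g'(2) A y
      by (intro poisson_invariant_unitary[OF AU f'(1) _ g'(1)]) (auto simp: invariant_on_def V_def)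
  qed
  then have "poisson 1 N f' g' z = h z" using desc[OF _ z] h fg by metis
  moreover have "poisson 1 N f' g' z = poisson 1 N f g z"
    using z eq unfolding V_def by (intro poisson_cong) auto
  ultimately show ?thesis by simp
qed

section \<open>Symplectic quotients that are not orbifolds\<close>

text \<open>The isomorphism runs from functions on the target to functions on the source and maps
  each graded part onto its counterpart. An invariant of the source thus has a preimage of the same
  degree, and the two are compared at points matched by \<open>h\<close>.\<close>

lemma transfer_function:
  assumes ga: "group_action G (phase_space k n) \<phi>" and Z: "Z \<subseteq> phase_space k n"
    and ga': "group_action G' (phase_space k' n') \<phi>'" and Z': "Z' \<subseteq> phase_space k' n'"
    and iso: "graded_poisson_iso (quotient_space k' n' Z' G' \<phi>') (quotient_space k n Z G \<phi>)
       (\<lambda>F. \<lambda>x\<in>points (quotient_space k n Z G \<phi>). F (h x))"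
    and f: "wpoly {d} k n f" "invariant_on G \<phi> (phase_space k n) f"
  shows "\<exists>f'. wpoly {d} k' n' f' \<and> invariant_on G' \<phi>' (phase_space k' n') f' \<and>
    (\<forall>y\<in>Z. \<forall>z\<in>Z'. h (orbit G \<phi> y) = orbit G' \<phi>' z \<longrightarrow> f' z = f y)"
proof -
  let ?M = "quotient_space k n Z G \<phi>" and ?M' = "quotient_space k' n' Z' G' \<phi>'"
  let ?\<Phi> = "\<lambda>F. \<lambda>x\<in>points ?M. F (h x)"
  have "descend G \<phi> Z f \<in> graded_part ?M d"
    using f by (auto simp: quotient_space_def homogeneous_on_eq_wpoly)
  also have "graded_part ?M d = ?\<Phi> ` graded_part ?M' d"
    using iso unfolding graded_poisson_iso_def by blast
  finally obtain f' where f': "wpoly {d} k' n' f'" "invariant_on G' \<phi>' (phase_space k' n') f'"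
    and eq: "descend G \<phi> Z f = ?\<Phi> (descend G' \<phi>' Z' f')"
    by (auto simp: quotient_space_def homogeneous_on_eq_wpoly)
  have "f' z = f y" if y: "y \<in> Z" and z: "z \<in> Z'" and h: "h (orbit G \<phi> y) = orbit G' \<phi>' z" for y z
  proof -
    have p: "orbit G \<phi> y \<in> points ?M" using y by (auto simp: points_quotient_space orbits_def)
    have "f y = descend G \<phi> Z f (orbit G \<phi> y)" by (rule descend_apply[OF ga f(2) Z y, symmetric])
    also have "\<dots> = descend G' \<phi>' Z' f' (orbit G' \<phi>' z)" unfolding eq using p h by simp
    also have "\<dots> = f' z" by (rule descend_apply[OF ga' f'(2) Z' z])
    finally show ?thesis by simp
  qed
  then show ?thesis using f' by blast
qed

text \<open>Finiteness of \<open>\<Gamma>\<close> enters as finiteness of its orbits, in two places: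
  no orbit contains a line, which makes the sum of the forms definite, and the fibres over the axis
  points are finite.\<close>

lemma quotient_not_orbifold:
  fixes k n N :: nat and \<Gamma> :: "complex mat set" and G :: "real mat monoid"
  assumes k: "2 \<le> k" and n: "2 \<le> n"
    and G: "G = orthogonal_group n \<or> G = special_orthogonal_group n"
    and fin: "finite \<Gamma>" and sub: "subgroup \<Gamma> (unitary_group N)"
    and symp: "graded_regularly_symplectomorphic
       (quotient_space k n (moment_zero_set k n) G (diagonal_action k n))
       (linear_symplectic_orbifold N \<Gamma>)"
  shows False
proof -
  define V where "V = phase_space k n"
  define Z where "Z = moment_zero_set k n"
  define \<phi> where "\<phi> = diagonal_action k n"
  define V' where "V' = phase_space 1 N"
  define G' where "G' = unitary_group N\<lparr>carrier := \<Gamma>\<rparr>"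
  define \<phi>' where "\<phi>' = unitary_action N"
  define M where "M = quotient_space k n Z G \<phi>"
  define M' where "M' = quotient_space 1 N V' G' \<phi>'"
  define I where "I = coords 1 N"
  define bp where "bp = block_product n"
  have M': "linear_symplectic_orbifold N \<Gamma> = M'"
    by (simp add: M'_def linear_symplectic_orbifold_def V'_def G'_def \<phi>'_def)
  have Gsub: "carrier (special_orthogonal_group n) \<subseteq> carrier G" "carrier G \<subseteq> carrier (orthogonal_group n)"
    using G by (auto simp: special_orthogonal_group_def)
  have ga: "group_action G V \<phi>"
    using G group_action_orthogonal group_action_special_orthogonal by (auto simp: V_def \<phi>_def)
  have ga': "group_action G' V' \<phi>'"
    unfolding G'_def V'_def \<phi>'_def
    by (rule group_action_subgroup[OF group_action_unitary group_unitary_group sub])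
  interpret A: group_action G V \<phi> by (rule ga)
  interpret B: group_action G' V' \<phi>' by (rule ga')
  let ?O = "orbit G \<phi>" and ?O' = "orbit G' \<phi>'"
  have ZV: "Z \<subseteq> V" by (auto simp: Z_def V_def moment_zero_set_def)
  obtain h where hom: "homeomorphic_map (space_topology M) (space_topology M') h"
    and iso: "graded_poisson_iso M' M (\<lambda>F. \<lambda>x\<in>points M. F (h x))"
    using symp unfolding graded_regularly_symplectomorphic_def M' Z_def[symmetric] \<phi>_def[symmetric]
      M_def[symmetric] by blast
  have pM: "points M = orbits G Z \<phi>" and pM': "points M' = orbits G' V' \<phi>'"
    by (simp_all add: M_def M'_def points_quotient_space)
  have hsurj: "\<exists>y\<in>Z. h (?O y) = ?O' z" if "z \<in> V'" for z
  proof -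
    have "?O' z \<in> h ` points M"
      using that homeomorphic_imp_surjective_map[OF hom] pM' by (auto simp: orbits_def)
    then show ?thesis unfolding pM orbits_def by force
  qed
  have hval: "\<exists>z\<in>V'. h (?O y) = ?O' z" if "y \<in> Z" for y
  proof -
    have "h (?O y) \<in> points M'"
      using that homeomorphic_imp_surjective_map[OF hom] pM by (auto simp: orbits_def)
    then show ?thesis unfolding pM' orbits_def by force
  qed
  have hinj: "?O y = ?O y'" if "y \<in> Z" "y' \<in> Z" "h (?O y) = h (?O y')" for y y'
    using homeomorphic_imp_injective_map[OF hom] that unfolding pM orbits_def inj_on_def by blast
  have finO': "finite (?O' z)" for z
  proof -
    have "?O' z = (\<lambda>g. \<phi>' g z) ` \<Gamma>" by (auto simp: orbit_def G'_def)
    then show ?thesis using fin by simp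
  qed
  have zO': "z \<in> ?O' z" if "z \<in> V'" for z using that by (rule B.orbit_refl)
  have finh: "finite (h (?O y))" if "y \<in> Z" for y using hval[OF that] finO' by metis

  have bp_hom: "wpoly {2} k n (bp i j)" if "i < 2 * k" "j < 2 * k" for i j
    unfolding bp_def using that by (rule block_product_homogeneous)
  have bp_inv: "invariant_on G \<phi> V (bp i j)" if "i < 2 * k" "j < 2 * k" for i j
    unfolding bp_def V_def \<phi>_def using Gsub(2) that by (rule block_product_invariant)
  have transfer: "\<exists>f'. wpoly {2} 1 N f' \<and> invariant_on G' \<phi>' V' f' \<and>
      (\<forall>y\<in>Z. \<forall>z\<in>V'. h (?O y) = ?O' z \<longrightarrow> f' z = bp i j y)"
    if "i < 2 * k" "j < 2 * k" for i j
    using transfer_function[OF ga[unfolded V_def] ZV[unfolded V_def] ga'[unfolded V'_def] subset_refl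
        iso[unfolded M_def M'_def V'_def] bp_hom[OF that] bp_inv[OF that, unfolded V_def]]
    unfolding V'_def .
  have "\<forall>j. \<exists>f'. j < 2 * k \<longrightarrow> wpoly {2} 1 N f' \<and> invariant_on G' \<phi>' V' f' \<and>
      (\<forall>y\<in>Z. \<forall>z\<in>V'. h (?O y) = ?O' z \<longrightarrow> f' z = bp j j y)"
    using transfer by blast
  from choice[OF this] obtain s where s: "\<forall>j. j < 2 * k \<longrightarrow> wpoly {2} 1 N (s j) \<and>
      invariant_on G' \<phi>' V' (s j) \<and>
      (\<forall>y\<in>Z. \<forall>z\<in>V'. h (?O y) = ?O' z \<longrightarrow> s j z = bp j j y)" ..
  obtain \<eta> where \<eta>: "wpoly {2} 1 N \<eta>" "invariant_on G' \<phi>' V' \<eta>"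
      "\<And>y z. y \<in> Z \<Longrightarrow> z \<in> V' \<Longrightarrow> h (?O y) = ?O' z \<Longrightarrow> \<eta> z = bp 0 1 y"
    using transfer[of 0 1] k by auto
  have s_hom: "wpoly {2} 1 N (s j)" and s_inv: "invariant_on G' \<phi>' V' (s j)"
    and s_val: "\<And>y z. y \<in> Z \<Longrightarrow> z \<in> V' \<Longrightarrow> h (?O y) = ?O' z \<Longrightarrow> s j z = bp j j y"
    if "j < 2 * k" for j using s that by blast+
  have bp_sq: "bp j j y = (\<Sum>\<alpha><n. (y (j, \<alpha>))^2)" for j y
    by (simp add: bp_def block_product_def power2_eq_square)

  have "\<forall>j. \<exists>\<beta>. j < 2 * k \<longrightarrow> (\<forall>c d. \<beta> c d = \<beta> d c) \<and> (\<forall>z\<in>V'. s j z = bform I \<beta> z z)"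
    using quadratic_form_exists[OF s_hom] unfolding I_def V'_def by blast
  from choice[OF this] obtain \<beta> where \<beta>: "\<forall>j. j < 2 * k \<longrightarrow>
      (\<forall>c d. \<beta> j c d = \<beta> j d c) \<and> (\<forall>z\<in>V'. s j z = bform I (\<beta> j) z z)" ..
  have \<beta>_sym: "\<forall>c d. \<beta> j c d = \<beta> j d c" and \<beta>_val: "\<And>z. z \<in> V' \<Longrightarrow> s j z = bform I (\<beta> j) z z"
    if "j < 2 * k" for j using \<beta> that by blast+
  obtain \<theta> where \<theta>_sym: "\<forall>c d. \<theta> c d = \<theta> d c" and \<theta>_val: "\<And>z. z \<in> V' \<Longrightarrow> \<eta> z = bform I \<theta> z z"
    using quadratic_form_exists[OF \<eta>(1)] unfolding I_def V'_def by blast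

  \<comment> \<open>Forms see only the coordinates in \<open>I\<close>, but the \<open>s j\<close>
    are tied to them on \<open>V'\<close> alone. Cutting off moves any vector into \<open>V'\<close>
    without changing a form.\<close>
  define cut where "cut = (\<lambda>x c. if c \<in> I then x c else (0::real))"
  have cutV: "cut x \<in> V'" for x by (auto simp: cut_def V'_def I_def phase_space_def)
  have cut_bform: "bform I b x y = bform I b (cut x) (cut y)" for b x y
    by (rule bform_cong) (auto simp: cut_def)
  have cut_bform': "bform I b x y = bform I b (cut x) y" for b x y
    by (rule bform_cong) (auto simp: cut_def)
  \<comment> \<open>Every \<open>z\<close> in \<open>V'\<close> corresponds to a real point of the
    zero set, where the value is a sum of squares.\<close>
  have psd: "\<forall>x. 0 \<le> bform I (\<beta> j) x x" if j: "j < 2 * k" for j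
  proof
    fix x
    obtain y where "y \<in> Z" "h (?O y) = ?O' (cut x)" using hsurj[OF cutV] by blast
    then have "s j (cut x) = bp j j y" using s_val[OF j] cutV by blast
    then show "0 \<le> bform I (\<beta> j) x x"
      using \<beta>_val[OF j cutV, of x] by (simp add: cut_bform[of _ x] bp_sq sum_nonneg)
  qed

  define \<gamma> where "\<gamma> = (\<lambda>c d. \<Sum>j<2*k. \<beta> j c d)"
  have \<gamma>: "bform I \<gamma> x y = (\<Sum>j<2*k. bform I (\<beta> j) x y)" for x y
    unfolding \<gamma>_def by (rule bform_sum_coeffs)
  have \<gamma>_sym: "\<forall>c d. \<gamma> c d = \<gamma> d c"
    unfolding \<gamma>_def using \<beta>_sym by (metis (no_types, lifting) lessThan_iff sum.cong)
  have point0: "(\<lambda>c. 0) \<in> Z" by (simp add: Z_def moment_zero_set_def phase_space_def)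
  have pos: "\<forall>x. (\<exists>c\<in>I. x c \<noteq> 0) \<longrightarrow> bform I \<gamma> x x > 0"
  proof (intro allI impI)
    fix x :: point assume "\<exists>c\<in>I. x c \<noteq> 0"
    then obtain c where c: "c \<in> I" "x c \<noteq> 0" by blast
    have nonneg: "0 \<le> bform I \<gamma> x x" unfolding \<gamma> using psd by (intro sum_nonneg) auto
    show "bform I \<gamma> x x > 0"
    proof (rule ccontr)
      assume "\<not> bform I \<gamma> x x > 0"
      then have "(\<Sum>j<2*k. bform I (\<beta> j) x x) = 0" using nonneg unfolding \<gamma> by simp
      then have z0: "bform I (\<beta> j) x x = 0" if "j < 2 * k" for j
        using that psd by (subst (asm) sum_nonneg_eq_0_iff) auto
      \<comment> \<open>All \<open>s j\<close> vanish on the line through a null vector, so each of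
        its points corresponds to the origin; a single finite orbit would have to contain the whole
        line.\<close>
      define tx where "tx = (\<lambda>t::real. cut (\<lambda>c. t * x c + 0 * x c))"
      have "tx t \<in> h (?O (\<lambda>c. 0))" for t
      proof -
        obtain y where y: "y \<in> Z" "h (?O y) = ?O' (tx t)" using hsurj[of "tx t"] cutV tx_def by auto
        have "y (j, \<alpha>) = 0" if j: "j < 2 * k" and "\<alpha> < n" for j \<alpha>
        proof -
          have "s j (tx t) = bform I (\<beta> j) (\<lambda>c. t * x c + 0 * x c) (\<lambda>c. t * x c + 0 * x c)"
            unfolding tx_def \<beta>_val[OF j cutV] by (rule cut_bform[symmetric])
          also have "\<dots> = 0" unfolding bform_lincomb_diag[OF \<beta>_sym[OF j]] using z0[OF j] by simp
          finally have "s j (tx t) = 0" .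
          then have "(\<Sum>\<alpha><n. (y (j, \<alpha>))^2) = 0"
            using s_val[OF j y(1) _ y(2)] cutV by (simp add: tx_def bp_sq)
          then show ?thesis using \<open>\<alpha> < n\<close> by (simp add: sum_nonneg_eq_0_iff)
        qed
        then have "y c = 0" for c
          using y(1) ZV unfolding V_def phase_space_def coords_def by (cases c) blast
        then have "y = (\<lambda>c. 0)" by blast
        then show ?thesis using y(2) zO'[of "tx t"] cutV by (simp add: tx_def)
      qed
      then have "finite (range tx)" using finh[OF point0] by (meson finite_subset image_subsetI)
      moreover have "inj tx"
      proof (rule injI)
        fix t u assume "tx t = tx u"
        then have "tx t c = tx u c" by simp
        then show "t = u" using c by (simp add: tx_def cut_def)
      qed
      ultimately have "finite (UNIV :: real set)" by (rule finite_imageD)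
      then show False using infinite_UNIV_char_0 by blast
    qed
  qed

  have bracket: "poisson 1 N \<eta> (s j) z = (if j = 0 then - 2 else if j = 1 then 2 else 0) * s j z"
    if j: "j < 2 * k" and z: "z \<in> V'" for j z
  proof -
    define c where "c = (if j = 0 then - 2 else if j = 1 then 2 else (0::real))"
    let ?d = "descend G \<phi> Z" and ?d' = "descend G' \<phi>' V'"
    let ?\<Phi> = "\<lambda>F. \<lambda>x\<in>points M. F (h x)"
    have poly: "polynomial_on k n f" if "wpoly {2} k n f" for k n f
      using that wpoly_mono by (auto simp: polynomial_on_eq_wpoly)
    have k01: "0 < 2 * k" "1 < 2 * k" using k by auto
    have cs_inv: "invariant_on G' \<phi>' V' (\<lambda>z. c * s j z)"
      using s_inv[OF j] by (simp add: invariant_on_def)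
    have cbp_inv: "invariant_on G \<phi> V (\<lambda>y. c * bp j j y)"
      using bp_inv[OF j j] by (simp add: invariant_on_def)
    have reg: "?d' \<eta> \<in> regular_functions M'" "?d' (s j) \<in> regular_functions M'"
      "?d' (\<lambda>z. c * s j z) \<in> regular_functions M'"
      using poly[OF \<eta>(1)] poly[OF s_hom[OF j]] poly[OF wpoly_cmult[OF s_hom[OF j]]]
        \<eta>(2) s_inv[OF j] cs_inv
      by (auto simp: M'_def quotient_space_def V'_def)
    \<comment> \<open>Functions that agree at matched points are exchanged by the isomorphism.
      Applied three times, this carries the bracket relation of block products over to
      \<open>\<eta>\<close> and \<open>s j\<close>.\<close>
    have im: "?\<Phi> (?d' f') = ?d f"
      if "invariant_on G \<phi> V f" "invariant_on G' \<phi>' V' f'"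
        "\<And>y z. y \<in> Z \<Longrightarrow> z \<in> V' \<Longrightarrow> h (?O y) = ?O' z \<Longrightarrow> f' z = f y" for f f'
    proof
      fix x
      show "?\<Phi> (?d' f') x = ?d f x"
      proof (cases "x \<in> points M")
        case True
        then obtain y where y: "y \<in> Z" "x = ?O y" by (auto simp: pM orbits_def)
        obtain z where z: "z \<in> V'" "h (?O y) = ?O' z" using hval[OF y(1)] by blast
        have "?\<Phi> (?d' f') x = f' z"
          using True y z descend_apply[OF ga' that(2) subset_refl z(1)] by simp
        also have "\<dots> = f y" by (rule that(3)[OF y(1) z])
        also have "\<dots> = ?d f x" using descend_apply[OF ga that(1) ZV y(1)] y by simp
        finally show ?thesis .
      qed (simp add: descend_def pM)
    qed
    have br: "bracket_graph M (?d (bp 0 1)) (?d (bp j j)) (?d (\<lambda>y. c * bp j j y))"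
    proof -
      have "poisson k n (bp 0 1) (bp j j) = (\<lambda>y. c * bp j j y)"
        unfolding bp_def c_def using k by (intro poisson_block_product) simp
      then show ?thesis
        using poly[OF bp_hom[OF k01]] poly[OF bp_hom[OF j j]] bp_inv[OF k01] bp_inv[OF j j]
        unfolding M_def quotient_space_def V_def poisson_space.simps
        by (intro exI[of _ "bp 0 1"] exI[of _ "bp j j"] conjI; simp)
    qed
    have im1: "?\<Phi> (?d' \<eta>) = ?d (bp 0 1)"
      by (rule im[OF bp_inv[OF k01] \<eta>(2)]) (rule \<eta>(3))
    have im2: "?\<Phi> (?d' (s j)) = ?d (bp j j)"
      by (rule im[OF bp_inv[OF j j] s_inv[OF j]]) (rule s_val[OF j])
    have im3: "?\<Phi> (?d' (\<lambda>z. c * s j z)) = ?d (\<lambda>y. c * bp j j y)"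
      by (rule im[OF cbp_inv cs_inv]) (simp add: s_val[OF j])
    have isoB: "\<forall>F\<in>regular_functions M'. \<forall>G\<in>regular_functions M'. \<forall>H\<in>regular_functions M'.
        bracket_graph M' F G H \<longleftrightarrow> bracket_graph M (?\<Phi> F) (?\<Phi> G) (?\<Phi> H)"
      using iso unfolding graded_poisson_iso_def by (elim conjE)
    have "bracket_graph M' (?d' \<eta>) (?d' (s j)) (?d' (\<lambda>z. c * s j z))"
      using isoB[rule_format, OF reg] br unfolding im1 im2 im3 by (rule iffD2)
    then have "poisson 1 N \<eta> (s j) z = c * s j z"
      using bracket_value_unitary[OF sub poly[OF \<eta>(1)] _ poly[OF s_hom[OF j]]] \<eta>(2) s_inv[OF j]
        cs_inv z
      unfolding M'[symmetric] G'_def V'_def \<phi>'_def by blast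
    then show ?thesis by (simp add: c_def)
  qed

  text \<open>The linear vector field generated by the function corresponding to \<open>q\<^sub>1 \<cdot> p\<^sub>1\<close>, scaled so
    that it acts on the forms \<open>\<beta> 0\<close> and \<open>\<beta> 1\<close> with weights 1 and -1.\<close>

  define u where "u = (\<lambda>b c::nat \<times> nat. if c = b then 1 else (0::real))"
  define H where "H = (\<lambda>x (i, m). if i = (1::nat) then - 2 * bform I \<theta> x (u (0, m))
      else 2 * bform I \<theta> x (u (1, m)))"
  have Hweight: "bform I (\<beta> j) x (H x)
      = (if j = 0 then 1 else if j = 1 then -1 else 0) * bform I (\<beta> j) x x"
    if j: "j < 2 * k" for j x
  proof -
    have *: "bform I (\<beta> j) z (H z)
      = (if j = 0 then 1 else if j = 1 then -1 else 0) * bform I (\<beta> j) z z" if z: "z \<in> V'" for z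
    proof -
      have p\<beta>: "partial b (s j) z = 2 * bform I (\<beta> j) z (u b)"
        and p\<theta>: "partial b \<eta> z = 2 * bform I \<theta> z (u b)" if "b \<in> I" for b
        using that z \<beta>_val[OF j] \<theta>_val unfolding I_def V'_def u_def
        by (auto intro!: partial_quadratic \<beta>_sym[OF j] \<theta>_sym)
      have "bform I (\<beta> j) z (H z) = bform I (\<beta> j) z (\<lambda>c. \<Sum>b\<in>I. H z b * u b c)"
        by (rule bform_cong) (simp_all add: u_def I_def if_distrib[of "\<lambda>u. _ * u"] cong: if_cong)
      also have "\<dots> = (\<Sum>b\<in>I. H z b * bform I (\<beta> j) z (u b))" by (rule bform_sum_right)
      also have "\<dots> = (\<Sum>m<N. H z (0, m) * bform I (\<beta> j) z (u (0, m)) + H z (1, m) * bform I (\<beta> j) z (u (1, m)))"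
        unfolding I_def sum_coords by (simp add: numeral_2_eq_2 sum.distrib)
      \<comment> \<open>Up to sign \<open>H\<close> consists of partial derivatives of
        \<open>\<eta>\<close>, while the values of \<open>\<beta> j\<close> are half the partial
        derivatives of \<open>s j\<close>. The resulting factor -1/2 turns the eigenvalues -2 and 2
        into the weights 1 and -1.\<close>
      also have "\<dots> = (\<Sum>m<N. - (partial (0, m) \<eta> z * partial (1, m) (s j) z
          - partial (1, m) \<eta> z * partial (0, m) (s j) z) / 2)"
        by (intro sum.cong refl) (simp add: H_def p\<beta> p\<theta> I_def coords_def algebra_simps)
      also have "\<dots> = - poisson 1 N \<eta> (s j) z / 2"
        by (simp add: poisson_def sum_negf sum_divide_distrib[symmetric] del: minus_diff_eq)
      finally show ?thesis unfolding bracket[OF j z] using \<beta>_val[OF j z] by simp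
    qed
    have "H x = H (cut x)" unfolding H_def by (intro ext) (auto simp: cut_bform'[of _ x])
    moreover have "bform I (\<beta> j) x y = bform I (\<beta> j) (cut x) y" for y by (rule cut_bform')
    ultimately show ?thesis using *[OF cutV, of x] cut_bform[of "\<beta> j" x x] by simp
  qed
  have k01: "0 < 2 * k" "1 < 2 * k" "2 < 2 * k" using k by auto
  have projection: "\<exists>x'. (\<forall>c. c \<notin> I \<longrightarrow> x' c = 0) \<and> bform I (\<beta> 0) x' x' = bform I (\<beta> 0) x x \<and>
      bform I \<gamma> x' x' = bform I (\<beta> 0) x x \<and>
      bform I (\<beta> 0) (\<lambda>c. 1 * x c + (-1) * x' c) (\<lambda>c. 1 * x c + (-1) * x' c) = 0" for x
  proof (rule psd_form_is_projection[OF _ \<beta>_sym[OF k01(1)] \<gamma>_sym \<beta>_sym[OF k01(2)]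
        psd[OF k01(1)] psd[OF k01(2)] pos, where H = H])
    show "finite I" by (simp add: I_def)
    show "bform I (\<beta> 0) x x \<le> bform I \<gamma> x x" for x
      unfolding \<gamma> using psd k01(1) by (intro member_le_sum) auto
    show "H (\<lambda>c. 1 * x c + 1 * y c) = (\<lambda>c. 1 * H x c + 1 * H y c)" for x y
      unfolding H_def bform_lincomb_left by (auto simp: fun_eq_iff algebra_simps)
    show "bform I (\<beta> 0) (H x) x = bform I (\<beta> 0) x x" for x
      using Hweight[OF k01(1), of x] bform_commute[OF \<beta>_sym[OF k01(1)], of I x "H x"] by simp
    show "bform I \<gamma> (H x) x = bform I (\<beta> 0) x x - bform I (\<beta> 1) x x" for x
    proof -
      have "bform I \<gamma> (H x) x = (\<Sum>j<2*k. bform I (\<beta> j) x (H x))"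
        unfolding bform_commute[OF \<gamma>_sym, of I "H x"] by (rule \<gamma>)
      also have "\<dots> = (\<Sum>j<2*k. (if j = 0 then bform I (\<beta> 0) x x else 0) - (if j = 1 then bform I (\<beta> 1) x x else 0))"
        by (intro sum.cong refl) (auto simp: Hweight)
      also have "\<dots> = bform I (\<beta> 0) x x - bform I (\<beta> 1) x x"
        using k01 by (simp add: sum_subtractf)
      finally show ?thesis .
    qed
  qed

  have s0: "s j z = (\<Sum>\<alpha><n. (y (j, \<alpha>))^2)" if "j < 2 * k" "y \<in> Z" "z \<in> V'" "h (?O y) = ?O' z" for j y z
    using s_val[OF that(1-4)] by (simp add: bp_sq)
  \<comment> \<open>One block is the first unit vector and all others are zero. A point of the zero
    set whose block \<open>i\<close> has length 1 while the others vanish is a rotation of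
    it.\<close>
  define axis where "axis = (\<lambda>i (c :: nat \<times> nat). if c = (i, 0) then 1 else (0::real))"
  have axisZ: "axis i \<in> Z" if "i < 2 * k" for i
    using that n by (auto simp: axis_def Z_def moment_zero_set_def phase_space_def coords_def)
  have fibre: "finite {z \<in> V'. s i z = 1 \<and> (\<forall>j<2*k. j \<noteq> i \<longrightarrow> s j z = 0)}" (is "finite ?F")
    if i: "i < 2 * k" for i
  proof (rule finite_subset[OF _ finh[OF axisZ[OF i]]])
    show "?F \<subseteq> h (?O (axis i))"
    proof
      fix z assume z: "z \<in> ?F"
      have zV: "z \<in> V'" and z1: "s i z = 1" and z0: "\<And>j. j < 2 * k \<Longrightarrow> j \<noteq> i \<Longrightarrow> s j z = 0"
        using z by auto
      obtain y where y: "y \<in> Z" "h (?O y) = ?O' z" using hsurj[OF zV] by blast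
      have y1: "(\<Sum>\<alpha><n. (y (i, \<alpha>))^2) = 1" using s0[OF i y(1) zV y(2)] z1 by simp
      have y0: "y (j, \<alpha>) = 0" if "j < 2 * k" "j \<noteq> i" "\<alpha> < n" for j \<alpha>
      proof -
        have "(\<Sum>\<alpha><n. (y (j, \<alpha>))^2) = 0" using s0[OF that(1) y(1) zV y(2)] z0[OF that(1,2)] by simp
        then show ?thesis using that(3) by (simp add: sum_nonneg_eq_0_iff)
      qed
      have "y \<in> ?O (axis i)"
        unfolding \<phi>_def
      proof (rule mem_orbit_axis[OF n Gsub(1) y1])
        show "axis i \<in> phase_space k n" "y \<in> phase_space k n"
          using axisZ[OF i] y(1) ZV by (auto simp: V_def)
        show "axis i (j, \<alpha>) = 0" if "\<alpha> \<noteq> 0" for j \<alpha> using that by (simp add: axis_def)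
        show "y (j, \<alpha>) = axis i (j, 0) * y (i, \<alpha>)" if "j < 2 * k" "\<alpha> < n" for j \<alpha>
          using that y0 by (auto simp: axis_def)
      qed
      then have "?O y = ?O (axis i)" using axisZ[OF i] ZV by (intro A.orbit_eqI) auto
      then show "z \<in> h (?O (axis i))" using y(2) zO'[OF zV] by simp
    qed
  qed
  let ?X = "{z \<in> V'. s 0 z = 1 \<and> s 2 z = 1 \<and> (\<forall>j<2*k. j \<noteq> 0 \<and> j \<noteq> 2 \<longrightarrow> s j z = 0)}"
  let ?F = "\<lambda>i. {z \<in> V'. s i z = 1 \<and> (\<forall>j<2*k. j \<noteq> i \<longrightarrow> s j z = 0)}"
  have "?X \<subseteq> (\<lambda>(x, y) c. x c + y c) ` (?F 0 \<times> ?F 2)"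
  proof
    fix z assume z: "z \<in> ?X"
    then have zV: "z \<in> V'" and z1: "s 0 z = 1" "s 2 z = 1"
      and z0: "\<And>j. j < 2 * k \<Longrightarrow> j \<noteq> 0 \<Longrightarrow> j \<noteq> 2 \<Longrightarrow> s j z = 0" by auto
    obtain x where x: "\<And>c. c \<notin> I \<Longrightarrow> x c = 0" "bform I (\<beta> 0) x x = bform I (\<beta> 0) z z"
      "bform I \<gamma> x x = bform I (\<beta> 0) z z"
      "bform I (\<beta> 0) (\<lambda>c. 1 * z c + (-1) * x c) (\<lambda>c. 1 * z c + (-1) * x c) = 0"
      using projection[of z] by blast
    define y where "y = (\<lambda>c. 1 * z c + (-1) * x c)"
    have xV: "x \<in> V'" using x(1) by (simp add: V'_def phase_space_def I_def)
    have yV: "y \<in> V'" using zV xV by (simp add: y_def V'_def phase_space_def)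
    have z00: "bform I (\<beta> 0) z z = 1" using z1(1) \<beta>_val[OF k01(1) zV] by simp
    \<comment> \<open>\<open>\<gamma>\<close> and \<open>\<beta> 0\<close> take the same value at
      \<open>x\<close>, which leaves 0 for the other semidefinite summands of
      \<open>\<gamma>\<close>.\<close>
    have x0: "bform I (\<beta> j) x x = 0" if j: "j < 2 * k" "j \<noteq> 0" for j
    proof -
      have "(\<Sum>j\<in>{..<2*k} - {0}. bform I (\<beta> j) x x) = 0"
        using x(2,3) k01(1) unfolding \<gamma> by (subst (asm) sum.remove[of _ 0]) auto
      then show ?thesis using j psd by (subst (asm) sum_nonneg_eq_0_iff) auto
    qed
    \<comment> \<open>A null vector of a semidefinite form lies in its radical, so subtracting
      \<open>x\<close> does not change the value of \<open>\<beta> j\<close>.\<close>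
    have y0: "bform I (\<beta> j) y y = bform I (\<beta> j) z z" if j: "j < 2 * k" "j \<noteq> 0" for j
    proof -
      have "bform I (\<beta> j) z x = 0"
        using psd_zero[OF \<beta>_sym[OF j(1)] psd[OF j(1)] x0[OF j], of z]
          bform_commute[OF \<beta>_sym[OF j(1)]] by metis
      then show ?thesis unfolding y_def bform_lincomb_diag[OF \<beta>_sym[OF j(1)]] using x0[OF j] by simp
    qed
    have "x \<in> ?F 0" using xV x(2) x0 z00 k01 by (auto simp: \<beta>_val)
    moreover have "y \<in> ?F 2"
    proof -
      have "s 2 y = 1" using y0[OF k01(3)] z1(2) \<beta>_val[OF k01(3)] yV zV by simp
      moreover have "s j y = 0" if "j < 2 * k" "j \<noteq> 2" for j
      proof (cases "j = 0")
        case True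
        then show ?thesis using x(4) \<beta>_val[OF k01(1) yV] by (simp add: y_def)
      next
        case False
        then show ?thesis using y0[OF that(1) False] z0[OF that(1) False that(2)] \<beta>_val[OF that(1)] yV zV
          by simp
      qed
      ultimately show ?thesis using yV by blast
    qed
    moreover have "z = (\<lambda>c. x c + y c)" by (simp add: y_def)
    ultimately show "z \<in> (\<lambda>(x, y) c. x c + y c) ` (?F 0 \<times> ?F 2)" by auto
  qed
  then have finX: "finite ?X"
    using fibre[OF k01(1)] fibre[OF k01(3)] by (meson finite_SigmaI finite_imageI finite_subset)

  \<comment> \<open>All momenta vanish, \<open>q_1\<close> is the first unit vector, and
    \<open>q_2\<close> lies in the plane of the first two axes with scalar product \<open>r\<close>
    with \<open>q_1\<close>. It has length 1 when \<open>r^2 \<le> 1\<close>; the interval from 0 to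
    1 already supplies infinitely many values.\<close>
  define pair where "pair = (\<lambda>r (c :: nat \<times> nat). if c = (0, 0) then 1 else if c = (2, 0) then r
     else if c = (2, 1) then sqrt (1 - r^2) else (0::real))"
  have pairZ: "pair r \<in> Z" for r
  proof -
    have odd0: "pair r (Suc (2 * l), \<alpha>) = 0" for l \<alpha>
    proof -
      have "Suc (2 * l) \<noteq> 2" by presburger
      then show ?thesis by (simp add: pair_def)
    qed
    show ?thesis
      using k n by (auto simp: Z_def moment_zero_set_def odd0) (auto simp: pair_def phase_space_def coords_def)
  qed
  have sum2: "(\<Sum>\<alpha><n. w \<alpha>) = w 0 + w 1" if "\<And>\<alpha>. 2 \<le> \<alpha> \<Longrightarrow> w \<alpha> = 0" for w :: "nat \<Rightarrow> real"
  proof -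
    have "(\<Sum>\<alpha><n. w \<alpha>) = (\<Sum>\<alpha>\<in>{0, 1}. w \<alpha>)"
      using n that by (intro sum.mono_neutral_right) (auto simp: not_less_eq_eq[symmetric])
    then show ?thesis by simp
  qed
  have "\<exists>z\<in>V'. h (?O (pair r)) = ?O' z" for r using hval[OF pairZ] .
  then obtain \<zeta> where \<zeta>: "\<And>r. \<zeta> r \<in> V'" "\<And>r. h (?O (pair r)) = ?O' (\<zeta> r)" by metis
  have "\<zeta> r \<in> ?X" if r: "r \<in> {0..1}" for r
  proof -
    have sv: "s j (\<zeta> r) = (\<Sum>\<alpha><n. (pair r (j, \<alpha>))^2)" if "j < 2 * k" for j
      by (rule s0[OF that pairZ \<zeta>])
    have "r^2 \<le> 1" using r by (simp add: power_le_one)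
    then have "s 0 (\<zeta> r) = 1" "s 2 (\<zeta> r) = 1"
      unfolding sv[OF k01(1)] sv[OF k01(3)] by (subst sum2; simp add: pair_def)+
    moreover have "s j (\<zeta> r) = 0" if "j < 2 * k" "j \<noteq> 0" "j \<noteq> 2" for j
      unfolding sv[OF that(1)] using that by (simp add: pair_def)
    ultimately show ?thesis using \<zeta>(1) by auto
  qed
  then have "finite (\<zeta> ` {0..1})" using finX by (meson finite_subset image_subsetI)
  moreover have "inj_on \<zeta> {0..1}"
  proof (rule inj_onI)
    fix r r' assume "\<zeta> r = \<zeta> r'"
    then have "?O (pair r) = ?O (pair r')" using hinj[OF pairZ pairZ] \<zeta>(2) by metis
    then have "pair r \<in> ?O (pair r')" using A.orbit_refl[of "pair r"] pairZ ZV by auto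
    then have "bp 0 2 (pair r) = bp 0 2 (pair r')"
      using pairZ ZV by (intro invariant_on_orbit[OF bp_inv[OF k01(1,3)]]) auto
    moreover have "bp 0 2 (pair r) = r" for r
      unfolding bp_def block_product_def by (subst sum2) (auto simp: pair_def)
    ultimately show "r = r'" by simp
  qed
  ultimately have "finite {0..1::real}" by (rule finite_imageD)
  then show False by (simp add: infinite_Icc)
qed

section \<open>Symplectomorphisms from linear sections\<close>

lemma openin_orbit_topology:
  "openin (orbit_topology G \<phi> Z) U \<longleftrightarrow>
     U \<subseteq> orbits G Z \<phi> \<and> openin (top_of_set Z) {y \<in> Z. orbit G \<phi> y \<in> U}"
proof -
  have q: "quotient_map (top_of_set Z) (orbit_topology G \<phi> Z) (orbit G \<phi>)"
    by (rule quotient_map_orbit_topology)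
  have "topspace (orbit_topology G \<phi> Z) = orbits G Z \<phi>"
    using quotient_imp_surjective_map[OF q] by (auto simp: orbits_def)
  then show ?thesis
    using q openin_subset[of "orbit_topology G \<phi> Z" U] unfolding quotient_map_def by auto
qed

text \<open>The image of \<open>\<iota>\<close> meets every \<open>G\<close>-orbit of
  \<open>Z\<close>, and in exactly one \<open>G'\<close>-orbit. Condition \<open>opn\<close> is what
  makes the comparison map continuous, and continuity of \<open>\<iota>\<close> makes it open;
  \<open>lift\<close> says that restriction to the section is onto the invariants. Letting
  \<open>D\<close> vary handles the algebra and its grading together. Both affirmative cases are
  instances.\<close>

lemma symplectomorphic_by_section:
  fixes \<iota> :: "point \<Rightarrow> point"
  assumes ga: "group_action G (phase_space k n) \<phi>" and ZV: "Z \<subseteq> phase_space k n"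
    and ga': "group_action G' (phase_space 1 N) \<phi>'"
    and \<iota>Z: "\<And>z. z \<in> phase_space 1 N \<Longrightarrow> \<iota> z \<in> Z"
    and surj: "\<And>y. y \<in> Z \<Longrightarrow> \<exists>z\<in>phase_space 1 N. y \<in> orbit G \<phi> (\<iota> z)"
    and inj: "\<And>z z'. z \<in> phase_space 1 N \<Longrightarrow> z' \<in> phase_space 1 N \<Longrightarrow>
        \<iota> z' \<in> orbit G \<phi> (\<iota> z) \<longleftrightarrow> z' \<in> orbit G' \<phi>' z"
    and cont: "continuous_on (phase_space 1 N) \<iota>"
    and opn: "\<And>U. openin (top_of_set (phase_space 1 N)) U \<Longrightarrow>
        openin (top_of_set Z) {y \<in> Z. \<exists>z\<in>U. y \<in> orbit G \<phi> (\<iota> z)}"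
    and pull: "\<And>D f. wpoly D k n f \<Longrightarrow> wpoly D 1 N (\<lambda>z. f (\<iota> z))"
    and lift: "\<And>D f'. wpoly D 1 N f' \<Longrightarrow> invariant_on G' \<phi>' (phase_space 1 N) f' \<Longrightarrow>
        \<exists>f. wpoly D k n f \<and> invariant_on G \<phi> (phase_space k n) f \<and>
          (\<forall>z\<in>phase_space 1 N. f (\<iota> z) = f' z)"
    and poiss: "\<And>f g z. polynomial_on k n f \<Longrightarrow> invariant_on G \<phi> (phase_space k n) f \<Longrightarrow>
        polynomial_on k n g \<Longrightarrow> invariant_on G \<phi> (phase_space k n) g \<Longrightarrow> z \<in> phase_space 1 N \<Longrightarrow>
        poisson k n f g (\<iota> z) = poisson 1 N (\<lambda>z. f (\<iota> z)) (\<lambda>z. g (\<iota> z)) z"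
    and pinv: "\<And>f g. polynomial_on k n f \<Longrightarrow> invariant_on G \<phi> (phase_space k n) f \<Longrightarrow>
        polynomial_on k n g \<Longrightarrow> invariant_on G \<phi> (phase_space k n) g \<Longrightarrow>
        invariant_on G \<phi> (phase_space k n) (poisson k n f g)"
    and pinv': "\<And>f g. polynomial_on 1 N f \<Longrightarrow> invariant_on G' \<phi>' (phase_space 1 N) f \<Longrightarrow>
        polynomial_on 1 N g \<Longrightarrow> invariant_on G' \<phi>' (phase_space 1 N) g \<Longrightarrow>
        invariant_on G' \<phi>' (phase_space 1 N) (poisson 1 N f g)"
  shows "graded_regularly_symplectomorphic
    (quotient_space k n Z G \<phi>) (quotient_space 1 N (phase_space 1 N) G' \<phi>')"
proof -
  define V where "V = phase_space k n"
  define V' where "V' = phase_space 1 N"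
  define M where "M = quotient_space k n Z G \<phi>"
  define M' where "M' = quotient_space 1 N V' G' \<phi>'"
  let ?O = "orbit G \<phi>" and ?O' = "orbit G' \<phi>'"
  let ?d = "descend G \<phi> Z" and ?d' = "descend G' \<phi>' V'"
  interpret A: group_action G V \<phi> using ga by (simp add: V_def)
  interpret B: group_action G' V' \<phi>' using ga' by (simp add: V'_def)
  note \<iota>Z = \<iota>Z[folded V'_def] and surj = surj[folded V'_def] and inj = inj[folded V'_def]
    and ZV = ZV[folded V_def]
  have \<iota>V: "\<iota> z \<in> V" if "z \<in> V'" for z using \<iota>Z[OF that] ZV by auto
  have pM: "points M = orbits G Z \<phi>" and pM': "points M' = orbits G' V' \<phi>'"
    by (simp_all add: M_def M'_def points_quotient_space)
  have top: "space_topology M = orbit_topology G \<phi> Z" "space_topology M' = orbit_topology G' \<phi>' V'"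
    by (simp_all add: M_def M'_def quotient_space_def)
  \<comment> \<open>An orbit is sent to its trace on the section, which by \<open>inj\<close> is a
    single \<open>G'\<close>-orbit.\<close>
  define h where "h = (\<lambda>x. {z \<in> V'. \<iota> z \<in> x})"
  have h\<iota>: "h (?O (\<iota> z)) = ?O' z" if "z \<in> V'" for z
    using inj[OF that] B.orbit_closed[OF that] by (auto simp: h_def)
  have Ocases: "\<exists>z\<in>V'. x = ?O (\<iota> z)" if x: "x \<in> orbits G Z \<phi>" for x
  proof -
    obtain y where y: "y \<in> Z" "x = ?O y" using x by (auto simp: orbits_def)
    obtain z where z: "z \<in> V'" "y \<in> ?O (\<iota> z)" using surj[OF y(1)] by blast
    have "?O y = ?O (\<iota> z)" using A.orbit_eqI[OF \<iota>V[OF z(1)] z(2)] .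
    then show ?thesis using y z by blast
  qed
  have O\<iota>: "?O (\<iota> z) \<in> orbits G Z \<phi>" if "z \<in> V'" for z using \<iota>Z[OF that] by (auto simp: orbits_def)
  have O': "?O' z \<in> orbits G' V' \<phi>'" if "z \<in> V'" for z using that by (auto simp: orbits_def)
  have hO: "h (?O y) = ?O' z \<longleftrightarrow> y \<in> ?O (\<iota> z)" if y: "y \<in> Z" and z: "z \<in> V'" for y z
  proof
    assume "y \<in> ?O (\<iota> z)"
    then show "h (?O y) = ?O' z" using A.orbit_eqI[OF \<iota>V[OF z]] h\<iota>[OF z] by simp
  next
    assume *: "h (?O y) = ?O' z"
    have "z \<in> h (?O y)" unfolding * using z by (rule B.orbit_refl)
    then have "\<iota> z \<in> ?O y" by (simp add: h_def)
    then show "y \<in> ?O (\<iota> z)" by (rule A.orbit_sym[OF subsetD[OF ZV y] \<iota>V[OF z]])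
  qed
  have img: "h ` orbits G Z \<phi> = orbits G' V' \<phi>'"
  proof (intro equalityI subsetI)
    fix x assume "x \<in> h ` orbits G Z \<phi>"
    then obtain w where w: "w \<in> orbits G Z \<phi>" "x = h w" by blast
    obtain z where "z \<in> V'" "w = ?O (\<iota> z)" using Ocases[OF w(1)] by blast
    then show "x \<in> orbits G' V' \<phi>'" using w(2) h\<iota> O' by simp
  next
    fix x assume "x \<in> orbits G' V' \<phi>'"
    then obtain z where z: "z \<in> V'" "x = ?O' z" by (auto simp: orbits_def)
    then have "x = h (?O (\<iota> z))" by (simp add: h\<iota>)
    then show "x \<in> h ` orbits G Z \<phi>" using O\<iota>[OF z(1)] by blast
  qed
  have hom: "homeomorphic_map (space_topology M) (space_topology M') h"
  proof (rule bijective_open_imp_homeomorphic_map)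
    show "h ` points M = points M'" unfolding pM pM' by (rule img)
    show "inj_on h (points M)"
    proof (rule inj_onI)
      fix x x' assume x: "x \<in> points M" "x' \<in> points M" "h x = h x'"
      obtain z where z: "z \<in> V'" "x = ?O (\<iota> z)" using Ocases x(1) pM by auto
      obtain z' where z': "z' \<in> V'" "x' = ?O (\<iota> z')" using Ocases x(2) pM by auto
      have "h (?O (\<iota> z)) = ?O' z'" using x(3) z z' by (simp add: h\<iota>)
      then have "\<iota> z \<in> ?O (\<iota> z')" using hO[OF \<iota>Z[OF z(1)] z'(1)] by simp
      then show "x = x'" using A.orbit_eqI[OF \<iota>V[OF z'(1)]] z z' by simp
    qed
    show "continuous_map (space_topology M) (space_topology M') h"
      unfolding continuous_map_def
    proof (intro conjI allI impI)
      show "h \<in> points M \<rightarrow> points M'" using img unfolding pM pM' by auto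
      fix U assume U: "openin (space_topology M') U"
      define W where "W = {z \<in> V'. ?O' z \<in> U}"
      have Uo: "U \<subseteq> orbits G' V' \<phi>'" "openin (top_of_set V') W"
        using U unfolding top openin_orbit_topology W_def by auto
      \<comment> \<open>Lifted to \<open>Z\<close>, the preimage of an open set is the saturation of
        an open subset of the section, to which \<open>opn\<close> applies.\<close>
      have "{y \<in> Z. ?O y \<in> {x \<in> points M. h x \<in> U}} = {y \<in> Z. \<exists>z\<in>W. y \<in> ?O (\<iota> z)}"
      proof (intro Collect_cong conj_cong refl)
        fix y assume y: "y \<in> Z"
        have "?O y \<in> points M" using y by (auto simp: pM orbits_def)
        moreover have "h (?O y) \<in> U \<longleftrightarrow> (\<exists>z\<in>W. y \<in> ?O (\<iota> z))"
        proof
          assume *: "h (?O y) \<in> U"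
          then obtain z where z: "z \<in> V'" "h (?O y) = ?O' z" using Uo(1) by (auto simp: orbits_def)
          then have "z \<in> W" "y \<in> ?O (\<iota> z)" using * hO[OF y z(1)] by (auto simp: W_def)
          then show "\<exists>z\<in>W. y \<in> ?O (\<iota> z)" by blast
        next
          assume "\<exists>z\<in>W. y \<in> ?O (\<iota> z)"
          then obtain z where "z \<in> V'" "?O' z \<in> U" "y \<in> ?O (\<iota> z)" by (auto simp: W_def)
          then show "h (?O y) \<in> U" using hO[OF y] by metis
        qed
        ultimately show "?O y \<in> {x \<in> points M. h x \<in> U} \<longleftrightarrow> (\<exists>z\<in>W. y \<in> ?O (\<iota> z))" by simp
      qed
      then show "openin (space_topology M) {x \<in> points M. h x \<in> U}"
        unfolding top openin_orbit_topology using opn[folded V'_def, OF Uo(2)] pM top by auto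
    qed
    show "open_map (space_topology M) (space_topology M') h"
      unfolding open_map_def
    proof (intro allI impI)
      fix U assume U: "openin (space_topology M) U"
      then have Uo: "U \<subseteq> orbits G Z \<phi>" "openin (top_of_set Z) {y \<in> Z. ?O y \<in> U}"
        unfolding top openin_orbit_topology by auto
      \<comment> \<open>Pulled back to \<open>V'\<close>, the image of \<open>U\<close> is the
        preimage under \<open>\<iota>\<close> of the lift of \<open>U\<close>, so openness follows
        from continuity of \<open>\<iota>\<close>.\<close>
      have "{z \<in> V'. ?O' z \<in> h ` U} = V' \<inter> \<iota> -` {y \<in> Z. ?O y \<in> U}"
      proof (intro equalityI subsetI)
        fix z assume "z \<in> {z \<in> V'. ?O' z \<in> h ` U}"
        then obtain x where z: "z \<in> V'" and x: "x \<in> U" "?O' z = h x" by auto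
        obtain w where w: "w \<in> V'" "x = ?O (\<iota> w)" using Ocases x(1) Uo(1) by blast
        have "\<iota> w \<in> ?O (\<iota> z)" using hO[OF \<iota>Z[OF w(1)] z] x(2) w(2) by simp
        then have "?O (\<iota> z) = x" using A.orbit_eqI[OF \<iota>V[OF z]] w(2) by simp
        then show "z \<in> V' \<inter> \<iota> -` {y \<in> Z. ?O y \<in> U}" using z x \<iota>Z by simp
      next
        fix z assume "z \<in> V' \<inter> \<iota> -` {y \<in> Z. ?O y \<in> U}"
        then have z: "z \<in> V'" "?O (\<iota> z) \<in> U" by auto
        then have "?O' z \<in> h ` U" using h\<iota>[OF z(1)] by (metis imageI)
        then show "z \<in> {z \<in> V'. ?O' z \<in> h ` U}" using z(1) by blast
      qed
      moreover have "openin (top_of_set V') (V' \<inter> \<iota> -` {y \<in> Z. ?O y \<in> U})"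
        using cont[folded V'_def] \<iota>Z Uo(2) by (intro continuous_openin_preimage) auto
      moreover have "h ` U \<subseteq> orbits G' V' \<phi>'" using Uo(1) img by blast
      ultimately show "openin (space_topology M') (h ` U)"
        unfolding top openin_orbit_topology by simp
    qed
  qed

  let ?\<Phi> = "\<lambda>F. \<lambda>x\<in>points M. F (h x)"
  have desc: "?d f (?O (\<iota> z)) = f (\<iota> z)" if "invariant_on G \<phi> V f" "z \<in> V'" for f z
    by (rule descend_apply[OF A.group_action_axioms that(1) ZV \<iota>Z[OF that(2)]])
  have desc': "?d' f (?O' z) = f z" if "invariant_on G' \<phi>' V' f" "z \<in> V'" for f z
    by (rule descend_apply[OF B.group_action_axioms that(1) subset_refl that(2)])
  have \<Phi>_ext: "?\<Phi> F = ?d f" if "invariant_on G \<phi> V f" "\<And>z. z \<in> V' \<Longrightarrow> F (?O' z) = f (\<iota> z)" for F f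
  proof
    fix x
    show "?\<Phi> F x = ?d f x"
    proof (cases "x \<in> points M")
      case True
      then obtain z where z: "z \<in> V'" "x = ?O (\<iota> z)" using Ocases pM by auto
      then show ?thesis using True that by (simp add: h\<iota> desc)
    qed (simp add: descend_def pM)
  qed
  have pull_inv: "invariant_on G' \<phi>' V' (\<lambda>z. f (\<iota> z))" if f: "invariant_on G \<phi> V f" for f
    unfolding invariant_on_def
  proof (intro ballI)
    fix g z assume g: "g \<in> carrier G'" and z: "z \<in> V'"
    have gz: "\<phi>' g z \<in> ?O' z" using g by (auto simp: orbit_def)
    then have "\<iota> (\<phi>' g z) \<in> ?O (\<iota> z)" using inj[OF z B.orbit_closed[OF z gz]] by simp
    then show "f (\<iota> (\<phi>' g z)) = f (\<iota> z)" using invariant_on_orbit[OF f \<iota>V[OF z]] by simp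
  qed
  \<comment> \<open>Used with \<open>UNIV\<close> for the regular functions and with singletons for
    the graded parts.\<close>
  have \<Phi>_image: "?\<Phi> ` ?d' ` {f'. wpoly D 1 N f' \<and> invariant_on G' \<phi>' V' f'}
      = ?d ` {f. wpoly D k n f \<and> invariant_on G \<phi> V f}" for D
  proof (intro equalityI subsetI)
    fix F assume "F \<in> ?\<Phi> ` ?d' ` {f'. wpoly D 1 N f' \<and> invariant_on G' \<phi>' V' f'}"
    then obtain f' where f': "wpoly D 1 N f'" "invariant_on G' \<phi>' V' f'" "F = ?\<Phi> (?d' f')" by blast
    obtain f where f: "wpoly D k n f" "invariant_on G \<phi> V f" "\<forall>z\<in>V'. f (\<iota> z) = f' z"
      using lift[OF f'(1) f'(2)[unfolded V'_def]] by (auto simp: V_def V'_def)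
    have "F = ?d f" unfolding f'(3) using f(3) desc'[OF f'(2)] by (intro \<Phi>_ext f(2)) simp
    then show "F \<in> ?d ` {f. wpoly D k n f \<and> invariant_on G \<phi> V f}" using f by blast
  next
    fix F assume "F \<in> ?d ` {f. wpoly D k n f \<and> invariant_on G \<phi> V f}"
    then obtain f where f: "wpoly D k n f" "invariant_on G \<phi> V f" "F = ?d f" by blast
    have "?\<Phi> (?d' (\<lambda>z. f (\<iota> z))) = ?d f"
      using desc'[OF pull_inv[OF f(2)]] by (intro \<Phi>_ext f(2))
    then have eq: "F = ?\<Phi> (?d' (\<lambda>z. f (\<iota> z)))" using f(3) by simp
    have mem: "(\<lambda>z. f (\<iota> z)) \<in> {f'. wpoly D 1 N f' \<and> invariant_on G' \<phi>' V' f'}"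
      using pull[OF f(1)] pull_inv[OF f(2)] by simp
    show "F \<in> ?\<Phi> ` ?d' ` {f'. wpoly D 1 N f' \<and> invariant_on G' \<phi>' V' f'}"
      by (rule image_eqI[where f = ?\<Phi> and x = "?d' (\<lambda>z. f (\<iota> z))"]) (simp add: eq, rule imageI, rule mem)
  qed
  have reg: "regular_functions M = ?d ` {f. wpoly UNIV k n f \<and> invariant_on G \<phi> V f}"
    "regular_functions M' = ?d' ` {f. wpoly UNIV 1 N f \<and> invariant_on G' \<phi>' V' f}"
    by (simp_all add: M_def M'_def quotient_space_def polynomial_on_eq_wpoly V_def V'_def)
  have gra: "graded_part M d = ?d ` {f. wpoly {d} k n f \<and> invariant_on G \<phi> V f}"
    "graded_part M' d = ?d' ` {f. wpoly {d} 1 N f \<and> invariant_on G' \<phi>' V' f}" for d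
    by (simp_all add: M_def M'_def quotient_space_def homogeneous_on_eq_wpoly V_def V'_def)
  have hsurj: "\<exists>y\<in>points M. x = h y" if "x \<in> points M'" for x
  proof -
    have "x \<in> h ` points M" using that unfolding pM pM' img .
    then show ?thesis by blast
  qed
  have ext: "F \<in> extensional (points M')" if "F \<in> regular_functions M'" for F
    using that by (auto simp: reg descend_def pM')
  have \<Phi>_inj: "F = F'" if F: "F \<in> regular_functions M'" "F' \<in> regular_functions M'" and "?\<Phi> F = ?\<Phi> F'" for F F'
  proof (rule extensionalityI[OF ext[OF F(1)] ext[OF F(2)]])
    fix x assume "x \<in> points M'"
    then obtain y where y: "y \<in> points M" "x = h y" using hsurj by blast
    have "?\<Phi> F y = ?\<Phi> F' y" using that(3) by (rule fun_cong)
    then show "F x = F' x" using y by simp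
  qed
  have hp: "h x \<in> points M'" if "x \<in> points M" for x
    using imageI[OF that, of h] unfolding pM pM' img .
  have brM: "bracket_graph M F1 F2 F3 \<longleftrightarrow> (\<exists>f g. polynomial_on k n f \<and> invariant_on G \<phi> V f \<and> ?d f = F1 \<and>
      polynomial_on k n g \<and> invariant_on G \<phi> V g \<and> ?d g = F2 \<and> ?d (poisson k n f g) = F3)" for F1 F2 F3
    by (simp add: M_def quotient_space_def V_def)
  have brM': "bracket_graph M' F1 F2 F3 \<longleftrightarrow> (\<exists>f g. polynomial_on 1 N f \<and> invariant_on G' \<phi>' V' f \<and> ?d' f = F1 \<and>
      polynomial_on 1 N g \<and> invariant_on G' \<phi>' V' g \<and> ?d' g = F2 \<and> ?d' (poisson 1 N f g) = F3)" for F1 F2 F3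
    by (simp add: M'_def quotient_space_def V'_def)
  have \<Phi>_poisson: "?\<Phi> (?d' (poisson 1 N f' g')) = ?d (poisson k n f g)"
    if f: "polynomial_on k n f" "invariant_on G \<phi> V f" and g: "polynomial_on k n g" "invariant_on G \<phi> V g"
      and f': "polynomial_on 1 N f'" "invariant_on G' \<phi>' V' f'"
      and g': "polynomial_on 1 N g'" "invariant_on G' \<phi>' V' g'"
      and eq: "\<And>z. z \<in> V' \<Longrightarrow> f (\<iota> z) = f' z" "\<And>z. z \<in> V' \<Longrightarrow> g (\<iota> z) = g' z" for f g f' g'
  proof (rule \<Phi>_ext)
    show "invariant_on G \<phi> V (poisson k n f g)"
      using pinv[OF f[unfolded V_def] g[unfolded V_def]] by (simp add: V_def)
    fix z assume z: "z \<in> V'"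
    have "invariant_on G' \<phi>' V' (poisson 1 N f' g')"
      using pinv'[OF f'[unfolded V'_def] g'[unfolded V'_def]] by (simp add: V'_def)
    then have "?d' (poisson 1 N f' g') (?O' z) = poisson 1 N f' g' z" using z by (rule desc')
    also have "\<dots> = poisson 1 N (\<lambda>z. f (\<iota> z)) (\<lambda>z. g (\<iota> z)) z"
      using eq z unfolding V'_def by (intro poisson_cong) auto
    also have "\<dots> = poisson k n f g (\<iota> z)"
      using poiss[OF f[unfolded V_def] g[unfolded V_def]] z by (simp add: V'_def)
    finally show "?d' (poisson 1 N f' g') (?O' z) = poisson k n f g (\<iota> z)" .
  qed
  \<comment> \<open>Brackets are given by graphs, so representatives must be produced on the other
    side: by lifting in one direction, by restriction to the section in the other.\<close>
  have br: "bracket_graph M' F1 F2 F3 \<longleftrightarrow> bracket_graph M (?\<Phi> F1) (?\<Phi> F2) (?\<Phi> F3)"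
    if F: "F1 \<in> regular_functions M'" "F2 \<in> regular_functions M'" "F3 \<in> regular_functions M'" for F1 F2 F3
  proof
    assume "bracket_graph M' F1 F2 F3"
    then obtain f' g' where f': "polynomial_on 1 N f'" "invariant_on G' \<phi>' V' f'" "?d' f' = F1"
      and g': "polynomial_on 1 N g'" "invariant_on G' \<phi>' V' g'" "?d' g' = F2"
      and p: "?d' (poisson 1 N f' g') = F3" unfolding brM' by blast
    obtain f where f: "polynomial_on k n f" "invariant_on G \<phi> V f" "\<And>z. z \<in> V' \<Longrightarrow> f (\<iota> z) = f' z"
      using lift[OF f'(1)[unfolded polynomial_on_eq_wpoly] f'(2)[unfolded V'_def]]
      by (auto simp: V_def V'_def polynomial_on_eq_wpoly)
    obtain g where g: "polynomial_on k n g" "invariant_on G \<phi> V g" "\<And>z. z \<in> V' \<Longrightarrow> g (\<iota> z) = g' z"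
      using lift[OF g'(1)[unfolded polynomial_on_eq_wpoly] g'(2)[unfolded V'_def]]
      by (auto simp: V_def V'_def polynomial_on_eq_wpoly)
    have "?d f = ?\<Phi> F1" "?d g = ?\<Phi> F2"
      unfolding f'(3)[symmetric] g'(3)[symmetric]
      using desc'[OF f'(2)] desc'[OF g'(2)] f(3) g(3) by (intro \<Phi>_ext[symmetric] f(2) g(2); simp)+
    moreover have "?d (poisson k n f g) = ?\<Phi> F3"
      unfolding p[symmetric] using f g f' g' by (intro \<Phi>_poisson[symmetric])
    ultimately show "bracket_graph M (?\<Phi> F1) (?\<Phi> F2) (?\<Phi> F3)" unfolding brM
      using f g by (intro exI[of _ f] exI[of _ g] conjI)
  next
    assume "bracket_graph M (?\<Phi> F1) (?\<Phi> F2) (?\<Phi> F3)"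
    then obtain f g where f: "polynomial_on k n f" "invariant_on G \<phi> V f" "?d f = ?\<Phi> F1"
      and g: "polynomial_on k n g" "invariant_on G \<phi> V g" "?d g = ?\<Phi> F2"
      and p: "?d (poisson k n f g) = ?\<Phi> F3" unfolding brM by blast
    define f' where "f' = (\<lambda>z. f (\<iota> z))"
    define g' where "g' = (\<lambda>z. g (\<iota> z))"
    have f': "polynomial_on 1 N f'" "invariant_on G' \<phi>' V' f'"
      using pull f(1) pull_inv[OF f(2)] by (auto simp: f'_def polynomial_on_eq_wpoly)
    have g': "polynomial_on 1 N g'" "invariant_on G' \<phi>' V' g'"
      using pull g(1) pull_inv[OF g(2)] by (auto simp: g'_def polynomial_on_eq_wpoly)
    have rf: "?d' f' \<in> regular_functions M'" "?d' g' \<in> regular_functions M'"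
      using f' g' by (auto simp: reg polynomial_on_eq_wpoly)
    have rp: "?d' (poisson 1 N f' g') = F3"
    proof (rule extensionalityI[OF _ ext[OF F(3)]])
      show "?d' (poisson 1 N f' g') \<in> extensional (points M')" by (simp add: descend_def pM')
      fix x assume "x \<in> points M'"
      then obtain y where y: "y \<in> points M" "x = h y" using hsurj by blast
      have "?\<Phi> (?d' (poisson 1 N f' g')) = ?\<Phi> F3"
        unfolding p[symmetric] using f g f' g' by (intro \<Phi>_poisson) (auto simp: f'_def g'_def)
      then have "?\<Phi> (?d' (poisson 1 N f' g')) y = ?\<Phi> F3 y" by (rule fun_cong)
      then show "?d' (poisson 1 N f' g') x = F3 x" using y by simp
    qed
    have e: "?\<Phi> (?d' f') = ?\<Phi> F1" "?\<Phi> (?d' g') = ?\<Phi> F2"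
      unfolding f(3)[symmetric] g(3)[symmetric]
      using desc'[OF f'(2)] desc'[OF g'(2)] by (intro \<Phi>_ext f(2) g(2); simp add: f'_def g'_def)+
    have "?d' f' = F1" "?d' g' = F2"
      by (rule \<Phi>_inj[OF rf(1) F(1) e(1)], rule \<Phi>_inj[OF rf(2) F(2) e(2)])
    then show "bracket_graph M' F1 F2 F3" unfolding brM'
      using f' g' rp by (intro exI[of _ f'] exI[of _ g'] conjI)
  qed
  have "graded_poisson_iso M' M ?\<Phi>"
    unfolding graded_poisson_iso_def
  proof (intro conjI allI ballI)
    show "bij_betw ?\<Phi> (regular_functions M') (regular_functions M)"
      unfolding bij_betw_def
    proof
      show "inj_on ?\<Phi> (regular_functions M')" by (rule inj_onI) (rule \<Phi>_inj)
      show "?\<Phi> ` regular_functions M' = regular_functions M" unfolding reg by (rule \<Phi>_image)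
    qed
    show "?\<Phi> ` graded_part M' d = graded_part M d" for d unfolding gra by (rule \<Phi>_image)
    show "bracket_graph M' F1 F2 F3 \<longleftrightarrow> bracket_graph M (?\<Phi> F1) (?\<Phi> F2) (?\<Phi> F3)"
      if "F1 \<in> regular_functions M'" "F2 \<in> regular_functions M'" "F3 \<in> regular_functions M'" for F1 F2 F3
      using that by (rule br)
  qed (use hp in \<open>auto simp: fun_eq_iff restrict_def\<close>)
  then show ?thesis
    using hom unfolding graded_regularly_symplectomorphic_def M_def M'_def V'_def by blast
qed

section \<open>One-dimensional and one-particle quotients\<close>

text \<open>For \<open>n = 1\<close> the flag distinguishes O_1, which contains the sign change,
  from the trivial group SO_1. For \<open>k = 1\<close> and \<open>n\<close> at least 2 both groups
  lead to the value \<open>True\<close>.\<close>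

definition sign_group :: "nat \<Rightarrow> bool \<Rightarrow> complex mat set" where
  "sign_group N b = (if b then {1\<^sub>m N, - 1\<^sub>m N} else {1\<^sub>m N})"

lemma finite_sign_group: "finite (sign_group N b)"
  by (simp add: sign_group_def)

lemma subgroup_sign_group: "subgroup (sign_group N b) (unitary_group N)"
proof -
  interpret group "unitary_group N" by (rule group_unitary_group)
  let ?m = "- 1\<^sub>m N :: complex mat"
  have adj: "mat_adjoint ?m = ?m"
    by (intro eq_matI) (auto simp: mat_adjoint_def mat_of_rows_def)
  have mm: "?m * ?m = 1\<^sub>m N"
    by (intro eq_matI) auto
  have m: "?m \<in> carrier (unitary_group N)"
    using mm by (simp add: unitary_group_def adj)
  have inv_m: "inv\<^bsub>unitary_group N\<^esub> ?m = ?m"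
    by (rule inv_equality[OF _ m m]) (simp add: unitary_group_def mm)
  have one: "\<one>\<^bsub>unitary_group N\<^esub> = 1\<^sub>m N" by (simp add: unitary_group_def)
  have one_c: "1\<^sub>m N \<in> carrier (unitary_group N)" using one_closed by (simp add: one)
  have inv_1: "inv\<^bsub>unitary_group N\<^esub> (1\<^sub>m N) = 1\<^sub>m N"
    using inv_one by (simp add: one)
  have mult: "x \<otimes>\<^bsub>unitary_group N\<^esub> y = x * y" for x y by (simp add: unitary_group_def)
  show ?thesis
  proof (rule subgroupI)
    show "sign_group N b \<subseteq> carrier (unitary_group N)" using m one_c by (auto simp: sign_group_def)
    show "sign_group N b \<noteq> {}" by (simp add: sign_group_def)
    show "inv\<^bsub>unitary_group N\<^esub> a \<in> sign_group N b" if "a \<in> sign_group N b" for a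
      using that inv_m inv_1 by (auto simp: sign_group_def split: if_splits)
    show "x \<otimes>\<^bsub>unitary_group N\<^esub> y \<in> sign_group N b"
      if "x \<in> sign_group N b" "y \<in> sign_group N b" for x y
      using that mm by (auto simp: sign_group_def mult split: if_splits)
  qed
qed

lemma unitary_action_one:
  assumes "z \<in> phase_space 1 N" shows "unitary_action N (1\<^sub>m N) z = z"
  using fun_cong[OF group_action.id_eq_one[OF group_action_unitary[of N]], of z] assms
  by (simp add: unitary_group_def)

lemma unitary_action_uminus_one:
  assumes z: "z \<in> phase_space 1 N" shows "unitary_action N (- 1\<^sub>m N) z = (\<lambda>c. - z c)"
proof
  fix c :: "nat \<times> nat"
  obtain i j where c: "c = (i, j)" by force
  show "unitary_action N (- 1\<^sub>m N) z c = - z c"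
  proof (cases "c \<in> coords 1 N")
    case True
    then have ij: "i = 0 \<or> i = 1" "j < N" by (auto simp: c coords_def)
    have "(\<Sum>m<N. (- 1\<^sub>m N) $$ (j, m) * complex_coord z m) = (\<Sum>m<N. if m = j then - complex_coord z m else 0)"
      using ij by (intro sum.cong refl) auto
    also have "\<dots> = - complex_coord z j" using ij by simp
    finally have "(\<Sum>m<N. (- 1\<^sub>m N) $$ (j, m) * complex_coord z m) = - complex_coord z j" .
    then show ?thesis using True ij z by (auto simp: unitary_action_def c Let_def complex_coord_def)
  next
    case False
    then show ?thesis
      using z unitary_action_closed[OF z, of "- 1\<^sub>m N"] by (simp add: phase_space_def c)
  qed
qed

lemma orbit_sign_group:
  assumes "z \<in> phase_space 1 N"
  shows "orbit (unitary_group N\<lparr>carrier := sign_group N b\<rparr>) (unitary_action N) z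
    = (if b then {z, \<lambda>c. - z c} else {z})"
proof -
  have "orbit (unitary_group N\<lparr>carrier := sign_group N b\<rparr>) (unitary_action N) z
      = (\<lambda>A. unitary_action N A z) ` sign_group N b"
    by (auto simp: orbit_def)
  then show ?thesis
    using unitary_action_one[OF assms] unitary_action_uminus_one[OF assms]
    by (simp add: sign_group_def)
qed

lemma group_action_sign_group:
  "group_action (unitary_group N\<lparr>carrier := sign_group N b\<rparr>) (phase_space 1 N) (unitary_action N)"
  by (rule group_action_subgroup[OF group_action_unitary group_unitary_group subgroup_sign_group])

lemma poisson_invariant_on_orthogonal:
  assumes G: "carrier G \<subseteq> carrier (orthogonal_group n)"
    and f: "polynomial_on k n f" "invariant_on G (diagonal_action k n) (phase_space k n) f"
    and g: "polynomial_on k n g" "invariant_on G (diagonal_action k n) (phase_space k n) g"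
  shows "invariant_on G (diagonal_action k n) (phase_space k n) (poisson k n f g)"
  unfolding invariant_on_def
proof (intro ballI)
  fix A y assume A: "A \<in> carrier G" and y: "y \<in> phase_space k n"
  show "poisson k n f g (diagonal_action k n A y) = poisson k n f g y"
    using f(2) g(2) A G y
    by (intro poisson_invariant_orthogonal[OF _ f(1) _ g(1)]) (auto simp: invariant_on_def)
qed

lemma poisson_invariant_on_sign_group:
  assumes f: "polynomial_on 1 N f" "invariant_on (unitary_group N\<lparr>carrier := sign_group N b\<rparr>)
        (unitary_action N) (phase_space 1 N) f"
    and g: "polynomial_on 1 N g" "invariant_on (unitary_group N\<lparr>carrier := sign_group N b\<rparr>)
        (unitary_action N) (phase_space 1 N) g"
  shows "invariant_on (unitary_group N\<lparr>carrier := sign_group N b\<rparr>) (unitary_action N)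
        (phase_space 1 N) (poisson 1 N f g)"
  unfolding invariant_on_def
proof (intro ballI)
  fix A y assume A: "A \<in> carrier (unitary_group N\<lparr>carrier := sign_group N b\<rparr>)"
    and y: "y \<in> phase_space 1 N"
  have AU: "A \<in> carrier (unitary_group N)"
    using A subgroup.subset[OF subgroup_sign_group] by auto
  show "poisson 1 N f g (unitary_action N A y) = poisson 1 N f g y"
    using f(2) g(2) A y
    by (intro poisson_invariant_unitary[OF AU f(1) _ g(1)]) (auto simp: invariant_on_def)
qed

lemma continuous_on_coord: "continuous_on S (\<lambda>y :: 'a \<Rightarrow> 'b :: topological_space. y c)"
  by (rule continuous_on_subset[OF continuous_on_product_coordinates]) simp

section \<open>Particles on a line, n = 1\<close>

lemma orbit_line:
  assumes y: "y \<in> phase_space k 1"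
    and G: "G = (if b then orthogonal_group 1 else special_orthogonal_group 1)"
  shows "orbit G (diagonal_action k 1) y = (if b then {y, \<lambda>c. - y c} else {y})"
proof -
  have act: "diagonal_action k 1 A y = (\<lambda>c. A $$ (0, 0) * y c)" for A
    using y by (auto simp: diagonal_action_def coords_def fun_eq_iff phase_space_def)
  have A1: "A $$ (0, 0) = 1 \<or> A $$ (0, 0) = -1" if "A \<in> carrier (orthogonal_group 1)" for A
    using orthogonal_column_products[OF that, of 0 0] by (simp add: square_eq_1_iff)
  have mem: "mat 1 1 (\<lambda>_. r) \<in> carrier (orthogonal_group 1)" if "r = 1 \<or> r = -1" for r :: real
    using that by (intro orthogonal_groupI) auto
  have det: "det A = A $$ (0, 0)" if "A \<in> carrier (orthogonal_group 1)" for A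
    using that by (intro det_single) (simp add: orthogonal_group_def)
  have "(\<lambda>A. A $$ (0, 0)) ` carrier G = (if b then {1, -1} else {1})"
  proof (cases b)
    case True
    then have cG: "carrier G = carrier (orthogonal_group 1)" by (simp add: G)
    have "r \<in> (\<lambda>A. A $$ (0, 0)) ` carrier (orthogonal_group 1)" if "r = 1 \<or> r = -1" for r :: real
      using mem[OF that] by (intro image_eqI[of _ _ "mat 1 1 (\<lambda>_. r)"]) simp_all
    then show ?thesis unfolding cG using True A1 by auto
  next
    case False
    then have cG: "carrier G = {A \<in> carrier (orthogonal_group 1). det A = 1}"
      by (simp add: G special_orthogonal_group_def)
    have "mat 1 1 (\<lambda>_. 1) \<in> carrier G"
      using mem[of 1] det[OF mem[of 1]] unfolding cG by simp
    then have "1 \<in> (\<lambda>A. A $$ (0, 0)) ` carrier G"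
      by (intro image_eqI[of _ _ "mat 1 1 (\<lambda>_. 1)"]) simp_all
    moreover have "(\<lambda>A. A $$ (0, 0)) ` carrier G \<subseteq> {1}" unfolding cG using det by auto
    ultimately show ?thesis using False by auto
  qed
  moreover have "orbit G (diagonal_action k 1) y
      = (\<lambda>r c. r * y c) ` (\<lambda>A. A $$ (0, 0)) ` carrier G"
    unfolding orbit_def act image_image by blast
  ultimately show ?thesis by simp
qed

declare One_nat_def [simp del]

text \<open>For \<open>n = 1\<close> the moment map has no components and the zero set is
  everything, so only a relabelling of coordinates is left.\<close>

lemma quotient_line_orbifold:
  fixes k :: nat
  assumes G: "G = (if b then orthogonal_group 1 else special_orthogonal_group 1)"
  shows "graded_regularly_symplectomorphic
    (quotient_space k 1 (moment_zero_set k 1) G (diagonal_action k 1))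
    (linear_symplectic_orbifold k (sign_group k b))"
proof -
  \<comment> \<open>Block \<open>2 * j + i\<close> with \<open>i < 2\<close> corresponds to entry
    \<open>(i, j)\<close>, where \<open>i = 0\<close> marks positions and \<open>i = 1\<close>
    momenta; \<open>\<kappa>\<close> is the inverse.\<close>
  define \<iota> :: "point \<Rightarrow> point" where "\<iota> = (\<lambda>z (i, \<alpha>). if i < 2 * k \<and> \<alpha> = 0 then z (i mod 2, i div 2) else (0::real))"
  define \<kappa> :: "point \<Rightarrow> point" where "\<kappa> = (\<lambda>y (i, j). if i < 2 \<and> j < k then y (2 * j + i, 0) else (0::real))"
  let ?V = "phase_space k 1" and ?V' = "phase_space 1 k"
  let ?G' = "unitary_group k\<lparr>carrier := sign_group k b\<rparr>"
  have Z: "moment_zero_set k 1 = ?V" by (auto simp: moment_zero_set_def)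
  have Gsub: "carrier G \<subseteq> carrier (orthogonal_group 1)"
    by (auto simp: G special_orthogonal_group_def)
  have ga: "group_action G ?V (diagonal_action k 1)"
    using group_action_orthogonal group_action_special_orthogonal by (auto simp: G)
  have \<iota>V: "\<iota> z \<in> ?V" for z by (auto simp: \<iota>_def phase_space_def coords_def)
  have \<kappa>V: "\<kappa> y \<in> ?V'" for y by (auto simp: \<kappa>_def phase_space_def coords_def)
  have \<iota>\<kappa>: "\<iota> (\<kappa> y) = y" if "y \<in> ?V" for y
  proof
    fix c :: "nat \<times> nat"
    obtain i \<alpha> where c: "c = (i, \<alpha>)" by force
    have "i mod 2 < 2" "i < 2 * k \<Longrightarrow> i div 2 < k" "2 * (i div 2) + i mod 2 = i" by auto
    then show "\<iota> (\<kappa> y) c = y c" using that by (auto simp: c \<iota>_def \<kappa>_def phase_space_def coords_def)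
  qed
  have \<kappa>\<iota>: "\<kappa> (\<iota> z) = z" if "z \<in> ?V'" for z
  proof
    fix c :: "nat \<times> nat"
    obtain i j where c: "c = (i, j)" by force
    have "2 * j + i < 2 * k" "(2 * j + i) mod 2 = i" "(2 * j + i) div 2 = j" if "i < 2" "j < k"
      using that by auto
    then show "\<kappa> (\<iota> z) c = z c" using that by (auto simp: c \<iota>_def \<kappa>_def phase_space_def coords_def)
  qed
  have \<iota>neg: "\<iota> (\<lambda>c. - z c) = (\<lambda>c. - \<iota> z c)" for z by (auto simp: \<iota>_def fun_eq_iff)
  have \<kappa>neg: "\<kappa> (\<lambda>c. - y c) = (\<lambda>c. - \<kappa> y c)" for y by (auto simp: \<kappa>_def fun_eq_iff)
  have neg: "(\<lambda>c. - y c) \<in> phase_space m n" if "y \<in> phase_space m n" for y m n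
    using that by (simp add: phase_space_def)
  have orb: "orbit G (diagonal_action k 1) y = (if b then {y, \<lambda>c. - y c} else {y})" if "y \<in> ?V" for y
    using that G by (rule orbit_line)
  have hom\<iota>: "wpoly {1} 1 k (\<lambda>z. \<iota> z c)" if c: "c \<in> coords k 1" for c
  proof -
    have "(fst c mod 2, fst c div 2) \<in> coords 1 k" using c by (auto simp: coords_def)
    moreover have "(\<lambda>z. \<iota> z c) = (\<lambda>z. z (fst c mod 2, fst c div 2))"
      using c by (auto simp: \<iota>_def coords_def fun_eq_iff)
    ultimately show ?thesis using homogeneous_coord by metis
  qed
  have hom\<kappa>: "wpoly {1} k 1 (\<lambda>y. \<kappa> y c)" if c: "c \<in> coords 1 k" for c
  proof -
    have "(2 * snd c + fst c, 0) \<in> coords k 1" using c by (auto simp: coords_def)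
    moreover have "(\<lambda>y. \<kappa> y c) = (\<lambda>y. y (2 * snd c + fst c, 0))"
      using c by (auto simp: \<kappa>_def coords_def fun_eq_iff)
    ultimately show ?thesis using homogeneous_coord by metis
  qed
  show ?thesis
    unfolding linear_symplectic_orbifold_def Z
  proof (rule symplectomorphic_by_section[where \<iota> = \<iota>])
    show "group_action G ?V (diagonal_action k 1)" by (rule ga)
    show "group_action ?G' ?V' (unitary_action k)" by (rule group_action_sign_group)
    show "\<iota> z \<in> ?V" for z by (rule \<iota>V)
    show "\<exists>z\<in>?V'. y \<in> orbit G (diagonal_action k 1) (\<iota> z)" if "y \<in> ?V" for y
      using that by (intro bexI[OF _ \<kappa>V[of y]]) (simp add: \<iota>\<kappa> orb)
    show "\<iota> z' \<in> orbit G (diagonal_action k 1) (\<iota> z) \<longleftrightarrow> z' \<in> orbit ?G' (unitary_action k) z"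
      if z: "z \<in> ?V'" "z' \<in> ?V'" for z z'
    proof -
      have "\<iota> z' = \<iota> w \<longleftrightarrow> z' = w" if "w \<in> ?V'" for w using \<kappa>\<iota> z(2) that by metis
      from this[OF z(1)] this[OF neg[OF z(1)]]
      show ?thesis unfolding orb[OF \<iota>V] orbit_sign_group[OF z(1)] \<iota>neg[symmetric] by simp
    qed
    show "continuous_on ?V' \<iota>"
    proof (rule continuous_on_coordinatewise_then_product)
      fix c :: "nat \<times> nat"
      show "continuous_on ?V' (\<lambda>z. \<iota> z c)"
        by (cases "fst c < 2 * k \<and> snd c = 0"; cases c) (auto simp: \<iota>_def intro!: continuous_on_coord)
    qed
    have "continuous_on ?V \<kappa>"
    proof (rule continuous_on_coordinatewise_then_product)
      fix c :: "nat \<times> nat"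
      show "continuous_on ?V (\<lambda>y. \<kappa> y c)"
        by (cases "fst c < 2 \<and> snd c < k"; cases c) (auto simp: \<kappa>_def intro!: continuous_on_coord)
    qed
    moreover have "continuous_on ?V (\<lambda>y. \<kappa> (\<lambda>c. - y c))"
    proof (rule continuous_on_coordinatewise_then_product)
      fix c :: "nat \<times> nat"
      show "continuous_on ?V (\<lambda>y. \<kappa> (\<lambda>c. - y c) c)"
        by (cases "fst c < 2 \<and> snd c < k"; cases c)
          (auto simp: \<kappa>_def intro!: continuous_on_minus continuous_on_coord)
    qed
    ultimately show "openin (top_of_set ?V) {y \<in> ?V. \<exists>z\<in>U. y \<in> orbit G (diagonal_action k 1) (\<iota> z)}"
      if U: "openin (top_of_set ?V') U" for U
    proof -
      assume c: "continuous_on ?V \<kappa>" "continuous_on ?V (\<lambda>y. \<kappa> (\<lambda>c. - y c))"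
      have UV: "U \<subseteq> ?V'" using openin_imp_subset[OF U] .
      have o: "openin (top_of_set ?V) (?V \<inter> \<kappa> -` U)"
        "openin (top_of_set ?V) (?V \<inter> (\<lambda>y. \<kappa> (\<lambda>c. - y c)) -` U)"
        using \<kappa>V by (auto intro!: continuous_openin_preimage[OF _ _ U] c)
      \<comment> \<open>Hence the saturation of \<open>U\<close> is its preimage under
        \<open>\<kappa>\<close>, joined, if signs act, with the preimage under
        \<open>\<kappa>\<close> after negation.\<close>
      have "y \<in> orbit G (diagonal_action k 1) (\<iota> z) \<longleftrightarrow> (z = \<kappa> y \<or> b \<and> z = \<kappa> (\<lambda>c. - y c))"
        if y: "y \<in> ?V" and z: "z \<in> ?V'" for y z
      proof -
        have "y = \<iota> z \<longleftrightarrow> z = \<kappa> y" using \<iota>\<kappa>[OF y] \<kappa>\<iota>[OF z] by metis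
        moreover have "y = (\<lambda>c. - \<iota> z c) \<longleftrightarrow> z = \<kappa> (\<lambda>c. - y c)"
        proof
          assume "y = (\<lambda>c. - \<iota> z c)" then show "z = \<kappa> (\<lambda>c. - y c)" using \<kappa>\<iota>[OF z] by simp
        next
          assume "z = \<kappa> (\<lambda>c. - y c)" then show "y = (\<lambda>c. - \<iota> z c)" using \<iota>\<kappa>[OF neg[OF y]] by simp
        qed
        ultimately show ?thesis unfolding orb[OF \<iota>V] by simp
      qed
      then have "{y \<in> ?V. \<exists>z\<in>U. y \<in> orbit G (diagonal_action k 1) (\<iota> z)}
          = (?V \<inter> \<kappa> -` U) \<union> (if b then ?V \<inter> (\<lambda>y. \<kappa> (\<lambda>c. - y c)) -` U else {})"
        using UV by (auto simp: subset_iff)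
      then show ?thesis using o by (cases b) auto
    qed
    show "wpoly D 1 k (\<lambda>z. f (\<iota> z))" if "wpoly D k 1 f" for D f
      using that hom\<iota> \<iota>V by (rule wpoly_compose)
    show "\<exists>f. wpoly D k 1 f \<and> invariant_on G (diagonal_action k 1) ?V f \<and> (\<forall>z\<in>?V'. f (\<iota> z) = f' z)"
      if f': "wpoly D 1 k f'" "invariant_on ?G' (unitary_action k) ?V' f'" for D f'
    proof (intro exI[of _ "\<lambda>y. f' (\<kappa> y)"] conjI ballI)
      show "wpoly D k 1 (\<lambda>y. f' (\<kappa> y))" using f'(1) hom\<kappa> \<kappa>V by (rule wpoly_compose)
      show "f' (\<kappa> (\<iota> z)) = f' z" if "z \<in> ?V'" for z using that by (simp add: \<kappa>\<iota>)
      show "invariant_on G (diagonal_action k 1) ?V (\<lambda>y. f' (\<kappa> y))"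
        unfolding invariant_on_def
      proof (intro ballI)
        fix A y assume A: "A \<in> carrier G" and y: "y \<in> ?V"
        have "diagonal_action k 1 A y \<in> orbit G (diagonal_action k 1) y" using A by (auto simp: orbit_def)
        then have "\<kappa> (diagonal_action k 1 A y) \<in> orbit ?G' (unitary_action k) (\<kappa> y)"
          unfolding orb[OF y] orbit_sign_group[OF \<kappa>V] by (auto simp: \<kappa>neg split: if_splits)
        then show "f' (\<kappa> (diagonal_action k 1 A y)) = f' (\<kappa> y)"
          by (rule invariant_on_orbit[OF f'(2) \<kappa>V])
      qed
    qed
    show "poisson k 1 f g (\<iota> z) = poisson 1 k (\<lambda>z. f (\<iota> z)) (\<lambda>z. g (\<iota> z)) z" for f g z
    proof -
      have p: "partial (i, j) (\<lambda>z. f (\<iota> z)) z = partial (2 * j + i, 0) f (\<iota> z)"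
        if "i < 2" "j < k" for i j f
      proof -
        have e: "(2 * j + i) mod 2 = i" "(2 * j + i) div 2 = j" "2 * j + i < 2 * k" using that by auto
        have inj: "i' = 2 * j + i" if "i' mod 2 = i" "i' div 2 = j" for i' using that by auto
        have "\<iota> (z((i, j) := t)) = (\<iota> z)((2 * j + i, 0) := t)" for t
          using e inj by (auto simp: \<iota>_def fun_eq_iff)
        moreover have "\<iota> z (2 * j + i, 0) = z (i, j)" using e by (simp add: \<iota>_def)
        ultimately show ?thesis by (simp add: partial_def)
      qed
      have "{..<1} = {0::nat}" by auto
      then show ?thesis
        unfolding poisson_def by (simp add: p[of 0, simplified] p[of 1, simplified])
    qed
    show "invariant_on G (diagonal_action k 1) ?V (poisson k 1 f g)"
      if "polynomial_on k 1 f" "invariant_on G (diagonal_action k 1) ?V f"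
        "polynomial_on k 1 g" "invariant_on G (diagonal_action k 1) ?V g" for f g
      using Gsub that by (rule poisson_invariant_on_orthogonal)
    show "invariant_on ?G' (unitary_action k) ?V' (poisson 1 k f g)"
      if "polynomial_on 1 k f" "invariant_on ?G' (unitary_action k) ?V' f"
        "polynomial_on 1 k g" "invariant_on ?G' (unitary_action k) ?V' g" for f g
      using that by (rule poisson_invariant_on_sign_group)
  qed simp
qed

section \<open>One particle, k = 1\<close>

text \<open>For one particle the components of the moment map are the 2 by 2 minors of the pair (q,
  p), so the blocks are parallel; antisymmetry extends the relation beyond increasing
  indices.\<close>

lemma moment_zero_set_parallel:
  assumes y: "y \<in> moment_zero_set 1 n" and \<alpha>: "\<alpha> < n" and \<beta>: "\<beta> < n" and ij: "i < 2" "j < 2"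
  shows "y (i, \<alpha>) * y (j, \<beta>) = y (i, \<beta>) * y (j, \<alpha>)"
proof -
  have J: "y (0, a) * y (1, b) = y (0, b) * y (1, a)" if "a < b" "b < n" for a b
    using y that by (auto simp: moment_zero_set_def One_nat_def)
  have "y (0, \<alpha>) * y (1, \<beta>) = y (0, \<beta>) * y (1, \<alpha>)"
    using J[of \<alpha> \<beta>] J[of \<beta> \<alpha>] \<alpha> \<beta> by (cases \<alpha> \<beta> rule: linorder_cases) simp_all
  moreover have "i = 0 \<or> i = 1" "j = 0 \<or> j = 1" using ij by auto
  ultimately show ?thesis by (auto simp: mult.commute)
qed

lemma phase_space_1_1_iff: "z \<in> phase_space 1 1 \<longleftrightarrow> (\<forall>i \<alpha>. \<not> (i < 2 \<and> \<alpha> = 0) \<longrightarrow> z (i, \<alpha>) = 0)"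
  by (auto simp: phase_space_def coords_def)

lemma phase_space_1_1_ext:
  assumes "x \<in> phase_space 1 1" "x' \<in> phase_space 1 1"
    and "x (0, 0) = x' (0, 0)" "x (1, 0) = x' (1, 0)"
  shows "x = x'"
proof
  fix c :: "nat \<times> nat"
  obtain i \<alpha> where c: "c = (i, \<alpha>)" by force
  show "x c = x' c"
  proof (cases "i < 2 \<and> \<alpha> = 0")
    case True
    then have "i = 0 \<or> i = 1" by auto
    then show ?thesis using True assms c by auto
  next
    case False
    then show ?thesis using assms(1,2) unfolding c phase_space_1_1_iff by metis
  qed
qed

lemma phase_space_1_1_subset: "1 \<le> n \<Longrightarrow> phase_space 1 1 \<subseteq> phase_space 1 n"
  by (auto simp: phase_space_def coords_def)

lemma phase_space_1_1_subset_zero_set: "1 \<le> n \<Longrightarrow> phase_space 1 1 \<subseteq> moment_zero_set 1 n"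
  using phase_space_1_1_subset[of n] by (auto simp: moment_zero_set_def phase_space_1_1_iff)

text \<open>The coordinates of a point of the zero set with respect to the unit vector along
  \<open>w = s q + t p\<close>; unlike the unit vector chosen by transitivity, this depends continuously on the
  point as long as \<open>w \<noteq> 0\<close>.\<close>

definition axis_coords :: "nat \<Rightarrow> real \<Rightarrow> real \<Rightarrow> point \<Rightarrow> point" where
  "axis_coords n s t y = (\<lambda>(i, \<alpha>). if i < 2 \<and> \<alpha> = 0
     then (\<Sum>\<beta><n. y (i, \<beta>) * (s * y (0, \<beta>) + t * y (1, \<beta>))) /
          sqrt (\<Sum>\<beta><n. (s * y (0, \<beta>) + t * y (1, \<beta>))^2) else 0)"

lemma axis_coords_in: "axis_coords n s t y \<in> phase_space 1 1"
  by (auto simp: axis_coords_def phase_space_1_1_iff)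

text \<open>Parallel blocks satisfy y_i(\<alpha>) w(\<beta>) = y_i(\<beta>) w(\<alpha>). Multiplying
  by w(\<beta>) and summing over \<beta> writes each block as a multiple of \<open>w\<close>, and
  \<open>axis_coords\<close> holds the multiples of the unit vector w / |w|.\<close>

lemma mem_orbit_axis_coords:
  assumes n: "2 \<le> n" and G: "carrier (special_orthogonal_group n) \<subseteq> carrier G"
    and y: "y \<in> moment_zero_set 1 n" and nz: "(\<Sum>\<beta><n. (s * y (0, \<beta>) + t * y (1, \<beta>))^2) \<noteq> 0"
  shows "y \<in> orbit G (diagonal_action 1 n) (axis_coords n s t y)"
proof -
  define w where "w = (\<lambda>\<beta>. s * y (0, \<beta>) + t * y (1, \<beta>))"
  define r where "r = (\<Sum>\<beta><n. (w \<beta>)^2)"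
  have "r \<ge> 0" unfolding r_def by (intro sum_nonneg) simp
  then have r: "r > 0" using nz by (simp add: r_def w_def)
  have v: "(\<Sum>\<alpha><n. (w \<alpha> / sqrt r)^2) = 1"
    using r by (simp add: power_divide sum_divide_distrib[symmetric] r_def[symmetric])
  show ?thesis
  proof (rule mem_orbit_axis[OF n G v])
    show "axis_coords n s t y \<in> phase_space 1 n"
      using axis_coords_in phase_space_1_1_subset[of n] n by auto
    show "axis_coords n s t y (i, \<alpha>) = 0" if "\<alpha> \<noteq> 0" for i \<alpha> using that by (simp add: axis_coords_def)
    show "y \<in> phase_space 1 n" using y by (simp add: moment_zero_set_def)
    fix i \<alpha> :: nat assume i: "i < 2 * 1" and \<alpha>: "\<alpha> < n"
    have "y (i, \<alpha>) * r = (\<Sum>\<beta><n. y (i, \<alpha>) * w \<beta> * w \<beta>)"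
      by (simp add: r_def sum_distrib_left power2_eq_square mult.assoc)
    also have "\<dots> = (\<Sum>\<beta><n. y (i, \<beta>) * w \<alpha> * w \<beta>)"
    proof (rule sum.cong[OF refl])
      fix \<beta> assume "\<beta> \<in> {..<n}"
      then have p: "y (i, \<alpha>) * y (j, \<beta>) = y (i, \<beta>) * y (j, \<alpha>)" if "j < 2" for j
        using moment_zero_set_parallel[OF y \<alpha> _ _ that, of \<beta> i] i by simp
      have "y (i, \<alpha>) * w \<beta> = s * (y (i, \<alpha>) * y (0, \<beta>)) + t * (y (i, \<alpha>) * y (1, \<beta>))"
        by (simp add: w_def algebra_simps)
      also have "\<dots> = y (i, \<beta>) * w \<alpha>" using p[of 0] p[of 1] by (simp add: w_def algebra_simps)
      finally show "y (i, \<alpha>) * w \<beta> * w \<beta> = y (i, \<beta>) * w \<alpha> * w \<beta>" by simp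
    qed
    also have "\<dots> = (\<Sum>\<beta><n. y (i, \<beta>) * w \<beta>) * w \<alpha>"
      by (simp add: sum_distrib_left mult_ac)
    finally have "y (i, \<alpha>) * r = (\<Sum>\<beta><n. y (i, \<beta>) * w \<beta>) * w \<alpha>" .
    then have "y (i, \<alpha>) = (\<Sum>\<beta><n. y (i, \<beta>) * w \<beta>) / sqrt r * (w \<alpha> / sqrt r)"
      using r by (simp add: field_simps)
    moreover have "axis_coords n s t y (i, 0) = (\<Sum>\<beta><n. y (i, \<beta>) * w \<beta>) / sqrt r"
      using i by (simp add: axis_coords_def w_def r_def)
    ultimately show "y (i, \<alpha>) = axis_coords n s t y (i, 0) * (w \<alpha> / sqrt r)" by simp
  qed
qed

lemma block_product_axis:
  assumes "1 \<le> n" "z \<in> phase_space 1 1"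
  shows "block_product n i j z = z (i, 0) * z (j, 0)"
proof -
  have "block_product n i j z = (\<Sum>\<alpha><n. if \<alpha> = 0 then z (i, 0) * z (j, 0) else 0)"
    unfolding block_product_def using assms(2)
    by (intro sum.cong refl) (auto simp: phase_space_1_1_iff)
  then show ?thesis using assms(1) by simp
qed

text \<open>The invariants q . q and p . p fix the two coordinates up to sign, and q . p excludes
  independent sign changes. Conversely, the common sign is realised by a matrix whose first column
  is plus or minus the first basis vector.\<close>

lemma orbit_axis_iff:
  fixes G :: "(real mat, 'm) monoid_scheme"
  assumes n: "2 \<le> n" and G: "carrier (special_orthogonal_group n) \<subseteq> carrier G"
      "carrier G \<subseteq> carrier (orthogonal_group n)"
    and z: "z \<in> phase_space 1 1" "z' \<in> phase_space 1 1"
  shows "z' \<in> orbit G (diagonal_action 1 n) z \<longleftrightarrow> z' = z \<or> z' = (\<lambda>c. - z c)"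
proof
  assume o: "z' \<in> orbit G (diagonal_action 1 n) z"
  have zV: "z \<in> phase_space 1 n" using z phase_space_1_1_subset[of n] n by auto
  have e: "z' (i, 0) * z' (j, 0) = z (i, 0) * z (j, 0)" if "i < 2" "j < 2" for i j
  proof -
    have "block_product n i j z' = block_product n i j z"
      using that by (intro invariant_on_orbit[OF block_product_invariant[OF G(2)] zV o]) auto
    then show ?thesis using n z by (simp add: block_product_axis)
  qed
  have neg: "(\<lambda>c. - z c) \<in> phase_space 1 1" using z(1) by (simp add: phase_space_1_1_iff)
  have sq: "(z' (i, 0))^2 = (z (i, 0))^2" if "i < 2" for i using e[OF that that] by (simp add: power2_eq_square)
  have c: "z' (0, 0) * z' (1, 0) = z (0, 0) * z (1, 0)" by (rule e) auto
  have s0: "z' (0, 0) = z (0, 0) \<or> z' (0, 0) = - z (0, 0)" using sq[of 0] by (simp add: power2_eq_iff)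
  have s1: "z' (1, 0) = z (1, 0) \<or> z' (1, 0) = - z (1, 0)" using sq[of 1] by (simp add: power2_eq_iff)
  have "(z' (0, 0) = z (0, 0) \<and> z' (1, 0) = z (1, 0)) \<or> (z' (0, 0) = - z (0, 0) \<and> z' (1, 0) = - z (1, 0))"
    using s0 s1 c by auto
  then show "z' = z \<or> z' = (\<lambda>c. - z c)" using phase_space_1_1_ext[OF z(2,1)] phase_space_1_1_ext[OF z(2) neg] by auto
next
  have m: "z'' \<in> orbit G (diagonal_action 1 n) z" if z'': "z'' = (\<lambda>c. \<epsilon> * z c)" and \<epsilon>: "\<epsilon>^2 = 1" for z'' \<epsilon>
  proof (rule mem_orbit_axis[OF n G(1), where v = "\<lambda>\<alpha>. if \<alpha> = 0 then \<epsilon> else 0"])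
    show "(\<Sum>\<alpha><n. (if \<alpha> = 0 then \<epsilon> else 0)^2) = 1"
      using n \<epsilon> by (simp add: if_distrib[of "\<lambda>u. u^2"] cong: if_cong)
    show "z \<in> phase_space 1 n" using z phase_space_1_1_subset[of n] n by auto
    then show "z'' \<in> phase_space 1 n" by (simp add: z'' phase_space_def)
    show "z (i, \<alpha>) = 0" if "\<alpha> \<noteq> 0" for i \<alpha> using that z(1) by (simp add: phase_space_1_1_iff)
    show "z'' (i, \<alpha>) = z (i, 0) * (if \<alpha> = 0 then \<epsilon> else 0)" for i \<alpha>
      using z(1) by (simp add: z'' phase_space_1_1_iff)
  qed
  assume "z' = z \<or> z' = (\<lambda>c. - z c)"
  then show "z' \<in> orbit G (diagonal_action 1 n) z" using m[of z' 1] m[of z' "-1"] by auto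
qed

text \<open>Rotating in the plane of the first and the \<open>\<alpha>\<close>-th direction, and reversing the \<open>\<alpha>\<close>-th
  direction, shows that the part of the bracket transverse to the axis vanishes.\<close>

lemma transverse_bracket_zero:
  assumes n: "2 \<le> n" and G: "carrier (special_orthogonal_group n) \<subseteq> carrier G"
    and f: "polynomial_on 1 n f" "invariant_on G (diagonal_action 1 n) (phase_space 1 n) f"
    and g: "polynomial_on 1 n g" "invariant_on G (diagonal_action 1 n) (phase_space 1 n) g"
    and z: "z \<in> phase_space 1 1" and \<alpha>: "0 < \<alpha>" "\<alpha> < n"
  shows "partial (0, \<alpha>) f z * partial (1, \<alpha>) g z = partial (1, \<alpha>) f z * partial (0, \<alpha>) g z"
proof -
  let ?V = "phase_space 1 n" and ?\<phi> = "diagonal_action 1 n"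
  have zV: "z \<in> ?V" using z phase_space_1_1_subset[of n] n by auto
  have rot: "z (0, 0) * partial (0, \<alpha>) f z + z (1, 0) * partial (1, \<alpha>) f z = 0"
    if f: "polynomial_on 1 n f" "invariant_on G ?\<phi> ?V f" for f
  proof -
    define \<gamma> where "\<gamma> = (\<lambda>\<theta> (i, a). if i < 2 then (if a = 0 then z (i, 0) * cos \<theta>
       else if a = \<alpha> then z (i, 0) * sin \<theta> else 0) else (0::real))"
    define \<gamma>' where "\<gamma>' = (\<lambda>(i, a). if i < 2 \<and> a = \<alpha> then z (i, 0) else (0::real))"
    have \<gamma>V: "\<gamma> \<theta> \<in> ?V" for \<theta> using \<alpha> by (auto simp: \<gamma>_def phase_space_def coords_def)
    have \<gamma>0: "\<gamma> 0 = z" using z by (auto simp: \<gamma>_def phase_space_1_1_iff fun_eq_iff)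
    have "f (\<gamma> \<theta>) = f z" for \<theta>
    proof (rule invariant_on_orbit[OF f(2) zV])
      show "\<gamma> \<theta> \<in> orbit G ?\<phi> z"
      proof (rule mem_orbit_axis[OF n G _ zV _ \<gamma>V, where v = "\<lambda>a. if a = 0 then cos \<theta> else if a = \<alpha> then sin \<theta> else 0"])
        have "(\<Sum>a<n. (if a = 0 then cos \<theta> else if a = \<alpha> then sin \<theta> else 0)^2)
            = (\<Sum>a<n. (if a = 0 then (cos \<theta>)^2 else 0) + (if a = \<alpha> then (sin \<theta>)^2 else 0))"
          using \<alpha> by (intro sum.cong refl) auto
        then show "(\<Sum>a<n. (if a = 0 then cos \<theta> else if a = \<alpha> then sin \<theta> else 0)^2) = 1"
          using \<alpha> by (simp add: sum.distrib)
        show "z (i, a) = 0" if "a \<noteq> 0" for i a using that z by (simp add: phase_space_1_1_iff)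
        show "\<gamma> \<theta> (i, a) = z (i, 0) * (if a = 0 then cos \<theta> else if a = \<alpha> then sin \<theta> else 0)"
          if "i < 2 * 1" for i a using that by (simp add: \<gamma>_def)
      qed
    qed
    then have "((\<lambda>\<theta>. f (\<gamma> \<theta>)) has_real_derivative 0) (at 0)" by simp
    moreover have "((\<lambda>\<theta>. f (\<gamma> \<theta>)) has_real_derivative
        (\<Sum>b\<in>coords 1 n. \<gamma>' b * partial b f (\<gamma> 0))) (at 0)"
    proof (rule DERIV_polynomial_along_curve[OF f(1) \<gamma>V])
      fix c :: "nat \<times> nat"
      obtain i a where c: "c = (i, a)" by force
      show "((\<lambda>t. \<gamma> t c) has_real_derivative \<gamma>' c) (at 0)"
        using \<alpha> by (cases "i < 2"; cases "a = 0"; cases "a = \<alpha>")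
          (auto simp: c \<gamma>_def \<gamma>'_def intro!: derivative_eq_intros)
    qed
    ultimately have "0 = (\<Sum>b\<in>coords 1 n. \<gamma>' b * partial b f z)"
      unfolding \<gamma>0 by (rule DERIV_unique)
    also have "\<dots> = (\<Sum>i<2. \<Sum>a<n. if a = \<alpha> then z (i, 0) * partial (i, \<alpha>) f z else 0)"
      unfolding sum_coords by (intro sum.cong) (auto simp: \<gamma>'_def)
    also have "\<dots> = z (0, 0) * partial (0, \<alpha>) f z + z (1, 0) * partial (1, \<alpha>) f z"
      using \<alpha> by (simp add: numeral_2_eq_2 One_nat_def)
    finally show ?thesis by simp
  qed
  have refl0: "partial (i, \<alpha>) f z = 0"
    if f: "polynomial_on 1 n f" "invariant_on G ?\<phi> ?V f" and z0: "z (0, 0) = 0" "z (1, 0) = 0"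
      and i: "i < 2" for f i
  proof -
    have "z = (\<lambda>c. 0)"
      by (rule phase_space_1_1_ext[OF z]) (simp_all add: z0 phase_space_def)
    then have zz: "z c = 0" for c by simp
    define \<gamma> where "\<gamma> = (\<lambda>t c. if c = (i, \<alpha>) then t else (0::real))"
    define x where "x = (\<lambda>t (c :: nat \<times> nat). if c = (i, 0) then t else (0::real))"
    have \<gamma>V: "\<gamma> t \<in> ?V" and xV: "x t \<in> ?V" for t
      using \<alpha> i by (auto simp: \<gamma>_def x_def phase_space_def coords_def)
    have \<gamma>0: "\<gamma> 0 = z" using zz by (auto simp: \<gamma>_def fun_eq_iff)
    \<comment> \<open>At the origin rotations give no condition. Instead, the points at
      \<open>t\<close> and \<open>-t\<close> on the transverse axis both lie in the orbit of
      \<open>x t\<close> on the first axis, so \<open>f\<close> is even along the transverse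
      axis.\<close>
    have ax: "f (\<gamma> (\<epsilon> * t)) = f (x t)" if \<epsilon>: "\<epsilon>^2 = 1" for t \<epsilon>
    proof (rule invariant_on_orbit[OF f(2) xV])
      show "\<gamma> (\<epsilon> * t) \<in> orbit G ?\<phi> (x t)"
      proof (rule mem_orbit_axis[OF n G _ xV _ \<gamma>V, where v = "\<lambda>a. if a = \<alpha> then \<epsilon> else 0"])
        show "(\<Sum>a<n. (if a = \<alpha> then \<epsilon> else 0)^2) = 1"
          using \<alpha> \<epsilon> by (simp add: if_distrib[of "\<lambda>u. u^2"] cong: if_cong)
      qed (auto simp: x_def \<gamma>_def)
    qed
    have sym: "f (\<gamma> (- t)) = f (\<gamma> t)" for t using ax[of 1 t] ax[of "-1" t] by simp
    have d: "((\<lambda>t. f (\<gamma> t)) has_real_derivative partial (i, \<alpha>) f z) (at 0)"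
    proof -
      have "((\<lambda>t. f (\<gamma> t)) has_real_derivative
        (\<Sum>b\<in>coords 1 n. (if b = (i, \<alpha>) then 1 else 0) * partial b f (\<gamma> 0))) (at 0)"
        by (rule DERIV_polynomial_along_curve[OF f(1) \<gamma>V]) (auto simp: \<gamma>_def)
      moreover have "(i, \<alpha>) \<in> coords 1 n" using i \<alpha> by (simp add: coords_def)
      ultimately show ?thesis by (simp add: \<gamma>0 if_distrib[of "\<lambda>u. u * _"] cong: if_cong)
    qed
    have "((\<lambda>t. f (\<gamma> (- t))) has_real_derivative partial (i, \<alpha>) f z * (- 1)) (at 0)"
      by (rule DERIV_chain2[of "\<lambda>t. f (\<gamma> t)"]) (use d in \<open>auto intro!: derivative_eq_intros\<close>)
    then have "partial (i, \<alpha>) f z * (- 1) = partial (i, \<alpha>) f z"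
      unfolding sym using d by (rule DERIV_unique)
    then show ?thesis by simp
  qed
  show ?thesis
  proof (cases "z (0, 0) = 0 \<and> z (1, 0) = 0")
    case True
    then show ?thesis using refl0[OF f] by simp
  next
    case False
    \<comment> \<open>By \<open>rot\<close> the transverse gradients of \<open>f\<close> and
      \<open>g\<close> are both orthogonal to the nonzero vector with entries
      \<open>z (0, 0)\<close> and \<open>z (1, 0)\<close>, hence linearly dependent;
      \<open>?D\<close> is their determinant.\<close>
    let ?D = "partial (0, \<alpha>) f z * partial (1, \<alpha>) g z - partial (1, \<alpha>) f z * partial (0, \<alpha>) g z"
    have "z (0, 0) * ?D = (z (0, 0) * partial (0, \<alpha>) f z + z (1, 0) * partial (1, \<alpha>) f z) * partial (1, \<alpha>) g z
        - (z (0, 0) * partial (0, \<alpha>) g z + z (1, 0) * partial (1, \<alpha>) g z) * partial (1, \<alpha>) f z"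
      by (simp add: algebra_simps)
    then have "z (0, 0) * ?D = 0" using rot[OF f] rot[OF g] by simp
    moreover have "z (1, 0) * ?D = (z (0, 0) * partial (0, \<alpha>) g z + z (1, 0) * partial (1, \<alpha>) g z) * partial (0, \<alpha>) f z
        - (z (0, 0) * partial (0, \<alpha>) f z + z (1, 0) * partial (1, \<alpha>) f z) * partial (0, \<alpha>) g z"
      by (simp add: algebra_simps)
    then have "z (1, 0) * ?D = 0" using rot[OF f] rot[OF g] by simp
    ultimately show ?thesis using False by auto
  qed
qed

text \<open>Even polynomials in two variables s and t are generated by s^2, s t and t^2, which are
  the restrictions of q . q, q . p and p . p to the axis, with the same degrees.\<close>

lemma even_polynomial_lift:
  assumes n: "1 \<le> n" and G: "carrier G \<subseteq> carrier (orthogonal_group n)"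
    and f': "wpoly D 1 1 f'" and even: "\<And>z. z \<in> phase_space 1 1 \<Longrightarrow> f' (\<lambda>c. - z c) = f' z"
  shows "\<exists>f. wpoly D 1 n f \<and> invariant_on G (diagonal_action 1 n) (phase_space 1 n) f \<and>
           (\<forall>z\<in>phase_space 1 1. f z = f' z)"
proof -
  obtain E a where E: "finite E" "\<And>e. e \<in> E \<Longrightarrow> (\<Sum>c\<in>coords 1 1. e c) \<in> D"
    "\<And>z. z \<in> phase_space 1 1 \<Longrightarrow> f' z = (\<Sum>e\<in>E. a e * (\<Prod>c\<in>coords 1 1. z c ^ e c))"
    using f' unfolding wpoly_def by blast
  have c11: "coords 1 1 = {(0, 0), (1, 0)}" by (auto simp: coords_def)
  define F where "F = {e \<in> E. even (e (0, 0) + e (1, 0))}"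
  \<comment> \<open>In a monomial of even degree both exponents have the same parity. This parity
    becomes the exponent of q . p, and the remaining factors pair up into squares.\<close>
  define L where "L = (\<lambda>(e :: nat \<times> nat \<Rightarrow> nat) y. block_product n 0 0 y ^ (e (0, 0) div 2) *
     block_product n 1 1 y ^ (e (1, 0) div 2) * block_product n 0 1 y ^ (e (0, 0) mod 2))"
  have inv: "invariant_on G (diagonal_action 1 n) (phase_space 1 n) (block_product n i j)"
    if "i < 2" "j < 2" for i j
    using that by (intro block_product_invariant[OF G]) auto
  have bp: "wpoly {2} 1 n (block_product n i j)" if "i < 2" "j < 2" for i j
    using that by (intro block_product_homogeneous) auto
  show ?thesis
  proof (intro exI[of _ "\<lambda>y. \<Sum>e\<in>F. a e * L e y"] conjI ballI)
    show "wpoly D 1 n (\<lambda>y. \<Sum>e\<in>F. a e * L e y)"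
    proof (intro wpoly_sum wpoly_cmult)
      show "finite F" using E(1) by (simp add: F_def)
      fix e assume e: "e \<in> F"
      have h: "wpoly {e (0, 0) div 2 * 2 + e (1, 0) div 2 * 2 + e (0, 0) mod 2 * 2} 1 n (L e)"
        unfolding L_def by (intro homogeneous_mult homogeneous_power bp) auto
      have "even (e (0, 0)) = even (e (1, 0))" using e by (auto simp: F_def)
      then have "e (0, 0) mod 2 = e (1, 0) mod 2" by presburger
      then have "e (0, 0) div 2 * 2 + e (1, 0) div 2 * 2 + e (0, 0) mod 2 * 2 = e (0, 0) + e (1, 0)"
        by presburger
      also have "\<dots> \<in> D" using E(2)[of e] e by (simp add: c11 F_def)
      finally show "wpoly D 1 n (L e)" using h by (auto elim: wpoly_mono)
    qed
    show "invariant_on G (diagonal_action 1 n) (phase_space 1 n) (\<lambda>y. \<Sum>e\<in>F. a e * L e y)"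
      using inv[of 0 0] inv[of 0 1] inv[of 1 1] by (simp add: invariant_on_def L_def)
    fix z assume z: "z \<in> phase_space 1 1"
    have neg: "(\<lambda>c. - z c) \<in> phase_space 1 1" using z by (simp add: phase_space_def)
    \<comment> \<open>Averaging over the sign cancels the terms of odd degree, so that their
      coefficients need no discussion.\<close>
    have "f' z = (f' z + f' (\<lambda>c. - z c)) / 2" using even[OF z] by simp
    also have "\<dots> = (\<Sum>e\<in>E. if even (e (0, 0) + e (1, 0)) then a e * (z (0, 0) ^ e (0, 0) * z (1, 0) ^ e (1, 0)) else 0)"
      unfolding E(3)[OF z] E(3)[OF neg] sum.distrib[symmetric] sum_divide_distrib
      by (intro sum.cong refl) (auto simp: c11 power_minus[of "z _"] uminus_power_if)
    also have "\<dots> = (\<Sum>e\<in>F. a e * (z (0, 0) ^ e (0, 0) * z (1, 0) ^ e (1, 0)))"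
      unfolding F_def using E(1) by (simp add: sum.inter_filter)
    also have "\<dots> = (\<Sum>e\<in>F. a e * L e z)"
    proof (intro sum.cong refl arg_cong[where f = "\<lambda>u. a _ * u"])
      fix e assume e: "e \<in> F"
      have "even (e (0, 0)) = even (e (1, 0))" using e by (auto simp: F_def)
      then have m: "e (0, 0) mod 2 = e (1, 0) mod 2" by presburger
      have p: "x ^ k = (x * x) ^ (k div 2) * x ^ (k mod 2)" for x :: real and k
        unfolding power2_eq_square[symmetric] power_mult[symmetric] power_add[symmetric] by simp
      show "z (0, 0) ^ e (0, 0) * z (1, 0) ^ e (1, 0) = L e z"
        unfolding L_def block_product_axis[OF n z] p[of "z (0, 0)" "e (0, 0)"] p[of "z (1, 0)" "e (1, 0)"] m
        by (simp add: power_mult_distrib mult_ac)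
    qed
    finally show "(\<Sum>e\<in>F. a e * L e z) = f' z" by simp
  qed
qed

lemma quotient_axis_orbifold:
  fixes n :: nat and G :: "real mat monoid"
  assumes n: "2 \<le> n" and G: "G = orthogonal_group n \<or> G = special_orthogonal_group n"
  shows "graded_regularly_symplectomorphic
    (quotient_space 1 n (moment_zero_set 1 n) G (diagonal_action 1 n))
    (linear_symplectic_orbifold 1 (sign_group 1 True))"
proof -
  let ?V = "phase_space 1 n" and ?V' = "phase_space 1 1" and ?Z = "moment_zero_set 1 n"
  let ?G' = "unitary_group 1\<lparr>carrier := sign_group 1 True\<rparr>"
  let ?O = "orbit G (diagonal_action 1 n)"
  have n1: "1 \<le> n" using n by simp
  have Gsub: "carrier (special_orthogonal_group n) \<subseteq> carrier G" "carrier G \<subseteq> carrier (orthogonal_group n)"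
    using G by (auto simp: special_orthogonal_group_def)
  have ga: "group_action G ?V (diagonal_action 1 n)"
    using G group_action_orthogonal group_action_special_orthogonal by auto
  interpret group_action G ?V "diagonal_action 1 n" by (rule ga)
  have V'V: "?V' \<subseteq> ?V" and V'Z: "?V' \<subseteq> ?Z"
    using phase_space_1_1_subset[OF n1] phase_space_1_1_subset_zero_set[OF n1] by auto
  have ZV: "?Z \<subseteq> ?V" by (auto simp: moment_zero_set_def)
  have homc: "wpoly {1} 1 1 (\<lambda>z. z c)" if "c \<in> coords 1 n" for c
  proof (cases "c \<in> coords 1 1")
    case True then show ?thesis by (rule homogeneous_coord)
  next
    case False
    \<comment> \<open>Coordinates off the axis vanish on it, and the zero polynomial is homogeneous
      of every degree.\<close>
    show ?thesis by (rule wpoly_cong[OF wpoly_zero]) (use False in \<open>unfold phase_space_def, blast\<close>)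
  qed
  \<comment> \<open>The squared norms of q and p, written in the shape required by
    \<open>mem_orbit_axis_coords\<close> for the weights (1, 0) and (0, 1).\<close>
  define sq where "sq = (\<lambda>y::point. \<Sum>\<beta><n. (1 * y (0, \<beta>) + 0 * y (1, \<beta>))^2)"
  define sp where "sp = (\<lambda>y::point. \<Sum>\<beta><n. (0 * y (0, \<beta>) + 1 * y (1, \<beta>))^2)"
  have zero: "y = (\<lambda>c. 0)" if y: "y \<in> ?Z" and "sq y = 0" "sp y = 0" for y
  proof
    fix c :: "nat \<times> nat"
    have "y (0, \<beta>) = 0" "y (1, \<beta>) = 0" if "\<beta> < n" for \<beta>
      using that \<open>sq y = 0\<close> \<open>sp y = 0\<close> by (simp_all add: sq_def sp_def sum_nonneg_eq_0_iff)
    note y0 = this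
    obtain i \<beta> where c: "c = (i, \<beta>)" by force
    show "y c = 0"
    proof (cases "c \<in> coords 1 n")
      case True
      then have "i = 0 \<or> i = 1" "\<beta> < n" by (auto simp: c coords_def)
      then show ?thesis using y0 c by auto
    next
      case False
      then show ?thesis using y ZV unfolding phase_space_def by blast
    qed
  qed
  have surj: "\<exists>z\<in>?V'. y \<in> ?O z" if y: "y \<in> ?Z" for y
  proof -
    consider "sq y \<noteq> 0" | "sp y \<noteq> 0" | "sq y = 0" "sp y = 0" by blast
    then show ?thesis
    proof cases
      case 1
      then show ?thesis
        using mem_orbit_axis_coords[OF n Gsub(1) y] axis_coords_in unfolding sq_def by blast
    next
      case 2
      then show ?thesis
        using mem_orbit_axis_coords[OF n Gsub(1) y] axis_coords_in unfolding sp_def by blast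
    next
      case 3
      have "y \<in> ?V'" unfolding zero[OF y 3] by (simp add: phase_space_def)
      then show ?thesis using orbit_refl[of y] y ZV by blast
    qed
  qed
  show ?thesis
    unfolding linear_symplectic_orbifold_def
  proof (rule symplectomorphic_by_section[where \<iota> = "\<lambda>z. z"])
    show "group_action G ?V (diagonal_action 1 n)" by (rule ga)
    show "?Z \<subseteq> ?V" by (rule ZV)
    show "group_action ?G' ?V' (unitary_action 1)" by (rule group_action_sign_group)
    show "z \<in> ?Z" if "z \<in> ?V'" for z using that V'Z by blast
    show "\<exists>z\<in>?V'. y \<in> ?O z" if "y \<in> ?Z" for y using that by (rule surj)
    show "z' \<in> ?O z \<longleftrightarrow> z' \<in> orbit ?G' (unitary_action 1) z" if "z \<in> ?V'" "z' \<in> ?V'" for z z'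
      using orbit_axis_iff[OF n Gsub that] orbit_sign_group[OF that(1), of True] by simp
    show "continuous_on ?V' (\<lambda>z. z)" by (rule continuous_on_id)
    show "openin (top_of_set ?Z) {y \<in> ?Z. \<exists>z\<in>U. y \<in> ?O z}" (is "openin _ ?W")
      if U: "openin (top_of_set ?V') U" for U
    proof (subst openin_subopen, intro ballI)
      obtain T where T: "open T" "U = T \<inter> ?V'" using U by (auto simp: openin_open)
      fix y\<^sub>0 assume "y\<^sub>0 \<in> ?W"
      then obtain z where y0: "y\<^sub>0 \<in> ?Z" and z: "z \<in> U" "y\<^sub>0 \<in> ?O z" by blast
      have zV': "z \<in> ?V'" using z(1) T by blast
      have z0: "z \<in> ?V" using zV' V'V by blast
      have bp0: "block_product n i j y\<^sub>0 = z (i, 0) * z (j, 0)" if "i < 2" "j < 2" for i j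
      proof -
        have "block_product n i j y\<^sub>0 = block_product n i j z"
          using that by (intro invariant_on_orbit[OF block_product_invariant[OF Gsub(2)] z0 z(2)]) auto
        then show ?thesis by (simp add: block_product_axis[OF n1 zV'])
      qed
      show "\<exists>S. openin (top_of_set ?Z) S \<and> y\<^sub>0 \<in> S \<and> S \<subseteq> ?W"
      proof (cases "z (0, 0) = 0 \<and> z (1, 0) = 0")
        case False
        \<comment> \<open>With weights taken from \<open>z\<close> itself, s q + t p at
          \<open>y\<^sub>0\<close> is the positive multiple \<open>s * s + t * t\<close> of the unit
          vector carrying \<open>z\<close>; so the local coordinates of \<open>y\<^sub>0\<close> are
          \<open>z\<close> and not its negative.\<close>
        define s t where "s = z (0, 0)" and "t = z (1, 0)"
        define r where "r = (\<lambda>y::point. \<Sum>\<beta><n. (s * y (0, \<beta>) + t * y (1, \<beta>))^2)"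
        define A where "A = {y \<in> ?Z. r y \<noteq> 0}"
        have cr: "continuous_on S r" for S
          unfolding r_def by (intro continuous_intros continuous_on_coord)
        have Ao: "openin (top_of_set ?Z) A"
          using continuous_openin_preimage[OF cr[of ?Z], of UNIV "- {0}"]
          by (auto simp: A_def vimage_def Int_def openin_open)
        have ca: "continuous_on A (axis_coords n s t)"
        proof (rule continuous_on_coordinatewise_then_product)
          fix c :: "nat \<times> nat"
          show "continuous_on A (\<lambda>y. axis_coords n s t y c)"
            by (cases c; cases "fst c < 2 \<and> snd c = 0")
               (auto simp: axis_coords_def A_def r_def intro!: continuous_intros continuous_on_coord)
        qed
        define S where "S = A \<inter> axis_coords n s t -` U"
        have "openin (top_of_set A) S"
          unfolding S_def using axis_coords_in by (intro continuous_openin_preimage[OF ca _ U]) auto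
        then have So: "openin (top_of_set ?Z) S" using Ao by (rule openin_trans)
        have bq: "(\<Sum>\<beta><n. y\<^sub>0 (i, \<beta>) * (s * y\<^sub>0 (0, \<beta>) + t * y\<^sub>0 (1, \<beta>)))
            = s * block_product n i 0 y\<^sub>0 + t * block_product n i 1 y\<^sub>0" for i
          unfolding block_product_def sum_distrib_left sum.distrib[symmetric]
          by (intro sum.cong refl) (simp add: algebra_simps)
        have st: "s * s + t * t > 0" using False by (simp add: s_def t_def sum_squares_gt_zero_iff)
        have r0: "r y\<^sub>0 = (s * s + t * t)^2"
        proof -
          have "r y\<^sub>0 = s * (\<Sum>\<beta><n. y\<^sub>0 (0, \<beta>) * (s * y\<^sub>0 (0, \<beta>) + t * y\<^sub>0 (1, \<beta>)))
              + t * (\<Sum>\<beta><n. y\<^sub>0 (1, \<beta>) * (s * y\<^sub>0 (0, \<beta>) + t * y\<^sub>0 (1, \<beta>)))"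
            unfolding r_def sum_distrib_left sum.distrib[symmetric]
            by (intro sum.cong refl) (simp add: algebra_simps power2_eq_square)
          also have "\<dots> = (s * s + t * t)^2"
            unfolding bq by (simp add: bp0 s_def t_def algebra_simps power2_eq_square)
          finally show ?thesis .
        qed
        have "axis_coords n s t y\<^sub>0 = z"
        proof
          fix c :: "nat \<times> nat"
          obtain i \<alpha> where c: "c = (i, \<alpha>)" by force
          show "axis_coords n s t y\<^sub>0 c = z c"
          proof (cases "i < 2 \<and> \<alpha> = 0")
            case True
            have "axis_coords n s t y\<^sub>0 c = (s * block_product n i 0 y\<^sub>0 + t * block_product n i 1 y\<^sub>0) / sqrt (r y\<^sub>0)"
              using True by (simp add: c axis_coords_def bq r_def)
            also have "\<dots> = z (i, 0) * (s * s + t * t) / sqrt ((s * s + t * t)^2)"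
              unfolding r0 using True by (simp add: bp0 s_def t_def algebra_simps)
            also have "\<dots> = z (i, 0)" using st by auto
            finally show ?thesis using True c by simp
          next
            case False
            then show ?thesis using zV' unfolding c phase_space_1_1_iff by (auto simp: axis_coords_def)
          qed
        qed
        then have "y\<^sub>0 \<in> S" using y0 z(1) r0 st by (auto simp: S_def A_def)
        moreover have "S \<subseteq> ?W"
          using mem_orbit_axis_coords[OF n Gsub(1)] by (auto simp: S_def A_def r_def)
        ultimately show ?thesis using So by blast
      next
        case True
        \<comment> \<open>Identifying the axis points with the plane provides a ball around the
          origin inside the given open set. The local coordinates used above break down
          here.\<close>
        define \<iota> where "\<iota> = (\<lambda>(a, b) (i, \<alpha>). if i = (0::nat) \<and> \<alpha> = (0::nat) then a else if i = 1 \<and> \<alpha> = 0 then b else (0::real))"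
        have c\<iota>: "continuous_on UNIV \<iota>"
        proof (rule continuous_on_coordinatewise_then_product)
          fix c :: "nat \<times> nat"
          have "(\<lambda>x. \<iota> x c) = (if c = (0, 0) then fst else if c = (1, 0) then snd else (\<lambda>x. 0))"
            by (cases c) (auto simp: \<iota>_def fun_eq_iff)
          then show "continuous_on UNIV (\<lambda>x. \<iota> x c)"
            using continuous_on_fst[OF continuous_on_id, of "UNIV :: (real \<times> real) set"]
              continuous_on_snd[OF continuous_on_id, of "UNIV :: (real \<times> real) set"]
            by (simp only: split: if_split) simp
        qed
        have \<iota>z: "\<iota> (w (0, 0), w (1, 0)) = w" if w: "w \<in> ?V'" for w
          by (rule phase_space_1_1_ext[OF _ w]) (auto simp: \<iota>_def phase_space_1_1_iff)
        have "open (\<iota> -` T)" using open_vimage[OF T(1) c\<iota>] .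
        moreover have "(0, 0) \<in> \<iota> -` T" using \<iota>z[OF zV'] True z(1) T(2) by simp
        ultimately obtain \<epsilon> where \<epsilon>: "\<epsilon> > 0" "ball (0, 0) \<epsilon> \<subseteq> \<iota> -` T" by (meson open_contains_ball)
        \<comment> \<open>This squared norm is constant on orbits, so smallness at \<open>y\<close>
          passes to every axis point in the orbit of \<open>y\<close>.\<close>
        define q where "q = (\<lambda>y. block_product n 0 0 y + block_product n 1 1 y)"
        define S where "S = {y \<in> ?Z. q y < \<epsilon>^2}"
        have cq: "continuous_on ?Z q"
          unfolding q_def block_product_def by (intro continuous_intros continuous_on_coord)
        have "openin (top_of_set ?Z) S"
          using continuous_openin_preimage[OF cq, of UNIV "{..<\<epsilon>^2}"]
          by (auto simp: S_def vimage_def Int_def openin_open)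
        moreover have "y\<^sub>0 \<in> S" using y0 \<epsilon>(1) bp0[of 0 0] bp0[of 1 1] True by (simp add: S_def q_def)
        moreover have "S \<subseteq> ?W"
        proof
          fix y assume y: "y \<in> S"
          then have yZ: "y \<in> ?Z" by (simp add: S_def)
          obtain w where w: "w \<in> ?V'" "y \<in> ?O w" using surj[OF yZ] by blast
          have wV: "w \<in> ?V" using w(1) V'V by blast
          have "block_product n i i y = w (i, 0) * w (i, 0)" if "i < 2" for i
          proof -
            have "block_product n i i y = block_product n i i w"
              using that by (intro invariant_on_orbit[OF block_product_invariant[OF Gsub(2)] wV w(2)]) auto
            then show ?thesis by (simp add: block_product_axis[OF n1 w(1)])
          qed
          then have "(w (0, 0))^2 + (w (1, 0))^2 < \<epsilon>^2"
            using y by (simp add: S_def q_def power2_eq_square)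
          then have "sqrt ((w (0, 0))^2 + (w (1, 0))^2) < \<epsilon>"
            using \<epsilon>(1) by (intro real_less_lsqrt) auto
          then have "(w (0, 0), w (1, 0)) \<in> ball (0, 0) \<epsilon>" by (simp add: dist_Pair_Pair dist_real_def)
          then have "w \<in> U" using \<epsilon>(2) \<iota>z[OF w(1)] w(1) T(2) by force
          then show "y \<in> ?W" using w(2) yZ by blast
        qed
        ultimately show ?thesis by blast
      qed
    qed
    show "wpoly D 1 1 f" if "wpoly D 1 n f" for D f
      by (rule wpoly_compose[where \<iota> = "\<lambda>z. z", OF that homc]) (use V'V in auto)
    show "\<exists>f. wpoly D 1 n f \<and> invariant_on G (diagonal_action 1 n) ?V f \<and> (\<forall>z\<in>?V'. f z = f' z)"
      if f': "wpoly D 1 1 f'" "invariant_on ?G' (unitary_action 1) ?V' f'" for D f'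
    proof (rule even_polynomial_lift[OF n1 Gsub(2) f'(1)])
      fix z assume z: "z \<in> ?V'"
      have "(\<lambda>c. - z c) \<in> orbit ?G' (unitary_action 1) z" by (simp add: orbit_sign_group[OF z])
      then show "f' (\<lambda>c. - z c) = f' z" by (rule invariant_on_orbit[OF f'(2) z])
    qed
    show "poisson 1 n f g z = poisson 1 1 f g z"
      if f: "polynomial_on 1 n f" "invariant_on G (diagonal_action 1 n) ?V f"
        and g: "polynomial_on 1 n g" "invariant_on G (diagonal_action 1 n) ?V g" and z: "z \<in> ?V'" for f g z
    proof -
      let ?h = "\<lambda>\<alpha>. partial (0, \<alpha>) f z * partial (1, \<alpha>) g z - partial (1, \<alpha>) f z * partial (0, \<alpha>) g z"
      have l1: "{..<1} = {0::nat}" by auto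
      have "(\<Sum>\<alpha><n. ?h \<alpha>) = (\<Sum>\<alpha><n. if \<alpha> = 0 then ?h 0 else 0)"
        using transverse_bracket_zero[OF n Gsub(1) f g z] by (intro sum.cong refl) auto
      then have "(\<Sum>\<alpha><n. ?h \<alpha>) = ?h 0" using n by simp
      then show ?thesis by (simp add: poisson_def l1)
    qed
    show "invariant_on G (diagonal_action 1 n) ?V (poisson 1 n f g)"
      if "polynomial_on 1 n f" "invariant_on G (diagonal_action 1 n) ?V f"
        "polynomial_on 1 n g" "invariant_on G (diagonal_action 1 n) ?V g" for f g
      using Gsub(2) that by (rule poisson_invariant_on_orthogonal)
    show "invariant_on ?G' (unitary_action 1) ?V' (poisson 1 1 f g)"
      if "polynomial_on 1 1 f" "invariant_on ?G' (unitary_action 1) ?V' f"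
        "polynomial_on 1 1 g" "invariant_on ?G' (unitary_action 1) ?V' g" for f g
      using that by (rule poisson_invariant_on_sign_group)
  qed
qed

theorem theorem4p3:
  fixes k n :: nat
  assumes "k \<ge> 1" and "n \<ge> 1"
  shows "((\<exists>N \<Gamma>. finite \<Gamma> \<and> subgroup \<Gamma> (unitary_group N) \<and>
             graded_regularly_symplectomorphic
               (symplectic_quotient_O k n) (linear_symplectic_orbifold N \<Gamma>))
           \<longleftrightarrow> k = 1 \<or> n = 1)
       \<and> ((\<exists>N \<Gamma>. finite \<Gamma> \<and> subgroup \<Gamma> (unitary_group N) \<and>
             graded_regularly_symplectomorphic
               (symplectic_quotient_SO k n) (linear_symplectic_orbifold N \<Gamma>))
           \<longleftrightarrow> k = 1 \<or> n = 1)"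
proof -
  have main: "(\<exists>N \<Gamma>. finite \<Gamma> \<and> subgroup \<Gamma> (unitary_group N) \<and>
      graded_regularly_symplectomorphic
        (quotient_space k n (moment_zero_set k n) G (diagonal_action k n))
        (linear_symplectic_orbifold N \<Gamma>)) \<longleftrightarrow> k = 1 \<or> n = 1" (is "?L \<longleftrightarrow> ?R")
    if G: "G = (if b then orthogonal_group n else special_orthogonal_group n)" for G b
  proof
    have G': "G = orthogonal_group n \<or> G = special_orthogonal_group n" using G by simp
    show ?R if ?L
    proof (rule ccontr)
      assume "\<not> ?R"
      then have "2 \<le> k" "2 \<le> n" using assms by auto
      then show False using that quotient_not_orbifold[OF _ _ G'] by blast
    qed
    assume ?R
    \<comment> \<open>For \<open>k = n = 1\<close> the first case has to be taken: the special
      orthogonal group is trivial there, while the second case always produces the group of both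
      signs.\<close>
    consider "n = 1" | "k = 1" "2 \<le> n" using \<open>?R\<close> assms(2) by force
    then show ?L
    proof cases
      case 1
      have "graded_regularly_symplectomorphic
          (quotient_space k n (moment_zero_set k n) G (diagonal_action k n))
          (linear_symplectic_orbifold k (sign_group k b))"
        using quotient_line_orbifold[OF G[unfolded 1], of k] by (simp only: 1)
      then show ?L using finite_sign_group subgroup_sign_group by blast
    next
      case 2
      have "graded_regularly_symplectomorphic
          (quotient_space k n (moment_zero_set k n) G (diagonal_action k n))
          (linear_symplectic_orbifold 1 (sign_group 1 True))"
        using quotient_axis_orbifold[OF 2(2) G'] by (simp only: 2(1))
      then show ?L using finite_sign_group subgroup_sign_group by blast
    qed
  qed
  show ?thesis
    unfolding symplectic_quotient_O_def symplectic_quotient_SO_def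
    using main[of _ True] main[of _ False] by simp
qed

end
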